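(* Let $N\ge2$ and let $p$, $q$, $c$ be generic. The quantum determinant of the elliptic quantum algebra $\mathcal{A}_{q,p}(\widehat{\mathfrak{gl}}_N)$ is group-like for its quasi-Hopf coproduct $\Delta$: $$\Delta\,\mathrm{qdet}\,L(z)=\mathrm{qdet}\,L\big(zq^{-c^{(2)}/2};\,pq^{-2c^{(2)}}\big)\otimes \mathrm{qdet}\,L\big(zq^{c^{(1)}/2};\,p\big),$$ where the second argument records the dependence of $L(z)=L(z;p)$ on the elliptic nome.
   Context: Parameters. $p$ (elliptic nome) and $q$ (deformation parameter) are nonzero complex numbers with $|p|<1$ and $|q|<1$ (so that the infinite products below converge); determinations of the fractional powers of $p$, $q$, $z$ occurring below are fixed. Set $\omega=e^{2i\pi/N}$ and $\omega^{x/2}=e^{i\pi x/N}$. Special functions. $(z;p_1,\dots,p_m)_\infty=\prod_{n_1,\dots,n_m\ge 0}(1-z\,p_1^{n_1}\cdots p_m^{n_m})$ and $\Theta_p(z)=(z;p)_\infty(pz^{-1};p)_\infty(p;p)_\infty$. $R$-matrix. Let $e_{a,b}$ be the elementary $N\times N$ matrices. Define $R(z)=\sum_{a,b,c,d=1}^N R_{a,c}^{b,d}(z)\,e_{a,b}\otimes e_{c,d}$ with $$R_{a,c}^{b,d}(z)=\eta(z)\,S_{a,c}^b(z)\,\omega^{(a+c-b-d)/2}\,\delta^{(\mathrm{mod}\,N)}_{a+c,\,b+d},$$ $$S_{a,c}^b(z)=z^{\frac{2(b-a)}{N}}q^{\frac{2(c-b)}{N}}p^{\frac{(b-a)(c-b)}{N}}\frac{\Theta_{p^N}(p^{N+c-a}q^2z^2)}{\Theta_{p^N}(p^{N+c-b}z^2)\,\Theta_{p^N}(p^{N+b-a}q^2)},$$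 $$\eta(z)=\frac{z^{2/N}}{\kappa_N(z^2)}\,\frac{(p^N;p^N)_\infty^3}{(p;p)_\infty^3}\,\frac{\Theta_p(q^2)\,\Theta_p(pz^2)}{\Theta_p(q^2z^2)},$$ $$\frac1{\kappa_N(z^2)}=\frac{(q^{2N}z^{-2};p,q^{2N})_\infty(q^2z^2;p,q^{2N})_\infty(pz^{-2};p,q^{2N})_\infty(pq^{2N-2}z^2;p,q^{2N})_\infty}{(q^{2N}z^2;p,q^{2N})_\infty(q^2z^{-2};p,q^{2N})_\infty(pz^2;p,q^{2N})_\infty(pq^{2N-2}z^{-2};p,q^{2N})_\infty}.$$ Set $\widehat R(z)=\tau_N(q^{1/2}z^{-1})\,R(z)$ with $\tau_N(z)=z^{\frac2N-2}\,\dfrac{\Theta_{q^{2N}}(qz^2)}{\Theta_{q^{2N}}(qz^{-2})}$. Values at points where zeros and poles of the factors cancel are understood by continuity. The algebra. $\mathcal{A}_{q,p}(\widehat{\mathfrak{gl}}_N)$ is the associative unital algebra generated by elements $L_{i,j}[n]$ ($1\le i,j\le N$, $n\in\mathbb{Z}$) together with an invertible central element $q^c$ ($c$ is the central charge), encoded in $L_{i,j}(z)=\sum_{n\in\mathbb{Z}}L_{i,j}[n]z^{-n}$ and in the Lax matrix $L(z)=L(z;p)=\sum_{i,j}L_{i,j}(z)\,e_{i,j}$, with defining relations $$\widehat R_{12}(z/w)\,L_1(z)\,L_2(w)=L_2(w)\,L_1(z)\,\widehat R^{*}_{12}(z/w),$$ where $L_1(z)=L(z)\otimes\mathbb{I}$,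 $L_2(z)=\mathbb{I}\otimes L(z)$ and $\widehat R^*_{12}(z)=\widehat R_{12}(z)\big|_{p\to p^*=pq^{-2c}}$. Coproduct. The quasi-Hopf coproduct is the algebra morphism given by $$\Delta L(z;p)=\Big(1\otimes L(zq^{c^{(1)}/2};p)\Big)\cdot\Big(L(zq^{-c^{(2)}/2};pq^{-2c^{(2)}})\otimes 1\Big),\qquad \Delta c=c\otimes1+1\otimes c\equiv c^{(1)}+c^{(2)},$$ where $\cdot$ is the product of $N\times N$ matrices, $c^{(1)}=c\otimes 1$, $c^{(2)}=1\otimes c$, and the displayed $p$-argument of $L$ indicates the nome of the corresponding elliptic algebra (the nome in the first tensor factor is shifted to $pq^{-2c^{(2)}}$). Quantum determinant. $\mathrm{qdet}\,L(z)=\sum_{\sigma\in\mathfrak{S}_N}\mathrm{sgn}(\sigma)\,L_{1,\sigma(1)}(z)\,L_{2,\sigma(2)}(zq^{-1})\cdots L_{N,\sigma(N)}(zq^{1-N})$; $\mathrm{qdet}\,L(z;p')$ denotes the same expression formed with $L(z;p')$. Genericity. "Generic $p$, $q$, $c$" means that there is no functional relation among $p$, $q$, $c$ and that they do not obey any algebraic relation such as $c=-N$ or $q$ being a root of unity. *)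

theory Defs
  imports
    "HOL-Algebra.QuotRing"
    "HOL-Combinatorics.Permutations"
    "HOL-Complex_Analysis.Complex_Analysis"
begin

section \<open>Infinite products and fractional powers\<close>

text \<open>\<open>qpoch z [p1, ..., pm]\<close> is the multiple infinite product
  $(z;p_1,\dots,p_m)_\infty$, written as an iterated product (it converges absolutely when all
  nomes have modulus less than one).\<close>

fun qpoch :: "complex \<Rightarrow> complex list \<Rightarrow> complex" where
  "qpoch z [] = 1 - z"
| "qpoch z (p # ps) = prodinf (\<lambda>n. qpoch (z * p ^ n) ps)"

definition theta :: "complex \<Rightarrow> complex \<Rightarrow> complex" where
  "theta p z = qpoch z [p] * qpoch (p / z) [p] * qpoch p [p]"

text \<open>The determinations of all fractional powers are given by one function \<open>lg\<close> choosing a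
  logarithm of every nonzero complex number; no continuity is imposed on the choice.\<close>

definition log_choice :: "(complex \<Rightarrow> complex) \<Rightarrow> bool" where
  "log_choice lg \<longleftrightarrow> (\<forall>x. x \<noteq> 0 \<longrightarrow> exp (lg x) = x)"

definition cpow :: "(complex \<Rightarrow> complex) \<Rightarrow> complex \<Rightarrow> complex \<Rightarrow> complex" where
  "cpow lg x s = exp (s * lg x)"


section \<open>The elliptic R-matrix\<close>

text \<open>The functions of the spectral parameter $z$ are written in the variable \<open>u\<close> with
  $z = e^u$, $z^s = e^{su}$. In this variable they are meromorphic on the whole plane,
  fractional powers included. In \<open>S_coeff\<close> the subtraction on natural numbers never truncates, since
  the indices lie in $\{1,\dots,N\}$.\<close>

definition S_coeff ::
  "(complex \<Rightarrow> complex) \<Rightarrow> nat \<Rightarrow> complex \<Rightarrow> complex \<Rightarrow> nat \<Rightarrow> nat \<Rightarrow> nat \<Rightarrow> complex \<Rightarrow> complex" where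
  "S_coeff lg N q p a c b u =
     exp (2 * (of_nat b - of_nat a) / of_nat N * u)
     * cpow lg q (2 * (of_nat c - of_nat b) / of_nat N)
     * cpow lg p ((of_nat b - of_nat a) * (of_nat c - of_nat b) / of_nat N)
     * (theta (p ^ N) (p ^ (N + c - a) * q\<^sup>2 * (exp u)\<^sup>2)
        / (theta (p ^ N) (p ^ (N + c - b) * (exp u)\<^sup>2)
           * theta (p ^ N) (p ^ (N + b - a) * q\<^sup>2)))"

definition inv_kappa :: "nat \<Rightarrow> complex \<Rightarrow> complex \<Rightarrow> complex \<Rightarrow> complex" where
  "inv_kappa N q p x =
     (let Q = q ^ (2 * N); f = (\<lambda>y. qpoch y [p, Q]) in
      (f (Q / x) * f (q\<^sup>2 * x) * f (p / x) * f (p * q ^ (2 * N - 2) * x))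
      / (f (Q * x) * f (q\<^sup>2 / x) * f (p * x) * f (p * q ^ (2 * N - 2) / x)))"

definition eta :: "nat \<Rightarrow> complex \<Rightarrow> complex \<Rightarrow> complex \<Rightarrow> complex" where
  "eta N q p u =
     exp (2 / of_nat N * u) * inv_kappa N q p ((exp u)\<^sup>2)
     * (qpoch (p ^ N) [p ^ N] ^ 3 / qpoch p [p] ^ 3)
     * (theta p (q\<^sup>2) * theta p (p * (exp u)\<^sup>2) / theta p (q\<^sup>2 * (exp u)\<^sup>2))"

text \<open>\<open>R_coeff lg N q p a c b d\<close> is the coefficient $R_{a,c}^{b,d}$ of $e_{a,b}\otimes e_{c,d}$.\<close>

definition R_coeff ::
  "(complex \<Rightarrow> complex) \<Rightarrow> nat \<Rightarrow> complex \<Rightarrow> complex \<Rightarrow> nat \<Rightarrow> nat \<Rightarrow> nat \<Rightarrow> nat \<Rightarrow> complex \<Rightarrow> complex" where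
  "R_coeff lg N q p a c b d u =
     (if (a + c) mod N = (b + d) mod N
      then eta N q p u * S_coeff lg N q p a c b u
           * exp (\<i> * of_real pi * (of_nat a + of_nat c - of_nat b - of_nat d) / of_nat N)
      else 0)"

definition tau :: "nat \<Rightarrow> complex \<Rightarrow> complex \<Rightarrow> complex" where
  "tau N q v =
     exp ((2 / of_nat N - 2) * v)
     * (theta (q ^ (2 * N)) (q * (exp v)\<^sup>2) / theta (q ^ (2 * N)) (q / (exp v)\<^sup>2))"

text \<open>In the variable \<open>u\<close>, the factor $\tau_N(q^{1/2}z^{-1})$ is \<open>tau\<close> at \<open>lg q / 2 - u\<close>. The closed
  formula \<open>Rhat_formula\<close> can be of the form $0/0$ or $0\cdot\infty$ at isolated points, where division
  by zero would give a wrong value; \<open>Rhat\<close> takes the limit there. Note that \<open>Rhat\<close> is a function of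
  $z$ again, and not of \<open>u\<close>.\<close>

definition Rhat_formula ::
  "(complex \<Rightarrow> complex) \<Rightarrow> nat \<Rightarrow> complex \<Rightarrow> complex \<Rightarrow> nat \<Rightarrow> nat \<Rightarrow> nat \<Rightarrow> nat \<Rightarrow> complex \<Rightarrow> complex" where
  "Rhat_formula lg N q p a c b d u = tau N q (lg q / 2 - u) * R_coeff lg N q p a c b d u"

definition Rhat ::
  "(complex \<Rightarrow> complex) \<Rightarrow> nat \<Rightarrow> complex \<Rightarrow> complex \<Rightarrow> nat \<Rightarrow> nat \<Rightarrow> nat \<Rightarrow> nat \<Rightarrow> complex \<Rightarrow> complex" where
  "Rhat lg N q p a c b d x = remove_sings (Rhat_formula lg N q p a c b d) (lg x)"

definition regular_points ::
  "(complex \<Rightarrow> complex) \<Rightarrow> nat \<Rightarrow> complex \<Rightarrow> complex set \<Rightarrow> complex set" where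
  "regular_points lg N q P =
     {x. x \<noteq> 0 \<and> (\<forall>p\<in>P. \<forall>a\<in>{1..N}. \<forall>c\<in>{1..N}. \<forall>b\<in>{1..N}. \<forall>d\<in>{1..N}.
            \<not> is_pole (Rhat_formula lg N q p a c b d) (lg x))}"

definition shift_nome :: "(complex \<Rightarrow> complex) \<Rightarrow> complex \<Rightarrow> complex \<Rightarrow> complex \<Rightarrow> complex" where
  "shift_nome lg q p c = p * cpow lg q (- 2 * c)"

text \<open>Genericity as multiplicative independence of $p$, $q$ and $q^c$. It excludes in particular
  $q$ a root of unity and $c = -N$.\<close>

definition generic :: "(complex \<Rightarrow> complex) \<Rightarrow> complex \<Rightarrow> complex \<Rightarrow> complex \<Rightarrow> bool" where
  "generic lg q p c \<longleftrightarrow>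
     (\<forall>k l m :: int. p powi k * q powi l * cpow lg q c powi m = 1 \<longrightarrow> k = 0 \<and> l = 0 \<and> m = 0)"


section \<open>Formal series over a monoid\<close>

text \<open>All complex functions on a monoid in which every element has finitely many factorizations,
  multiplied by convolution. For the monoid of words this is the ring of noncommutative formal
  series, in which infinite combinations such as $\sum_n L_{i,j}[n] z^{-n}$ make sense; for pairs of
  words it is the completed tensor square of that ring.\<close>

definition series_ring :: "'m monoid \<Rightarrow> ('m \<Rightarrow> complex) ring" where
  "series_ring M =
     \<lparr>carrier = {f. \<forall>m. m \<notin> carrier M \<longrightarrow> f m = 0},
      monoid.mult = (\<lambda>f g m. \<Sum>(x, y)\<in>{(x, y). x \<in> carrier M \<and> y \<in> carrier M \<and> x \<otimes>\<^bsub>M\<^esub> y = m}. f x * g y),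
      monoid.one = (\<lambda>m. if m = \<one>\<^bsub>M\<^esub> then 1 else 0),
      ring.zero = (\<lambda>m. 0),
      ring.add = (\<lambda>f g m. f m + g m)\<rparr>"

definition series_const :: "'m monoid \<Rightarrow> complex \<Rightarrow> 'm \<Rightarrow> complex" where
  "series_const M k = (\<lambda>m. if m = \<one>\<^bsub>M\<^esub> then k else 0)"

lemma ring_series_ring:
  assumes "Group.monoid M"
    and fin: "\<And>m. finite {(x, y). x \<in> carrier M \<and> y \<in> carrier M \<and> x \<otimes>\<^bsub>M\<^esub> y = m}"
  shows "ring (series_ring M)"
proof -
  interpret M: Group.monoid M by fact
  let ?D = "\<lambda>m. {(x, y). x \<in> carrier M \<and> y \<in> carrier M \<and> x \<otimes>\<^bsub>M\<^esub> y = m}"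
  let ?R = "series_ring M"
  have ab: "abelian_group ?R"
  proof (rule abelian_groupI)
    fix f assume f: "f \<in> carrier ?R"
    show "\<exists>g\<in>carrier ?R. g \<oplus>\<^bsub>?R\<^esub> f = \<zero>\<^bsub>?R\<^esub>"
      using f by (intro bexI[of _ "\<lambda>m. - f m"]) (auto simp: series_ring_def)
  qed (simp_all add: series_ring_def fun_eq_iff add_ac)
  have mon: "Group.monoid ?R"
  proof (rule monoidI)
    fix f g assume "f \<in> carrier ?R" "g \<in> carrier ?R"
    have "(\<Sum>(x, y)\<in>?D m. f x * g y) = 0" if "m \<notin> carrier M" for m
    proof -
      have D: "?D m = {}" using that by auto
      show ?thesis unfolding D by simp
    qed
    then show "f \<otimes>\<^bsub>?R\<^esub> g \<in> carrier ?R" unfolding series_ring_def by simp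
  next
    show "\<one>\<^bsub>?R\<^esub> \<in> carrier ?R" by (auto simp: series_ring_def)
  next
    fix f g h
    assume "f \<in> carrier ?R" "g \<in> carrier ?R" "h \<in> carrier ?R"
    have "(\<Sum>(t, z)\<in>?D m. (\<Sum>(x, y)\<in>?D t. f x * g y) * h z)
        = (\<Sum>(x, s)\<in>?D m. f x * (\<Sum>(y, z)\<in>?D s. g y * h z))" for m
    proof -
      have "(\<Sum>(t, z)\<in>?D m. (\<Sum>(x, y)\<in>?D t. f x * g y) * h z)
          = (\<Sum>r\<in>?D m. \<Sum>k\<in>?D (fst r). f (fst k) * g (snd k) * h (snd r))"
        by (simp add: case_prod_beta sum_distrib_right)
      also have "\<dots> = (\<Sum>(r, k)\<in>(SIGMA r:?D m. ?D (fst r)). f (fst k) * g (snd k) * h (snd r))"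
        by (rule sum.Sigma) (use fin in blast)+
      also have "\<dots> = (\<Sum>(r, k)\<in>(SIGMA r:?D m. ?D (snd r)). f (fst r) * g (fst k) * h (snd k))"
        by (rule sum.reindex_bij_witness[where
              i = "\<lambda>((x, s), (y, z)). ((x \<otimes>\<^bsub>M\<^esub> y, z), (x, y))" and
              j = "\<lambda>((t, z), (x, y)). ((x, y \<otimes>\<^bsub>M\<^esub> z), (y, z))"])
          (auto simp: M.m_assoc)
      also have "\<dots> = (\<Sum>r\<in>?D m. \<Sum>k\<in>?D (snd r). f (fst r) * g (fst k) * h (snd k))"
        by (rule sum.Sigma[symmetric]) (use fin in blast)+
      also have "\<dots> = (\<Sum>(x, s)\<in>?D m. f x * (\<Sum>(y, z)\<in>?D s. g y * h z))"
        by (simp add: case_prod_beta sum_distrib_left mult.assoc)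
      finally show ?thesis .
    qed
    then show "f \<otimes>\<^bsub>?R\<^esub> g \<otimes>\<^bsub>?R\<^esub> h = f \<otimes>\<^bsub>?R\<^esub> (g \<otimes>\<^bsub>?R\<^esub> h)"
      unfolding series_ring_def by (simp add: fun_eq_iff)
  next
    fix f assume f: "f \<in> carrier ?R"
    have "(\<Sum>(x, y)\<in>?D m. (if x = \<one>\<^bsub>M\<^esub> then 1 else 0) * f y) = f m" for m
    proof (cases "m \<in> carrier M")
      case True
      have "(\<Sum>(x, y)\<in>?D m. (if x = \<one>\<^bsub>M\<^esub> then 1 else 0) * f y)
          = (\<Sum>(x, y)\<in>{(\<one>\<^bsub>M\<^esub>, m)}. (if x = \<one>\<^bsub>M\<^esub> then 1 else 0) * f y)"
        by (rule sum.mono_neutral_right[OF fin]) (use True in \<open>auto split: if_splits\<close>)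
      then show ?thesis by simp
    next
      case False
      then have D: "?D m = {}" by auto
      show ?thesis unfolding D using False f by (simp add: series_ring_def)
    qed
    then show "\<one>\<^bsub>?R\<^esub> \<otimes>\<^bsub>?R\<^esub> f = f" unfolding series_ring_def by (simp add: fun_eq_iff)
    have "(\<Sum>(x, y)\<in>?D m. f x * (if y = \<one>\<^bsub>M\<^esub> then 1 else 0)) = f m" for m
    proof (cases "m \<in> carrier M")
      case True
      have "(\<Sum>(x, y)\<in>?D m. f x * (if y = \<one>\<^bsub>M\<^esub> then 1 else 0))
          = (\<Sum>(x, y)\<in>{(m, \<one>\<^bsub>M\<^esub>)}. f x * (if y = \<one>\<^bsub>M\<^esub> then 1 else 0))"
        by (rule sum.mono_neutral_right[OF fin]) (use True in \<open>auto split: if_splits\<close>)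
      then show ?thesis by simp
    next
      case False
      then have D: "?D m = {}" by auto
      show ?thesis unfolding D using False f by (simp add: series_ring_def)
    qed
    then show "f \<otimes>\<^bsub>?R\<^esub> \<one>\<^bsub>?R\<^esub> = f" unfolding series_ring_def by (simp add: fun_eq_iff)
  qed
  show ?thesis
    by (rule ringI[OF ab mon])
      (simp_all add: series_ring_def fun_eq_iff case_prod_beta sum.distrib algebra_simps)
qed


section \<open>The elliptic quantum algebra at a fixed value of the central charge\<close>

text \<open>The letter \<open>(i, j, n)\<close> stands for the generator $L_{i,j}[n]$.\<close>

type_synonym letter = "nat \<times> nat \<times> int"

definition words :: "nat \<Rightarrow> letter list monoid" where
  "words N = \<lparr>carrier = lists ({1..N} \<times> {1..N} \<times> UNIV), monoid.mult = (@), monoid.one = []\<rparr>"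

abbreviation free_ring :: "nat \<Rightarrow> (letter list \<Rightarrow> complex) ring" where
  "free_ring N \<equiv> series_ring (words N)"

abbreviation free_ring2 :: "nat \<Rightarrow> (letter list \<times> letter list \<Rightarrow> complex) ring" where
  "free_ring2 N \<equiv> series_ring (words N \<times>\<times> words N)"

text \<open>The formal series $L_{i,j}(z) = \sum_n L_{i,j}[n] z^{-n}$ at a number $z \ne 0$: the coefficient
  of the one-letter word $L_{i,j}[n]$ is $z^{-n}$, all other coefficients vanish.\<close>

definition L_series :: "nat \<Rightarrow> nat \<Rightarrow> complex \<Rightarrow> letter list \<Rightarrow> complex" where
  "L_series i j z =
     (\<lambda>w. case w of [(i', j', n)] \<Rightarrow> if i' = i \<and> j' = j then z powi (- n) else 0 | _ \<Rightarrow> 0)"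

text \<open>Entry in row $(a,c)$ and column $(e,f)$ of
  $\widehat R_{12}(z/w) L_1(z) L_2(w) - L_2(w) L_1(z) \widehat R^*_{12}(z/w)$.\<close>

definition RLL_entry ::
  "(complex \<Rightarrow> complex) \<Rightarrow> nat \<Rightarrow> complex \<Rightarrow> complex \<Rightarrow> complex \<Rightarrow> nat \<Rightarrow> nat \<Rightarrow> nat \<Rightarrow> nat
     \<Rightarrow> complex \<Rightarrow> complex \<Rightarrow> letter list \<Rightarrow> complex" where
  "RLL_entry lg N q p ch a c e f z w =
     (\<lambda>v. (\<Sum>b\<in>{1..N}. \<Sum>d\<in>{1..N}. Rhat lg N q p a c b d (z / w)
             * (L_series b e z \<otimes>\<^bsub>free_ring N\<^esub> L_series d f w) v)
        - (\<Sum>b\<in>{1..N}. \<Sum>d\<in>{1..N}. (L_series c d w \<otimes>\<^bsub>free_ring N\<^esub> L_series a b z) v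
             * Rhat lg N q (shift_nome lg q p ch) b d e f (z / w)))"

text \<open>The defining relations of the algebra of nome \<open>p\<close> and central charge \<open>ch\<close> are imposed for the
  ratios $z/w$ in the set \<open>X\<close>. \<open>X\<close> has to consist of regular points of the two R-matrices involved;
  it is a parameter because the coproduct also brings in the R-matrix of an intermediate nome, whose
  poles must be avoided too for the coproduct to respect the relations.\<close>

definition RLL_ideal ::
  "(complex \<Rightarrow> complex) \<Rightarrow> nat \<Rightarrow> complex \<Rightarrow> complex set \<Rightarrow> complex \<Rightarrow> complex
     \<Rightarrow> (letter list \<Rightarrow> complex) set" where
  "RLL_ideal lg N q X p ch =
     genideal (free_ring N)
       {RLL_entry lg N q p ch a c e f z w | a c e f z w.
          a \<in> {1..N} \<and> c \<in> {1..N} \<and> e \<in> {1..N} \<and> f \<in> {1..N} \<and> z \<noteq> 0 \<and> w \<noteq> 0 \<and> z / w \<in> X}"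

definition ell_alg ::
  "(complex \<Rightarrow> complex) \<Rightarrow> nat \<Rightarrow> complex \<Rightarrow> complex set \<Rightarrow> complex \<Rightarrow> complex
     \<Rightarrow> (letter list \<Rightarrow> complex) set ring" where
  "ell_alg lg N q X p ch = free_ring N Quot RLL_ideal lg N q X p ch"

definition L_op ::
  "(complex \<Rightarrow> complex) \<Rightarrow> nat \<Rightarrow> complex \<Rightarrow> complex set \<Rightarrow> complex \<Rightarrow> complex
     \<Rightarrow> nat \<Rightarrow> nat \<Rightarrow> complex \<Rightarrow> (letter list \<Rightarrow> complex) set" where
  "L_op lg N q X p ch i j z = RLL_ideal lg N q X p ch +>\<^bsub>free_ring N\<^esub> L_series i j z"

definition qdet ::
  "('r, 'x) ring_scheme \<Rightarrow> nat \<Rightarrow> complex \<Rightarrow> (nat \<Rightarrow> nat \<Rightarrow> complex \<Rightarrow> 'r) \<Rightarrow> complex \<Rightarrow> 'r" where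
  "qdet R N q L z =
     (\<Oplus>\<^bsub>R\<^esub>\<sigma>\<in>{\<sigma>. \<sigma> permutes {1..N}}.
        add_pow R (sign \<sigma> :: int)
          (foldr (monoid.mult R) (map (\<lambda>i. L i (\<sigma> i) (z * q powi (1 - int i))) [1..<Suc N]) \<one>\<^bsub>R\<^esub>))"


section \<open>Tensor products and the coproduct\<close>

definition tensor_series ::
  "(letter list \<Rightarrow> complex) \<Rightarrow> (letter list \<Rightarrow> complex) \<Rightarrow> letter list \<times> letter list \<Rightarrow> complex" where
  "tensor_series f g = (\<lambda>(u, v). f u * g v)"

definition tensor_ideal ::
  "nat \<Rightarrow> (letter list \<Rightarrow> complex) set \<Rightarrow> (letter list \<Rightarrow> complex) set
     \<Rightarrow> (letter list \<times> letter list \<Rightarrow> complex) set" where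
  "tensor_ideal N I J =
     genideal (free_ring2 N)
       ({tensor_series f \<one>\<^bsub>free_ring N\<^esub> | f. f \<in> I} \<union> {tensor_series \<one>\<^bsub>free_ring N\<^esub> g | g. g \<in> J})"

text \<open>The (completed) tensor product of the quotients by \<open>I\<close> and \<open>J\<close>, and the tensor product of two
  residue classes.\<close>

definition tensor_alg ::
  "nat \<Rightarrow> (letter list \<Rightarrow> complex) set \<Rightarrow> (letter list \<Rightarrow> complex) set
     \<Rightarrow> (letter list \<times> letter list \<Rightarrow> complex) set ring" where
  "tensor_alg N I J = free_ring2 N Quot tensor_ideal N I J"

definition tensor_class ::
  "nat \<Rightarrow> (letter list \<Rightarrow> complex) set \<Rightarrow> (letter list \<Rightarrow> complex) set
     \<Rightarrow> (letter list \<Rightarrow> complex) set \<Rightarrow> (letter list \<Rightarrow> complex) set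
     \<Rightarrow> (letter list \<times> letter list \<Rightarrow> complex) set" where
  "tensor_class N I J A B =
     (\<Union>f\<in>A. \<Union>g\<in>B. tensor_ideal N I J +>\<^bsub>free_ring2 N\<^esub> tensor_series f g)"

text \<open>Algebra morphisms from the algebra of nome $p$ and central charge $c_1+c_2$ to the tensor
  product of the algebra of nome $pq^{-2c_2}$ and central charge $c_1$ with the algebra of nome $p$
  and central charge $c_2$, with the prescribed values on $L(z)$. That $\Delta c = c_1 + c_2$ is
  expressed by the choice of the source algebra.\<close>

definition quasi_hopf_coproduct ::
  "(complex \<Rightarrow> complex) \<Rightarrow> nat \<Rightarrow> complex \<Rightarrow> complex set \<Rightarrow> complex \<Rightarrow> complex \<Rightarrow> complex
     \<Rightarrow> ((letter list \<Rightarrow> complex) set \<Rightarrow> (letter list \<times> letter list \<Rightarrow> complex) set) \<Rightarrow> bool" where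
  "quasi_hopf_coproduct lg N q X p c1 c2 \<Delta> \<longleftrightarrow>
     (let p' = shift_nome lg q p c2;
          A1 = ell_alg lg N q X p' c1; I1 = RLL_ideal lg N q X p' c1;
          A2 = ell_alg lg N q X p c2; I2 = RLL_ideal lg N q X p c2;
          T = tensor_alg N I1 I2
      in \<Delta> \<in> ring_hom (ell_alg lg N q X p (c1 + c2)) T
       \<and> (\<forall>k. \<Delta> (RLL_ideal lg N q X p (c1 + c2) +>\<^bsub>free_ring N\<^esub> series_const (words N) k)
              = tensor_ideal N I1 I2 +>\<^bsub>free_ring2 N\<^esub> series_const (words N \<times>\<times> words N) k)
       \<and> (\<forall>i\<in>{1..N}. \<forall>j\<in>{1..N}. \<forall>z. z \<noteq> 0 \<longrightarrow>
            \<Delta> (L_op lg N q X p (c1 + c2) i j z)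
            = (\<Oplus>\<^bsub>T\<^esub>k\<in>{1..N}.
                 tensor_class N I1 I2 \<one>\<^bsub>A1\<^esub> (L_op lg N q X p c2 i k (z * cpow lg q (c1 / 2)))
                 \<otimes>\<^bsub>T\<^esub>
                 tensor_class N I1 I2 (L_op lg N q X p' c1 k j (z * cpow lg q (- c2 / 2))) \<one>\<^bsub>A2\<^esub>)))"

lemma ring_free_ring: "ring (free_ring N)"
proof (rule ring_series_ring)
  show "Group.monoid (words N)" by (rule monoidI) (simp_all add: words_def)
  fix m :: "letter list"
  have "{(x, y). x \<in> carrier (words N) \<and> y \<in> carrier (words N) \<and> x \<otimes>\<^bsub>words N\<^esub> y = m}
      \<subseteq> (\<lambda>k. (take k m, drop k m)) ` {..length m}"
  proof (safe, goal_cases)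
    case (1 x y)
    then show ?case by (intro image_eqI[of _ _ "length x"]) (auto simp: words_def)
  qed
  then show "finite {(x, y). x \<in> carrier (words N) \<and> y \<in> carrier (words N) \<and> x \<otimes>\<^bsub>words N\<^esub> y = m}"
    by (rule finite_subset) simp
qed

lemma ring_free_ring2: "ring (free_ring2 N)"
proof (rule ring_series_ring)
  have "Group.monoid (words N)" by (rule monoidI) (simp_all add: words_def)
  from DirProd_monoid[OF this this] show "Group.monoid (words N \<times>\<times> words N)" .
  fix m :: "letter list \<times> letter list"
  have "{(x, y). x \<in> carrier (words N \<times>\<times> words N) \<and> y \<in> carrier (words N \<times>\<times> words N)
            \<and> x \<otimes>\<^bsub>words N \<times>\<times> words N\<^esub> y = m}
      \<subseteq> (\<lambda>(k, l). ((take k (fst m), take l (snd m)), (drop k (fst m), drop l (snd m))))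
          ` ({..length (fst m)} \<times> {..length (snd m)})"
  proof (safe, goal_cases)
    case (1 u v u' v')
    then show ?case
      by (intro image_eqI[of _ _ "(length u, length v)"]) (auto simp: words_def DirProd_def)
  qed
  then show "finite {(x, y). x \<in> carrier (words N \<times>\<times> words N) \<and> y \<in> carrier (words N \<times>\<times> words N)
            \<and> x \<otimes>\<^bsub>words N \<times>\<times> words N\<^esub> y = m}"
    by (rule finite_subset) simp
qed

end

theory Submission
  imports Defs
begin

text \<open>At the ratio $z/w = q$ the matrix $\widehat R$ is finite, symmetric in its column indices, and its
  kernel consists exactly of the antisymmetric tensors. Multiplying the RLL relation at this point from
  the right by the antisymmetrizer therefore kills its right-hand side, and the left-hand side shows
  that the $2\times2$ quantum minors of $L(z)$, $L(zq^{-1})$ are antisymmetric in their rows. Hence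
  $\sum_\sigma \mathrm{sgn}(\sigma) \prod_i L_{\kappa(i),\sigma(i)}(zq^{1-i})$ is alternating in
  $\kappa$, and expanding $\Delta\,\mathrm{qdet}\,L(z)$ over the intermediate indices $\kappa$ leaves
  only the permutations, as for the classical determinant.

  The kernel is found as follows. In a fixed weight space, the rows of $\widehat R(q)$ are the values
  at $x = p^{-a}$ of the functions $1/(\Theta(xp^bq^2)\,\Theta(xp^{s-b}q^2))$ up to factors. A
  vanishing combination of them, multiplied by suitable theta functions of nome $p^N$, is a theta
  function of degree $N$ that vanishes at all powers of $p$. Its quotient by $\Theta_p$ has a
  multiplier excluded by genericity, so it is zero, and evaluation at the poles gives the vanishing
  of the coefficients.\<close>

section \<open>Infinite products over geometric progressions\<close>

text \<open>The ratio q is the right one because consecutive arguments z q^(1-n) and z q^(-n) of the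
  determinant have exactly this ratio. The two inclusions for the kernel serve different purposes:
  that it contains the antisymmetric tensors is used for the starred matrix, that it contains
  nothing else for the unstarred one. In the coproduct the summed index is the row index of the left
  tensor factor, so both matrices belong to the algebra of nome p' = p q^(-2 c2) and central charge
  c1, and the starred one has nome p q^(-2 (c1 + c2)).

  The kernel concerns complex vectors, while the minors are noncommutative series. It is therefore
  dualized: the functional sending x to x(i,i') + x(i',i) vanishes on the kernel, hence is a complex
  combination of the rows of the matrix, and the same combination of RLL relations puts the required
  identity into the ideal. Since products do not commute, rows are first exchanged at neighbouring
  positions only, and the sign comes from an argument of the form 2 x = 0; complex constants in the
  series ring allow the division by 2.\<close>

lemma entire_quotient_bound:
  fixes g :: "complex \<Rightarrow> complex"
  assumes "g holomorphic_on UNIV" "g 0 = 1"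
  obtains K where "K \<ge> 0" "\<And>w. norm w \<le> r \<Longrightarrow> norm (g w - 1) \<le> K * norm w"
proof -
  \<comment> \<open>Removing the singularity at 0 gives g w - 1 = w * h w with h entire, so a bound
    for h on the disc yields the linear bound. Along an orbit y p^n it becomes geometric.\<close>
  define h where "h = (\<lambda>w. if w = 0 then deriv g 0 else (g w - g 0) / (w - 0))"
  have "h holomorphic_on UNIV"
    unfolding h_def using assms(1) by (rule pole_lemma) simp
  then have "continuous_on (cball 0 r) h"
    using holomorphic_on_imp_continuous_on continuous_on_subset by blast
  then have "bounded (h ` cball 0 r)"
    by (intro compact_imp_bounded compact_continuous_image) auto
  then obtain K where K: "K > 0" "\<And>w. w \<in> cball 0 r \<Longrightarrow> norm (h w) \<le> K"
    unfolding bounded_pos by auto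
  show thesis
  proof (rule that[of K])
    fix w :: complex assume w: "norm w \<le> r"
    have "g w - 1 = h w * w" by (auto simp: h_def assms(2))
    then show "norm (g w - 1) \<le> K * norm w"
      using K(2)[of w] w by (auto simp: norm_mult intro: mult_right_mono)
  qed (use K in auto)
qed

context
  fixes g :: "complex \<Rightarrow> complex" and p :: complex
  assumes g_hol: "g holomorphic_on UNIV" and g_0: "g 0 = 1" and p_small: "norm p < 1"
begin

lemma abs_convergent_prod_orbit: "abs_convergent_prod (\<lambda>n. g (y * p ^ n))"
proof -
  obtain K where K: "K \<ge> 0" "\<And>w. norm w \<le> norm y \<Longrightarrow> norm (g w - 1) \<le> K * norm w"
    using entire_quotient_bound[OF g_hol g_0] by metis
  have "summable (\<lambda>n. norm (g (y * p ^ n) - 1))"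
  proof (rule summable_comparison_test')
    show "summable (\<lambda>n. K * norm y * norm p ^ n)"
      using p_small by (intro summable_mult summable_geometric) auto
    fix n :: nat
    have "norm (y * p ^ n) \<le> norm y"
      using p_small by (simp add: norm_mult norm_power mult_left_le power_le_one)
    from K(2)[OF this] show "norm (norm (g (y * p ^ n) - 1)) \<le> K * norm y * norm p ^ n"
      by (simp add: norm_mult norm_power mult.assoc)
  qed
  then show ?thesis by (rule summable_imp_abs_convergent_prod)
qed

lemma convergent_prod_orbit: "convergent_prod (\<lambda>n. g (y * p ^ n))"
  by (rule abs_convergent_prod_imp_convergent_prod[OF abs_convergent_prod_orbit])

lemma prodinf_orbit_nonzero:
  "(\<And>n. g (y * p ^ n) \<noteq> 0) \<Longrightarrow> prodinf (\<lambda>n. g (y * p ^ n)) \<noteq> 0"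
  by (rule prodinf_nonzero[OF convergent_prod_orbit])

lemma prodinf_orbit_split:
  "prodinf (\<lambda>n. g (y * p ^ n)) = g y * prodinf (\<lambda>n. g (y * p * p ^ n))"
proof -
  have L: "(\<lambda>n. \<Prod>i\<le>n. g (y * p * p ^ i)) \<longlonglongrightarrow> prodinf (\<lambda>n. g (y * p * p ^ n))"
    by (intro convergent_prod_LIMSEQ convergent_prod_orbit)
  have "(\<lambda>n. \<Prod>i\<le>n. g (y * p ^ i)) \<longlonglongrightarrow> prodinf (\<lambda>n. g (y * p ^ n))"
    by (intro convergent_prod_LIMSEQ convergent_prod_orbit)
  then have "(\<lambda>n. \<Prod>i\<le>Suc n. g (y * p ^ i)) \<longlonglongrightarrow> prodinf (\<lambda>n. g (y * p ^ n))"
    by (rule LIMSEQ_Suc)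
  moreover have "(\<Prod>i\<le>Suc n. g (y * p ^ i)) = g y * (\<Prod>i\<le>n. g (y * p * p ^ i))" for n
    by (subst prod.atMost_Suc_shift) (simp add: mult.assoc)
  ultimately have "(\<lambda>n. g y * (\<Prod>i\<le>n. g (y * p * p ^ i))) \<longlonglongrightarrow> prodinf (\<lambda>n. g (y * p ^ n))"
    by simp
  moreover have "(\<lambda>n. g y * (\<Prod>i\<le>n. g (y * p * p ^ i))) \<longlonglongrightarrow> g y * prodinf (\<lambda>n. g (y * p * p ^ n))"
    by (intro tendsto_intros L)
  ultimately show ?thesis by (rule LIMSEQ_unique)
qed

lemma holomorphic_prodinf_orbit: "(\<lambda>y. prodinf (\<lambda>n. g (y * p ^ n))) holomorphic_on UNIV"
proof -
  have hol: "(\<lambda>y. g (y * p ^ n)) holomorphic_on A" for n A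
    using holomorphic_on_compose_gen[OF _ g_hol, of "\<lambda>y. y * p ^ n" A]
    by (simp add: o_def holomorphic_intros)
  \<comment> \<open>On the disc of radius r the n-th factor differs from 1 by at most
    \<open>K * r * norm p ^ n\<close>, which is summable and independent of the point.\<close>
  have unif: "uniform_limit (cball 0 r) (\<lambda>k y. \<Prod>n<k. g (y * p ^ n)) 
      (\<lambda>y. prodinf (\<lambda>n. g (y * p ^ n))) sequentially" for r
  proof -
    obtain K where K: "K \<ge> 0" "\<And>w. norm w \<le> r \<Longrightarrow> norm (g w - 1) \<le> K * norm w"
      using entire_quotient_bound[OF g_hol g_0] by metis
    have "uniformly_convergent_on (cball 0 r) (\<lambda>k y. \<Sum>n<k. norm (g (y * p ^ n) - 1))"
    proof (rule Weierstrass_m_test'_ev[OF always_eventually])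
      show "summable (\<lambda>n. K * r * norm p ^ n)"
        using p_small by (intro summable_mult summable_geometric) auto
      show "\<forall>n. \<forall>x\<in>cball 0 r. norm (norm (g (x * p ^ n) - 1)) \<le> K * r * norm p ^ n"
      proof safe
        fix n x assume x: "x \<in> cball (0::complex) r"
        have "norm (x * p ^ n) \<le> norm x"
          using p_small by (simp add: norm_mult norm_power mult_left_le power_le_one)
        then have "norm (x * p ^ n) \<le> r" using x by simp
        from K(2)[OF this] have "norm (g (x * p ^ n) - 1) \<le> K * (norm x * norm p ^ n)"
          by (simp add: norm_mult norm_power)
        also have "\<dots> \<le> K * (r * norm p ^ n)"
          using x K(1) by (intro mult_left_mono mult_right_mono) auto
        finally show "norm (norm (g (x * p ^ n) - 1)) \<le> K * r * norm p ^ n"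
          by (simp add: mult.assoc)
      qed
    qed
    then have "uniformly_convergent_on (cball 0 r) (\<lambda>k y. \<Prod>n<k. g (y * p ^ n))"
      by (intro uniformly_convergent_on_prod')
         (auto intro!: holomorphic_on_imp_continuous_on hol)
    then obtain l where l: "uniform_limit (cball 0 r) (\<lambda>k y. \<Prod>n<k. g (y * p ^ n)) l sequentially"
      by (auto simp: uniformly_convergent_on_def)
    have "l y = prodinf (\<lambda>n. g (y * p ^ n))" if "y \<in> cball 0 r" for y
    proof -
      have "(\<lambda>k. \<Prod>n<k. g (y * p ^ n)) \<longlonglongrightarrow> l y"
        using tendsto_uniform_limitI[OF l that] .
      moreover have "(\<lambda>k. \<Prod>n<k. g (y * p ^ n)) \<longlonglongrightarrow> prodinf (\<lambda>n. g (y * p ^ n))"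
        using convergent_prod_LIMSEQ[OF convergent_prod_orbit[of y]]
        by (subst (asm) LIMSEQ_lessThan_iff_atMost[symmetric])
      ultimately show ?thesis by (rule LIMSEQ_unique)
    qed
    with l show ?thesis by (subst uniform_limit_cong'[where g = "\<lambda>k y. \<Prod>n<k. g (y * p ^ n)" and i = l]) auto
  qed
  show ?thesis
  proof (rule holomorphic_uniform_sequence[where f = "\<lambda>k y. \<Prod>n<k. g (y * p ^ n)"])
    fix x :: complex
    have "cball x 1 \<subseteq> cball 0 (norm x + 1)" 
      by (simp add: cball_subset_cball_iff)
    from uniform_limit_on_subset[OF unif this]
    show "\<exists>d>0. cball x d \<subseteq> UNIV \<and> uniform_limit (cball x d) (\<lambda>k y. \<Prod>n<k. g (y * p ^ n))
       (\<lambda>y. prodinf (\<lambda>n. g (y * p ^ n))) sequentially"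
      by (intro exI[of _ 1]) auto
  qed (auto intro!: holomorphic_intros hol)
qed

end

text \<open>Each nome adds one infinite product whose factor is the product over the remaining
  nomes. The value 1 at 0 is carried along because convergence of the next product depends on
  it.\<close>

lemma qpoch_entire:
  "\<forall>p\<in>set ps. norm p < 1 \<Longrightarrow> (\<lambda>z. qpoch z ps) holomorphic_on UNIV \<and> qpoch 0 ps = 1"
proof (induction ps)
  case Nil
  then show ?case by (auto intro!: holomorphic_intros)
next
  case (Cons p ps)
  then have *: "(\<lambda>z. qpoch z ps) holomorphic_on UNIV" "qpoch 0 ps = 1" "norm p < 1" by auto
  have "(\<lambda>z. qpoch z (p # ps)) holomorphic_on UNIV"
    using holomorphic_prodinf_orbit[OF *] by simp
  then show ?case using *(2) by simp
qed

lemmas holomorphic_qpoch = qpoch_entire[THEN conjunct1]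

lemma qpoch_split:
  assumes "\<forall>r\<in>set (p # ps). norm r < 1"
  shows "qpoch z (p # ps) = qpoch z ps * qpoch (z * p) (p # ps)"
  using prodinf_orbit_split[of "\<lambda>z. qpoch z ps" p z] qpoch_entire[of ps] assms by simp

lemma qpoch_Cons_nonzero:
  assumes "\<forall>r\<in>set (p # ps). norm r < 1" "\<And>n. qpoch (z * p ^ n) ps \<noteq> 0"
  shows "qpoch z (p # ps) \<noteq> 0"
  using prodinf_orbit_nonzero[of "\<lambda>z. qpoch z ps" p z] qpoch_entire[of ps] assms by simp

lemma qpoch1_nonzero:
  assumes "norm p < 1" "\<And>n. z * p ^ n \<noteq> 1"
  shows "qpoch z [p] \<noteq> 0"
  using assms(1) by (intro qpoch_Cons_nonzero) (simp_all add: assms(2)[symmetric])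

lemma qpoch2_nonzero:
  assumes "norm p < 1" "norm r < 1" "\<And>m n. z * p ^ m * r ^ n \<noteq> 1"
  shows "qpoch z [p, r] \<noteq> 0"
  using assms by (intro qpoch_Cons_nonzero[of p "[r]"] qpoch1_nonzero) auto

lemma continuous_qpoch [continuous_intros]:
  assumes "continuous (at x within A) f" "\<forall>p\<in>set ps. norm p < 1"
  shows "continuous (at x within A) (\<lambda>x. qpoch (f x) ps)"
proof -
  have "isCont (\<lambda>z. qpoch z ps) z" for z
    using holomorphic_on_imp_continuous_on[OF holomorphic_qpoch[OF assms(2)]]
    by (simp add: continuous_on_eq_continuous_at)
  from isCont_tendsto_compose[OF this] show ?thesis
    using assms(1) by (simp add: continuous_within)
qed

lemma holomorphic_qpoch_compose [holomorphic_intros]: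
  assumes "f holomorphic_on A" "\<forall>p\<in>set ps. norm p < 1"
  shows "(\<lambda>x. qpoch (f x) ps) holomorphic_on A"
  using holomorphic_on_compose_gen[OF assms(1) holomorphic_qpoch[OF assms(2)]]
  by (simp add: o_def)

lemma qpoch1_split:
  assumes "norm p < 1"
  shows "qpoch z [p] = (1 - z) * qpoch (p * z) [p]"
  using qpoch_split[of p "[]" z] assms by (simp add: mult.commute[of p z] del: qpoch.simps(2))

section \<open>Theta functions and quasi-periodic entire functions\<close>

lemma theta_one: "norm p < 1 \<Longrightarrow> theta p 1 = 0"
  using qpoch_split[of p "[]" 1] by (simp add: theta_def del: qpoch.simps(2))

lemma qpoch_nome_nonzero:
  assumes "norm p < 1" shows "qpoch p [p] \<noteq> 0"
proof (rule qpoch1_nonzero[OF assms])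
  fix n
  have "norm (p * p ^ n) < 1" using assms
    using mult_left_mono[OF power_le_one[of "norm p" n], of "norm p"]
    by (simp add: norm_mult norm_power)
  then show "p * p ^ n \<noteq> 1" by auto
qed

text \<open>Passing from z to p z removes the factor 1 - z from one product and adds 1 - 1/z to the
  other; the quotient of the two is -1/z.\<close>

lemma theta_mult_nome:
  assumes "norm p < 1" "p \<noteq> 0" "z \<noteq> 0"
  shows "theta p (p * z) = - theta p z / z"
proof -
  have 1: "qpoch z [p] = (1 - z) * qpoch (p * z) [p]"
    using qpoch1_split[OF assms(1), of z] .
  have 2: "qpoch (p / (p * z)) [p] = (1 - 1 / z) * qpoch (p / z) [p]"
    using qpoch1_split[OF assms(1), of "1 / z"] assms(2) by (simp del: qpoch.simps)
  have 3: "1 - 1 / z = - (1 - z) / z" using assms by (simp add: field_simps)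
  show ?thesis unfolding theta_def 1 2 3 using assms(3) by (simp add: field_simps del: qpoch.simps)
qed

lemma theta_nonzero:
  assumes "norm p < 1" "p \<noteq> 0" "z \<noteq> 0" "\<And>k::int. z \<noteq> p powi k"
  shows "theta p z \<noteq> 0"
proof -
  have "qpoch z [p] \<noteq> 0"
  proof (rule qpoch1_nonzero)
    fix n show "z * p ^ n \<noteq> 1"
      using assms(4)[of "- int n"] assms(2) by (auto simp: power_int_minus field_simps)
  qed fact
  moreover have "qpoch (p / z) [p] \<noteq> 0"
  proof (rule qpoch1_nonzero)
    fix n show "p / z * p ^ n \<noteq> 1"
      using assms(4)[of "int (Suc n)"] assms(2,3) by (auto simp add: field_simps simp del: of_nat_Suc)
  qed fact
  ultimately show ?thesis using qpoch_nome_nonzero[OF assms(1)] by (simp add: theta_def del: qpoch.simps(2))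
qed

lemma continuous_theta [continuous_intros]:
  assumes "continuous (at x) f" "f x \<noteq> 0" "norm p < 1"
  shows "continuous (at x) (\<lambda>x. theta p (f x))"
  unfolding theta_def using assms by (intro continuous_intros) auto

lemma holomorphic_theta_exp [holomorphic_intros]:
  assumes "f holomorphic_on A" "norm p < 1"
  shows "(\<lambda>u. theta p (exp (f u))) holomorphic_on A"
  unfolding theta_def using assms by (intro holomorphic_intros) auto

text \<open>The sign and the power of p stay existential: what is used later is that \<sigma> is a
  sign, that j is an integer, and that neither depends on z.\<close>

lemma theta_powi_shift:
  assumes "norm p < 1" "p \<noteq> 0"
  shows "\<exists>\<sigma> j. \<sigma>\<^sup>2 = 1 \<and> (\<forall>z. z \<noteq> 0 \<longrightarrow>
           theta p (p powi k * z) = \<sigma> * p powi j * z powi (- k) * theta p z)"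
proof (induction k rule: int_induct[where k = 0])
  case base
  show ?case by (rule exI[of _ 1], rule exI[of _ 0]) auto
next
  case (step1 i)
  then obtain \<sigma> j where IH: "\<sigma>\<^sup>2 = 1"
    "\<And>z. z \<noteq> 0 \<Longrightarrow> theta p (p powi i * z) = \<sigma> * p powi j * z powi (- i) * theta p z" by blast
  show ?case
  proof (rule exI[of _ "-\<sigma>"], rule exI[of _ "j - i"], intro conjI allI impI)
    fix z :: complex assume z: "z \<noteq> 0"
    have "theta p (p powi (i + 1) * z) = theta p (p * (p powi i * z))"
      using assms by (simp add: power_int_add mult_ac)
    also have "\<dots> = - theta p (p powi i * z) / (p powi i * z)"
      using assms z by (intro theta_mult_nome) auto
    also have "\<dots> = - \<sigma> * p powi (j - i) * z powi (- (i + 1)) * theta p z"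
      unfolding IH(2)[OF z] using assms z by (simp add: power_int_add power_int_diff power_int_minus field_simps)
    finally show "theta p (p powi (i + 1) * z) = - \<sigma> * p powi (j - i) * z powi (- (i + 1)) * theta p z" .
  qed (use IH in auto)
next
  case (step2 i)
  then obtain \<sigma> j where IH: "\<sigma>\<^sup>2 = 1"
    "\<And>z. z \<noteq> 0 \<Longrightarrow> theta p (p powi i * z) = \<sigma> * p powi j * z powi (- i) * theta p z" by blast
  show ?case
  proof (rule exI[of _ "-\<sigma>"], rule exI[of _ "j + i - 1"], intro conjI allI impI)
    fix z :: complex assume z: "z \<noteq> 0"
    have "theta p (p powi i * z) = theta p (p * (p powi (i - 1) * z))"
      using assms by (simp add: power_int_diff mult_ac)
    also have "\<dots> = - theta p (p powi (i - 1) * z) / (p powi (i - 1) * z)"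
      using assms z by (intro theta_mult_nome) auto
    finally have "theta p (p powi (i - 1) * z) = - (p powi (i - 1) * z) * theta p (p powi i * z)"
      using assms z by (simp add: field_simps)
    also have "\<dots> = - \<sigma> * p powi (j + i - 1) * z powi (- (i - 1)) * theta p z"
      unfolding IH(2)[OF z] using assms z by (simp add: power_int_add power_int_diff power_int_minus field_simps)
    finally show "theta p (p powi (i - 1) * z) = - \<sigma> * p powi (j + i - 1) * z powi (- (i - 1)) * theta p z" .
  qed (use IH in auto)
qed

text \<open>Quasi-periodicity moves the zero p^k to 1, where the factor 1 - z splits off and the
  remaining product does not vanish. Thus all zeros are simple.\<close>

lemma deriv_theta_exp_nonzero:
  assumes "norm p < 1" "p \<noteq> 0" "exp u = p powi k"
  shows "deriv (\<lambda>u. theta p (exp u)) u \<noteq> 0"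
proof -
  obtain \<sigma> j where \<sigma>: "\<sigma>\<^sup>2 = 1"
    "\<And>z. z \<noteq> 0 \<Longrightarrow> theta p (p powi k * z) = \<sigma> * p powi j * z powi (- k) * theta p z"
    using theta_powi_shift[OF assms(1,2), of k] by blast
  define \<psi> where "\<psi> = (\<lambda>v. \<sigma> * p powi j * exp v powi (- k) *
     (qpoch (exp v * p) [p] * qpoch (p * exp (- v)) [p] * qpoch p [p]))"
  have eq: "theta p (exp v) = (1 - exp (v - u)) * \<psi> (v - u)" for v
  proof -
    have "theta p (exp v) = theta p (p powi k * exp (v - u))"
      by (simp add: assms(3)[symmetric] flip: exp_add)
    also have "\<dots> = \<sigma> * p powi j * exp (v - u) powi (- k) * theta p (exp (v - u))"
      by (rule \<sigma>) simp
    also have "\<dots> = (1 - exp (v - u)) * \<psi> (v - u)"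
      using qpoch_split[of p "[]" "exp (v - u)"] assms
      by (simp add: \<psi>_def theta_def exp_minus divide_inverse mult_ac del: qpoch.simps(2))
    finally show ?thesis .
  qed
  have hol: "(\<lambda>v. \<psi> (v - u)) holomorphic_on UNIV"
    unfolding \<psi>_def using assms by (intro holomorphic_intros) auto
  have "((\<lambda>v. (1 - exp (v - u)) * \<psi> (v - u)) has_field_derivative
     (- exp (u - u)) * \<psi> (u - u) + deriv (\<lambda>v. \<psi> (v - u)) u * (1 - exp (u - u))) (at u)"
    by (rule DERIV_mult) (auto intro!: derivative_eq_intros holomorphic_derivI[OF hol])
  then have "((\<lambda>u. theta p (exp u)) has_field_derivative - \<psi> 0) (at u)"
    by (simp add: eq)
  moreover have "\<psi> 0 \<noteq> 0"
    using \<sigma>(1) assms qpoch_nome_nonzero[OF assms(1)] by (auto simp: \<psi>_def simp del: qpoch.simps(2))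
  ultimately show ?thesis by (simp add: DERIV_imp_deriv)
qed

section \<open>Entire functions with two quasi-periods\<close>

lemma entire_divide:
  fixes F G :: "complex \<Rightarrow> complex"
  assumes F: "F holomorphic_on UNIV" and G: "G holomorphic_on UNIV"
    and zeros: "\<And>u. G u = 0 \<Longrightarrow> F u = 0 \<and> deriv G u \<noteq> 0"
  obtains h where "h holomorphic_on UNIV" "\<And>u. F u = h u * G u"
proof -
  define h where "h = (\<lambda>u. if G u = 0 then deriv F u / deriv G u else F u / G u)"
  have "h field_differentiable at u" for u
  proof -
    define fq where "fq = (\<lambda>z. if z = u then deriv F u else (F z - F u) / (z - u))"
    define gq where "gq = (\<lambda>z. if z = u then deriv G u else (G z - G u) / (z - u))"
    have fq: "fq holomorphic_on UNIV" unfolding fq_def by (rule pole_lemma) (use F in auto)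
    have gq: "gq holomorphic_on UNIV" unfolding gq_def by (rule pole_lemma) (use G in auto)
    show ?thesis
    proof (cases "G u = 0")
      case True
      \<comment> \<open>Near a common zero u the quotient equals fq / gq, a quotient of difference
        quotients, and gq u is the nonzero derivative of G.\<close>
      define U where "U = {z. gq z \<noteq> 0}"
      have "open U"
        unfolding U_def using holomorphic_on_imp_continuous_on[OF gq]
        by (intro open_Collect_neq continuous_on_const) auto
      moreover have "u \<in> U" using zeros[OF True] by (simp add: U_def gq_def)
      moreover have "(\<lambda>z. fq z / gq z) holomorphic_on U"
        using fq gq holomorphic_on_subset[of _ UNIV U] by (intro holomorphic_on_divide) (auto simp: U_def)
      moreover have "h z = fq z / gq z" if "z \<in> U" for z
      proof (cases "z = u")
        case False
        with that True have "G z \<noteq> 0" by (auto simp: U_def gq_def)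
        then show ?thesis using False True zeros[OF True] by (simp add: h_def fq_def gq_def)
      qed (simp add: h_def fq_def gq_def True)
      ultimately have "h holomorphic_on U"
        using holomorphic_transform[of "\<lambda>z. fq z / gq z" U h] by auto
      with \<open>open U\<close> \<open>u \<in> U\<close> show ?thesis using holomorphic_on_imp_differentiable_at by blast
    next
      case False
      define U where "U = {z. G z \<noteq> 0}"
      have "open U"
        unfolding U_def using holomorphic_on_imp_continuous_on[OF G]
        by (intro open_Collect_neq continuous_on_const) auto
      moreover have "u \<in> U" using False by (simp add: U_def)
      moreover have "(\<lambda>z. F z / G z) holomorphic_on U"
        using F G holomorphic_on_subset[of _ UNIV U] by (intro holomorphic_on_divide) (auto simp: U_def)
      moreover have "h z = F z / G z" if "z \<in> U" for z
        using that by (simp add: h_def U_def)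
      ultimately have "h holomorphic_on U"
        using holomorphic_transform[of "\<lambda>z. F z / G z" U h] by auto
      with \<open>open U\<close> \<open>u \<in> U\<close> show ?thesis using holomorphic_on_imp_differentiable_at by blast
    qed
  qed
  then have "h holomorphic_on UNIV" by (simp add: holomorphic_on_def field_differentiable_at_within)
  moreover have "F u = h u * G u" for u
    using zeros[of u] by (auto simp: h_def)
  ultimately show thesis by (rule that)
qed

text \<open>The codomain is arbitrary so that the lemma also applies to predicates such as
  \<open>\<Gamma> u = 0\<close>.\<close>

lemma periodic_int:
  fixes H :: "complex \<Rightarrow> 'a"
  assumes "\<And>u. H (u + L) = H u"
  shows "H (u + of_int k * L) = H u"
proof (induction k rule: int_induct[where k = 0])
  case (step1 i)
  then show ?case using assms[of "u + of_int i * L"] by (simp add: algebra_simps)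
next
  case (step2 i)
  then show ?case using assms[of "u + of_int (i - 1) * L"] by (simp add: algebra_simps)
qed auto

lemma doubly_periodic_entire_constant:
  fixes H :: "complex \<Rightarrow> complex"
  assumes hol: "H holomorphic_on UNIV" and per1: "\<And>u. H (u + 2 * of_real pi * \<i>) = H u"
    and per2: "\<And>u. H (u + L) = H u" and L: "Re L \<noteq> 0"
  shows "H u = H v"
proof -
  define K where "K = cbox (Complex (- \<bar>Re L\<bar>) 0) (Complex \<bar>Re L\<bar> (2 * pi))"
  have "continuous_on K H"
    using holomorphic_on_imp_continuous_on[OF hol] continuous_on_subset by blast
  then have "bounded (H ` K)"
    by (intro compact_imp_bounded compact_continuous_image) (auto simp: K_def)
  moreover have "H w \<in> H ` K" for w
  proof -
    \<comment> \<open>Reduction by L brings the real part into range; the later shift by a multiple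
      of 2 pi i leaves it unchanged.\<close>
    define k where "k = \<lfloor>Re w / Re L\<rfloor>"
    define w' where "w' = w + of_int (- k) * L"
    define m where "m = \<lfloor>Im w' / (2 * pi)\<rfloor>"
    define w'' where "w'' = w' + of_int (- m) * (2 * of_real pi * \<i>)"
    have "H w'' = H w"
      unfolding w''_def w'_def using periodic_int[of H, OF per1] periodic_int[of H, OF per2] by metis
    moreover have "w'' \<in> K"
    proof -
      have "Re w'' = Re L * frac (Re w / Re L)"
        using L by (simp add: w''_def w'_def frac_def k_def algebra_simps)
      then have "\<bar>Re w''\<bar> \<le> \<bar>Re L\<bar> * 1"
        using frac_lt_1[of "Re w / Re L"] frac_ge_0[of "Re w / Re L"]
        by (simp only: abs_mult) (intro mult_left_mono; simp)
      moreover have "Im w'' = 2 * pi * frac (Im w' / (2 * pi))"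
        by (simp add: w''_def frac_def m_def algebra_simps)
      then have "0 \<le> Im w''" "Im w'' \<le> 2 * pi"
        using frac_lt_1[of "Im w' / (2 * pi)"] frac_ge_0[of "Im w' / (2 * pi)"] by (simp_all add: mult_left_le)
      ultimately show ?thesis by (auto simp: K_def in_cbox_complex_iff)
    qed
    ultimately show ?thesis by (metis imageI)
  qed
  ultimately have "bounded (range H)" by (meson bounded_subset image_subsetI)
  from Liouville_theorem[OF hol this] show ?thesis by (auto simp: constant_on_def)
qed

text \<open>\<open>F u * F (v - u)\<close> is elliptic in \<open>u\<close>, hence constant, so that \<open>F\<close> is an exponential up to
  a factor.\<close>

lemma quasi_periodic_entire_eq_0:
  fixes F :: "complex \<Rightarrow> complex"
  assumes hol: "F holomorphic_on UNIV" and per1: "\<And>u. F (u + 2 * of_real pi * \<i>) = F u"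
    and per2: "\<And>u. F (u + L) = C * F u" and L: "Re L \<noteq> 0"
    and C0: "C \<noteq> 0" and C: "\<And>n::int. C \<noteq> exp (of_int n * L)"
  shows "F u = 0"
proof -
  have const: "F u * F (v - u) = F 0 * F v" for u v
  proof -
    define H where "H = (\<lambda>u. F u * F (v - u))"
    have "H u = H 0"
    proof (rule doubly_periodic_entire_constant[of H L])
      have "(\<lambda>u. F (v - u)) holomorphic_on UNIV"
        using holomorphic_on_compose_gen[OF _ hol, of "\<lambda>u. v - u" UNIV] by (simp add: o_def holomorphic_on_diff)
      then show "H holomorphic_on UNIV"
        unfolding H_def using hol by (intro holomorphic_intros)
      fix w
      show "H (w + 2 * of_real pi * \<i>) = H w"
        using per1[of "v - (w + 2 * of_real pi * \<i>)"] per1[of w] by (simp add: H_def algebra_simps)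
      show "H (w + L) = H w"
        using per2[of "v - (w + L)"] per2[of w] by (simp add: H_def algebra_simps)
    qed fact
    then show ?thesis by (simp add: H_def)
  qed
  show "F u = 0"
  proof (cases "F 0 = 0")
    case True
    then show ?thesis using const[of u "2 * u"] by simp
  next
    case False
    \<comment> \<open>Differentiating the multiplicative law gives F' = \<kappa> F. The period 2 pi
      i then forces \<kappa> to be an integer, and the shift by L gives C the excluded value exp
      (\<kappa> * L).\<close>
    define \<kappa> where "\<kappa> = deriv F 0 / F 0"
    have mult: "F (w + v) = F w * F v / F 0" for w v
      using const[of w "w + v"] False by (simp add: field_simps)
    have der: "(F has_field_derivative \<kappa> * F w) (at w)" for w
    proof -
      have "((\<lambda>v. F w * F (v - w) / F 0) has_field_derivative F w * deriv F 0 / F 0) (at w)"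
      proof -
        have "(F has_field_derivative deriv F 0) (at (w - w))"
          using holomorphic_derivI[OF hol] by simp
        then have "((\<lambda>v. F (v - w)) has_field_derivative deriv F 0 * 1) (at w)"
          by (rule DERIV_chain2) (auto intro!: derivative_eq_intros)
        from DERIV_cdivide[OF DERIV_cmult[OF this, of "F w"], of "F 0"] show ?thesis by simp
      qed
      moreover have "F w * F (v - w) / F 0 = F v" for v using mult[of w "v - w"] by simp
      ultimately show ?thesis by (simp add: \<kappa>_def mult_ac)
    qed
    have "\<exists>c. \<forall>w\<in>UNIV. F w * exp (- (\<kappa> * w)) = c"
    proof (rule has_field_derivative_zero_constant)
      fix w
      have "((\<lambda>w. F w * exp (- (\<kappa> * w))) has_field_derivative
          \<kappa> * F w * exp (- (\<kappa> * w)) + exp (- (\<kappa> * w)) * (- \<kappa>) * F w) (at w)"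
        by (rule DERIV_mult[OF der]) (auto intro!: derivative_eq_intros)
      then show "((\<lambda>w. F w * exp (- (\<kappa> * w))) has_field_derivative 0) (at w within UNIV)"
        by (simp add: mult_ac)
    qed auto
    then obtain c where c: "F w * exp (- (\<kappa> * w)) = c" for w by auto
    have "F 0 = c" using c[of 0] by simp
    have F_eq: "F w = F 0 * exp (\<kappa> * w)" for w
    proof -
      have "F w = (F w * exp (- (\<kappa> * w))) * exp (\<kappa> * w)" by (simp add: exp_minus)
      also have "\<dots> = F 0 * exp (\<kappa> * w)" unfolding c \<open>F 0 = c\<close> ..
      finally show ?thesis .
    qed
    have "exp (\<kappa> * (2 * of_real pi * \<i>)) = 1"
      using per1[of 0] F_eq[of "2 * of_real pi * \<i>"] False by simp
    then obtain n :: int where n: "Re (\<kappa> * (2 * of_real pi * \<i>)) = 0" 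
      "Im (\<kappa> * (2 * of_real pi * \<i>)) = of_int (2 * n) * pi"
      unfolding exp_eq_1 by auto
    then have "\<kappa> = of_int n" by (auto simp: complex_eq_iff)
    moreover have "exp (\<kappa> * L) = C" using per2[of 0] F_eq[of L] False by simp
    ultimately show ?thesis using C[of n] by simp
  qed
qed

section \<open>The R-matrix at $z = q$\<close>

text \<open>Independence of p and q is what genericity leaves once q^c has been absorbed into the
  nome. The same facts are needed at three nomes, the original one and two shifted ones.\<close>

locale independent_nome =
  fixes N :: nat and lg :: "complex \<Rightarrow> complex" and q p :: complex
  assumes N_ge_2: "N \<ge> 2" and log_choice: "log_choice lg"
    and q_nonzero: "q \<noteq> 0" and q_small: "norm q < 1"
    and p_nonzero: "p \<noteq> 0" and p_small: "norm p < 1"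
    and independent: "\<And>k l :: int. p powi k * q powi l = 1 \<Longrightarrow> k = 0 \<and> l = 0"
begin

lemma exp_lg_p: "exp (lg p) = p" and exp_lg_q: "exp (lg q) = q"
  using log_choice p_nonzero q_nonzero by (auto simp: log_choice_def)

lemma nome_power_small: "m > 0 \<Longrightarrow> norm (p ^ m) < 1" "m > 0 \<Longrightarrow> norm (q ^ m) < 1"
  using p_small q_small by (auto simp: norm_power power_less_one_iff)

lemma theta_nome_power_nonzero:
  assumes "z = p powi i * q powi j" "m > 0" "j \<noteq> 0 \<or> \<not> int m dvd i"
  shows "theta (p ^ m) z \<noteq> 0"
proof (rule theta_nonzero)
  fix k :: int
  show "z \<noteq> (p ^ m) powi k"
  proof
    assume "z = (p ^ m) powi k"
    then have "z = p powi (int m * k)" by (metis power_int_mult power_int_of_nat)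
    then have "p powi (i - int m * k) * q powi j = 1"
      using p_nonzero assms(1) by (simp add: power_int_diff)
    from independent[OF this] assms(3) show False by auto
  qed
qed (use nome_power_small assms p_nonzero q_nonzero in auto)

lemma theta_nome_nonzero:
  assumes "z = p powi i * q powi j" "j \<noteq> 0"
  shows "theta p z \<noteq> 0"
  using theta_nome_power_nonzero[of z i j 1] assms by simp

lemma theta_q_nonzero:
  assumes "z = q powi j" "m > 0" "\<not> int m dvd j"
  shows "theta (q ^ m) z \<noteq> 0"
proof (rule theta_nonzero)
  fix k :: int
  show "z \<noteq> (q ^ m) powi k"
  proof
    assume "z = (q ^ m) powi k"
    then have "z = q powi (int m * k)" by (metis power_int_mult power_int_of_nat)
    then have "p powi 0 * q powi (j - int m * k) = 1"
      using q_nonzero assms(1) by (simp add: power_int_diff)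
    from independent[OF this] assms(3) show False by auto
  qed
qed (use nome_power_small assms q_nonzero in auto)

text \<open>Every factor has the form 1 - p^(i+m) q^(j+2Nn). By independence it vanishes only for i
  = m = 0 and j = -2Nn, so a positive i admits negative powers of q.\<close>

lemma qpoch_two_nomes_nonzero:
  assumes "z = p powi i * q powi j" "i \<ge> 0" "i > 0 \<or> j > 0"
  shows "qpoch z [p, q ^ (2 * N)] \<noteq> 0"
proof (rule qpoch2_nonzero)
  fix m n
  show "z * p ^ m * (q ^ (2 * N)) ^ n \<noteq> 1"
  proof
    assume *: "z * p ^ m * (q ^ (2 * N)) ^ n = 1"
    have "(q ^ (2 * N)) ^ n = q powi int (2 * N * n)"
      unfolding power_int_of_nat by (rule power_mult[symmetric])
    then have "p powi (i + int m) * q powi (j + int (2 * N * n)) = z * p ^ m * (q ^ (2 * N)) ^ n"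
      unfolding assms(1) using p_nonzero q_nonzero
      by (simp only: power_int_add power_int_of_nat mult.assoc mult.left_commute simp_thms)
    with * have "i + int m = 0 \<and> j + int (2 * N * n) = 0" using independent by metis
    moreover have "int (2 * N * n) \<ge> 0" by (rule of_nat_0_le_iff)
    ultimately show False using assms(2,3) by linarith
  qed
qed (use p_small nome_power_small N_ge_2 in auto)

text \<open>At \<open>z = q\<close> the zero of \<open>tau\<close> and the pole of \<open>inv_kappa\<close> come from the same factor
  \<open>1 - q\<^sup>2 / z\<^sup>2\<close>; \<open>prefactor\<close> is \<open>tau * eta\<close> with that factor cancelled.\<close>

definition prefactor :: "complex \<Rightarrow> complex" where
  "prefactor u =
     (let Q = q ^ (2 * N); f = (\<lambda>y. qpoch y [p, Q]); x = (exp u)\<^sup>2; y = q\<^sup>2 / x in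
      exp ((2 / of_nat N - 2) * (lg q / 2 - u))
      * (qpoch (Q * y) [Q] * qpoch (Q / y) [Q] * qpoch Q [Q] / theta Q x)
      * (exp (2 / of_nat N * u)
         * ((f (Q / x) * f (q\<^sup>2 * x) * f (p / x) * f (p * q ^ (2 * N - 2) * x))
           / (f (Q * x) * (qpoch (Q * y) [Q] * f (y * p)) * f (p * x) * f (p * q ^ (2 * N - 2) / x)))
         * (qpoch (p ^ N) [p ^ N] ^ 3 / qpoch p [p] ^ 3)
         * (theta p (q\<^sup>2) * theta p (p * x) / theta p (q\<^sup>2 * x))))"

lemma tau_eta_eq_prefactor:
  assumes "(exp u)\<^sup>2 \<noteq> q\<^sup>2"
  shows "tau N q (lg q / 2 - u) * eta N q p u = prefactor u"
proof -
  define Q where "Q = q ^ (2 * N)"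
  define x where "x = (exp u)\<^sup>2"
  define y where "y = q\<^sup>2 / x"
  have Q: "norm Q < 1" unfolding Q_def using nome_power_small N_ge_2 by simp
  have x: "x \<noteq> 0" by (simp add: x_def)
  have y: "1 - y \<noteq> 0" using assms x by (simp add: y_def x_def)
  have sq: "(exp (lg q / 2 - u))\<^sup>2 = q / x"
    by (simp add: x_def exp_diff power_divide exp_lg_q flip: exp_double)
  have th: "theta Q y = (1 - y) * (qpoch (Q * y) [Q] * qpoch (Q / y) [Q] * qpoch Q [Q])"
    unfolding theta_def qpoch1_split[OF Q, of y] by (simp only: mult.assoc)
  have f: "qpoch y [p, Q] = (1 - y) * (qpoch (Q * y) [Q] * qpoch (y * p) [p, Q])"
    using qpoch_split[of p "[Q]" y] p_small Q
    by (simp only: qpoch1_split[OF Q, of y] mult.assoc list.set ball_simps simp_thms)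
  \<comment> \<open>Stated for variables, so that cancelling 1 - y is pure field algebra and the
    infinite products stay folded.\<close>
  have canc: "e * ((1 - y) * a / t) * (e' * (n / (d1 * ((1 - y) * b) * d3 * d4)) * c * r)
     = e * (a / t) * (e' * (n / (d1 * b * d3 * d4)) * c * r)" for e a t e' n d1 b d3 d4 c r
    using y by (simp add: divide_inverse)
  have ty: "q * (q / x) = y" "q / (q / x) = x" "q\<^sup>2 / x = y"
    using q_nonzero x by (simp_all add: y_def power2_eq_square)
  show ?thesis
    unfolding tau_def eta_def inv_kappa_def prefactor_def Let_def sq x_def[symmetric] Q_def[symmetric] ty th f
    by (rule canc)
qed

lemma exp_lg_q_sq: "(exp (lg q))\<^sup>2 = q\<^sup>2"
  by (simp add: exp_lg_q)

lemma prefactor_nonzero_terms: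
  shows "theta (q ^ (2 * N)) (q\<^sup>2) \<noteq> 0" "theta p (q\<^sup>2) \<noteq> 0" "theta p (p * q\<^sup>2) \<noteq> 0"
    "theta p (q\<^sup>2 * q\<^sup>2) \<noteq> 0"
    "qpoch (q ^ (2 * N) / q\<^sup>2) [p, q ^ (2 * N)] \<noteq> 0"
    "qpoch (q\<^sup>2 * q\<^sup>2) [p, q ^ (2 * N)] \<noteq> 0"
    "qpoch (p / q\<^sup>2) [p, q ^ (2 * N)] \<noteq> 0"
    "qpoch (p * q ^ (2 * N - 2) * q\<^sup>2) [p, q ^ (2 * N)] \<noteq> 0"
    "qpoch (q ^ (2 * N) * q\<^sup>2) [p, q ^ (2 * N)] \<noteq> 0"
    "qpoch p [p, q ^ (2 * N)] \<noteq> 0"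
    "qpoch (p * q\<^sup>2) [p, q ^ (2 * N)] \<noteq> 0"
    "qpoch (p * q ^ (2 * N - 2) / q\<^sup>2) [p, q ^ (2 * N)] \<noteq> 0"
    "qpoch (q ^ (2 * N)) [q ^ (2 * N)] \<noteq> 0"
    "qpoch (p ^ N) [p ^ N] \<noteq> 0" "qpoch p [p] \<noteq> 0"
proof -
  have nat: "q ^ n = q powi int n" "p = p powi 1" for n by simp_all
  have q2: "q\<^sup>2 = q powi 2" by simp
  have N2: "q ^ (2 * N - 2) = q powi (2 * int N - 2)" "q ^ (2 * N) = q powi (2 * int N)"
    using N_ge_2 by (simp_all add: of_nat_diff nat(1) del: power_int_of_nat)
  \<comment> \<open>Here N >= 2 enters: for N = 1 the argument q^2 would be the nome itself, a zero
    of theta.\<close>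
  show "theta (q ^ (2 * N)) (q\<^sup>2) \<noteq> 0"
    by (rule theta_q_nonzero[of _ 2]) (use N_ge_2 zdvd_imp_le[of "2 * int N" 2] in auto)
  show "theta p (q\<^sup>2) \<noteq> 0" by (rule theta_nome_nonzero[of _ 0 2]) auto
  show "theta p (p * q\<^sup>2) \<noteq> 0" by (rule theta_nome_nonzero[of _ 1 2]) auto
  show "theta p (q\<^sup>2 * q\<^sup>2) \<noteq> 0" by (rule theta_nome_nonzero[of _ 0 4]) (auto simp flip: power_add)
  show "qpoch (q ^ (2 * N) / q\<^sup>2) [p, q ^ (2 * N)] \<noteq> 0"
    by (rule qpoch_two_nomes_nonzero[of _ 0 "2 * int N - 2"])
       (use q_nonzero N_ge_2 in \<open>auto simp: N2 power_int_diff\<close>)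
  show "qpoch (q\<^sup>2 * q\<^sup>2) [p, q ^ (2 * N)] \<noteq> 0"
    by (rule qpoch_two_nomes_nonzero[of _ 0 4]) (auto simp flip: power_add)
  show "qpoch (p / q\<^sup>2) [p, q ^ (2 * N)] \<noteq> 0"
    by (rule qpoch_two_nomes_nonzero[of _ 1 "-2"]) (auto simp: power_int_minus divide_inverse)
  show "qpoch (p * q ^ (2 * N - 2) * q\<^sup>2) [p, q ^ (2 * N)] \<noteq> 0"
    by (rule qpoch_two_nomes_nonzero[of _ 1 "2 * int N"])
       (use q_nonzero in \<open>auto simp: N2 power_int_diff\<close>)
  show "qpoch (q ^ (2 * N) * q\<^sup>2) [p, q ^ (2 * N)] \<noteq> 0"
    by (rule qpoch_two_nomes_nonzero[of _ 0 "2 * int N + 2"])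
       (use q_nonzero in \<open>auto simp: N2 power_int_add\<close>)
  show "qpoch p [p, q ^ (2 * N)] \<noteq> 0"
    by (rule qpoch_two_nomes_nonzero[of _ 1 0]) auto
  show "qpoch (p * q\<^sup>2) [p, q ^ (2 * N)] \<noteq> 0"
    by (rule qpoch_two_nomes_nonzero[of _ 1 2]) auto
  \<comment> \<open>The exponent 2 * N - 4 of q vanishes for N = 2; it is the positive power of p
    that excludes a zero.\<close>
  show "qpoch (p * q ^ (2 * N - 2) / q\<^sup>2) [p, q ^ (2 * N)] \<noteq> 0"
  proof (rule qpoch_two_nomes_nonzero[of _ 1 "2 * int N - 4"])
    have "q powi (2 * int N - 4) = q powi (2 * int N - 2) / q powi 2"
      using power_int_diff[of q "2 * int N - 2" 2] q_nonzero by simp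
    then show "p * q ^ (2 * N - 2) / q\<^sup>2 = p powi 1 * q powi (2 * int N - 4)"
      unfolding N2 by simp
  qed auto
  show "qpoch (q ^ (2 * N)) [q ^ (2 * N)] \<noteq> 0"
    by (rule qpoch_nome_nonzero) (use nome_power_small N_ge_2 in auto)
  show "qpoch (p ^ N) [p ^ N] \<noteq> 0" "qpoch p [p] \<noteq> 0"
    by (rule qpoch_nome_nonzero; use nome_power_small N_ge_2 p_small in auto)+
qed

lemma prefactor_at_q:
  shows "prefactor (lg q) \<noteq> 0" "isCont prefactor (lg q)"
proof -
  have y: "q\<^sup>2 / q\<^sup>2 = 1" using q_nonzero by simp
  have Q: "\<forall>r\<in>set [q ^ (2 * N)]. norm r < 1" "\<forall>r\<in>set [p, q ^ (2 * N)]. norm r < 1"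
    "norm (q ^ (2 * N)) < 1" "norm p < 1"
    using nome_power_small N_ge_2 p_small by auto
  note nz = prefactor_nonzero_terms
  show "prefactor (lg q) \<noteq> 0"
    unfolding prefactor_def Let_def exp_lg_q_sq y using nz by (simp del: qpoch.simps)
  show "isCont prefactor (lg q)"
    unfolding prefactor_def Let_def
    by (intro continuous_intros Q)
       (simp_all only: exp_lg_q y nz mult_eq_0_iff divide_eq_0_iff power_eq_0_iff p_nonzero q_nonzero
          de_Morgan_disj simp_thms mult_1_right div_by_1 mult_1_left one_neq_zero)
qed

lemma S_coeff_denominator_nonzero:
  assumes "a \<in> {1..N}" "b \<in> {1..N}" "c \<in> {1..N}"
  shows "theta (p ^ N) (p ^ (N + c - b) * q\<^sup>2) \<noteq> 0"
  by (rule theta_nome_power_nonzero[of _ "int (N + c - b)" 2]) (use N_ge_2 in auto)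

lemma isCont_S_coeff:
  assumes "a \<in> {1..N}" "b \<in> {1..N}" "c \<in> {1..N}"
  shows "isCont (S_coeff lg N q p a c b) (lg q)"
  unfolding S_coeff_def
  by (intro continuous_intros)
     (use S_coeff_denominator_nonzero assms q_nonzero p_nonzero nome_power_small(1)[of N] N_ge_2
       in \<open>auto simp add: exp_lg_q\<close>)

text \<open>The value at z = q by continuity: the formula for \<open>Rhat\<close> with the cancelled
  \<open>prefactor\<close> in place of \<open>tau * eta\<close>.\<close>

definition Rq :: "nat \<Rightarrow> nat \<Rightarrow> nat \<Rightarrow> nat \<Rightarrow> complex" where
  "Rq a c b d = (if (a + c) mod N = (b + d) mod N
      then prefactor (lg q) * S_coeff lg N q p a c b (lg q)
           * exp (\<i> * of_real pi * (of_nat a + of_nat c - of_nat b - of_nat d) / of_nat N)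
      else 0)"

lemma eventually_exp_sq_neq: "eventually (\<lambda>u. (exp u)\<^sup>2 \<noteq> q\<^sup>2) (at (lg q))"
proof -
  \<comment> \<open>The solutions of e^(2u) = q^2 are lg q + pi i n, so the ball of radius 1 < pi
    contains only its centre.\<close>
  have "\<forall>\<^sub>F u in at (lg q). u \<in> ball (lg q) 1 - {lg q}"
    by (rule eventually_at_in_open) auto
  then show ?thesis
  proof eventually_elim
    case (elim u)
    show "(exp u)\<^sup>2 \<noteq> q\<^sup>2"
    proof
      assume "(exp u)\<^sup>2 = q\<^sup>2"
      then have "exp (2 * u) = exp (2 * lg q)"
        by (metis exp_double exp_lg_q)
      then obtain n :: int where n: "2 * u = 2 * lg q + (of_int (2 * n) * pi) * \<i>"
        unfolding exp_eq by auto
      then have "2 * (u - lg q) = 2 * (of_int n * pi * \<i>)" by (simp add: algebra_simps)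
      then have u: "u - lg q = of_int n * pi * \<i>" by (simp only: mult_cancel_left) simp
      have "norm (u - lg q) < 1" using elim by (simp add: dist_norm norm_minus_commute)
      then have *: "\<bar>of_int n\<bar> * pi < 1" unfolding u by (simp add: norm_mult)
      have "n \<noteq> 0" using u elim by auto
      then have "\<bar>real_of_int n\<bar> \<ge> 1" by linarith
      then have "\<bar>of_int n\<bar> * pi \<ge> 1 * pi" by (intro mult_right_mono) auto
      with * pi_gt3 show False by linarith
    qed
  qed
qed

lemma Rhat_formula_tendsto:
  assumes "a \<in> {1..N}" "b \<in> {1..N}" "c \<in> {1..N}"
  shows "Rhat_formula lg N q p a c b d \<midarrow>lg q\<rightarrow> Rq a c b d"
proof (cases "(a + c) mod N = (b + d) mod N")
  case True
  let ?e = "exp (\<i> * of_real pi * (of_nat a + of_nat c - of_nat b - of_nat d) / of_nat N)"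
  have "(\<lambda>u. prefactor u * S_coeff lg N q p a c b u * ?e) \<midarrow>lg q\<rightarrow>
      prefactor (lg q) * S_coeff lg N q p a c b (lg q) * ?e"
    using prefactor_at_q(2) isCont_S_coeff[OF assms] unfolding isCont_def by (intro tendsto_intros)
  moreover have "\<forall>\<^sub>F u in at (lg q). prefactor u * S_coeff lg N q p a c b u * ?e
      = Rhat_formula lg N q p a c b d u"
    using eventually_exp_sq_neq
  proof eventually_elim
    case (elim u)
    show ?case
      unfolding Rhat_formula_def R_coeff_def if_P[OF True] tau_eta_eq_prefactor[OF elim, symmetric]
      by (simp only: mult.assoc)
  qed
  ultimately show ?thesis unfolding Rq_def if_P[OF True] by (rule Lim_transform_eventually)
next
  case False
  then have "Rhat_formula lg N q p a c b d = (\<lambda>u. 0)" "Rq a c b d = 0"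
    by (auto simp: Rhat_formula_def R_coeff_def Rq_def fun_eq_iff)
  then show ?thesis by simp
qed

lemma Rhat_at_q:
  assumes "a \<in> {1..N}" "b \<in> {1..N}" "c \<in> {1..N}"
  shows "Rhat lg N q p a c b d q = Rq a c b d"
    and "\<not> is_pole (Rhat_formula lg N q p a c b d) (lg q)"
proof -
  show "Rhat lg N q p a c b d q = Rq a c b d"
    unfolding Rhat_def by (rule remove_sings_eqI[OF Rhat_formula_tendsto[OF assms]])
  show "\<not> is_pole (Rhat_formula lg N q p a c b d) (lg q)"
    unfolding is_pole_def using Rhat_formula_tendsto[OF assms]
    by (meson at_neq_bot not_tendsto_and_filterlim_at_infinity)
qed

end

section \<open>Linear independence of products of theta functions\<close>

text \<open>The set where g does not vanish is open and nonempty, and f is zero on it, so the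
  identity theorem applies. This transfers functional equations from the product
  \<open>h * G\<close> to \<open>h\<close>.\<close>

lemma entire_mult_eq_0:
  fixes f g :: "complex \<Rightarrow> complex"
  assumes "f holomorphic_on UNIV" "g holomorphic_on UNIV" "\<And>u. f u * g u = 0" "g u0 \<noteq> 0"
  shows "f u = 0"
proof -
  define U where "U = {z. g z \<noteq> 0}"
  have "open U"
    unfolding U_def using holomorphic_on_imp_continuous_on[OF assms(2)]
    by (intro open_Collect_neq continuous_on_const) auto
  moreover have "f z = 0" if "z \<in> U" for z using assms(3)[of z] that by (simp add: U_def)
  ultimately show ?thesis
    using analytic_continuation_open[of U UNIV f "\<lambda>_. 0" u] assms by (auto simp: U_def)
qed

context independent_nome
begin

text \<open>The logarithmic variable turns multiplication by the nome into a translation and makes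
  fractional powers of p and q unambiguous.\<close>

definition T :: "complex \<Rightarrow> complex" where "T v = theta (p ^ N) (exp v)"

lemma nome_N_small: "norm (p ^ N) < 1" using nome_power_small N_ge_2 by simp

lemma exp_mult_lg_p: "exp (of_nat n * lg p) = p ^ n" "exp (of_int k * lg p) = p powi k"
  by (simp_all add: exp_of_nat_mult exp_lg_p flip: exp_power_int)

lemma exp_mult_lg_q: "exp (of_nat n * lg q) = q ^ n" "exp (of_int k * lg q) = q powi k"
  by (simp_all add: exp_of_nat_mult exp_lg_q flip: exp_power_int)

lemma T_shift: "T (v + of_nat N * lg p) = - exp (- v) * T v"
  using theta_mult_nome[OF nome_N_small, of "exp v"] p_nonzero
  by (simp add: T_def exp_add exp_mult_lg_p exp_minus mult.commute divide_inverse)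

lemma T_2_pi: "T (v + of_int n * (2 * of_real pi * \<i>)) = T v"
proof -
  have "exp (of_int n * (2 * of_real pi * \<i>)) = (1::complex)" 
    by (simp flip: exp_power_int)
  then show ?thesis by (simp add: T_def exp_add)
qed

lemma holomorphic_T [holomorphic_intros]:
  "f holomorphic_on A \<Longrightarrow> (\<lambda>u. T (f u)) holomorphic_on A"
  unfolding T_def using nome_N_small by (intro holomorphic_intros)

lemma T_nonzero:
  assumes "v = of_int i * lg p + of_int j * lg q" "j \<noteq> 0 \<or> \<not> int N dvd i"
  shows "T v \<noteq> 0"
  unfolding T_def
  by (rule theta_nome_power_nonzero[of _ i j]) (use assms N_ge_2 in \<open>auto simp: exp_add exp_mult_lg_p exp_mult_lg_q\<close>)

lemma T_0: "T 0 = 0" unfolding T_def using theta_one[OF nome_N_small] by simp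

text \<open>Clearing denominators gives degree 2 * (card B - 1), and the bound on
  \<open>card B\<close> keeps this at most N, so that it can be padded to N, the degree of
  \<open>theta p\<close> over the period N lg p. Since H b = H (s - b), \<open>distinct\<close>
  excludes b' congruent to b and to s - b; this keeps the other \<open>H b'\<close> nonzero at the
  zero of \<open>H b0\<close> used at the end.\<close>

lemma theta_products_independent:
  fixes w :: "nat \<Rightarrow> complex" and s :: nat
  defines "H \<equiv> \<lambda>b u. T (u + of_nat b * lg p + 2 * lg q) * T (u + (of_nat s - of_nat b) * lg p + 2 * lg q)"
  assumes fin: "finite B" and card: "2 * card B \<le> N + 2"
    and distinct: "\<And>b b'. b \<in> B \<Longrightarrow> b' \<in> B \<Longrightarrow> b \<noteq> b' \<Longrightarrow>
      \<not> int N dvd int b' - int b \<and> \<not> int N dvd int s - int b' - int b"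
    and vanish: "\<And>a. a \<in> {1..N} \<Longrightarrow> (\<Sum>b\<in>B. w b / H b (- (of_nat a * lg p))) = 0"
    and b0: "b0 \<in> B"
  shows "w b0 = 0"
proof -
  define L where "L = of_nat N * lg p"
  define n where "n = card B - 1"
  define m where "m = N - 2 * n"
  have "card B > 0" using fin b0 by (auto simp: card_gt_0_iff)
  then have nm: "2 * n + m = N" "n + m > 0" using card N_ge_2 by (auto simp: n_def m_def)
  define \<Gamma>0 where "\<Gamma>0 = (\<lambda>u. \<Sum>b\<in>B. w b * (\<Prod>b'\<in>B-{b}. H b' u))"
  \<comment> \<open>The power of \<open>T\<close> raises the degree of \<open>\<Gamma>0\<close> to \<open>N\<close>; the shift \<open>4 * lg q\<close> makes the exponent
    of \<open>q\<close> in the multiplier \<open>C\<close> below nonzero.\<close>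
  define \<Gamma> where "\<Gamma> = (\<lambda>u. \<Gamma>0 u * T (u + 4 * lg q) ^ m)"
  define G where "G = (\<lambda>u. theta p (exp u))"
  define E where "E = (\<lambda>u. exp (- (2 * u + of_nat s * lg p + 4 * lg q)))"
  have H_shift: "H b (u + L) = E u * H b u" for b u
  proof -
    have "H b (u + L) = T ((u + of_nat b * lg p + 2 * lg q) + of_nat N * lg p)
         * T ((u + (of_nat s - of_nat b) * lg p + 2 * lg q) + of_nat N * lg p)"
      by (simp add: H_def L_def add_ac)
    also have "\<dots> = exp (- (u + of_nat b * lg p + 2 * lg q)) * exp (- (u + (of_nat s - of_nat b) * lg p + 2 * lg q)) * H b u"
      unfolding T_shift H_def by simp
    also have "\<dots> = E u * H b u"
      unfolding E_def exp_add[symmetric] by (simp add: algebra_simps)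
    finally show ?thesis .
  qed
  have hol_H: "H b holomorphic_on UNIV" for b unfolding H_def by (intro holomorphic_intros)
  have hol_\<Gamma>: "\<Gamma> holomorphic_on UNIV"
    unfolding \<Gamma>_def \<Gamma>0_def by (intro holomorphic_intros hol_H)
  have hol_G: "G holomorphic_on UNIV"
    unfolding G_def using p_small by (intro holomorphic_intros)
  have \<Gamma>0_shift: "\<Gamma>0 (u + L) = E u ^ n * \<Gamma>0 u" for u
  proof -
    have "(\<Prod>b'\<in>B-{b}. H b' (u + L)) = E u ^ n * (\<Prod>b'\<in>B-{b}. H b' u)" if "b \<in> B" for b
      using that fin by (simp add: H_shift prod.distrib n_def)
    then show ?thesis by (simp add: \<Gamma>0_def sum_distrib_left mult.left_commute)
  qed
  \<comment> \<open>\<open>E u ^ n\<close> contributes p^(-n s) q^(-4 n), and the m padding factors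
    contribute (-1)^m q^(-4 m).\<close>
  define c1 where "c1 = (- 1) ^ m * p powi (- int (n * s)) * q powi (- int (4 * (n + m)))"
  have \<Gamma>_shift: "\<Gamma> (u + L) = c1 * exp (- (of_nat N * u)) * \<Gamma> u" for u
  proof -
    have "T (u + L + 4 * lg q) = - exp (- (u + 4 * lg q)) * T (u + 4 * lg q)"
      using T_shift[of "u + 4 * lg q"] by (simp add: L_def add_ac)
    then have "\<Gamma> (u + L) = E u ^ n * (- exp (- (u + 4 * lg q))) ^ m * \<Gamma> u"
      by (simp only: \<Gamma>_def \<Gamma>0_shift power_mult_distrib mult_ac)
    also have "E u ^ n * (- exp (- (u + 4 * lg q))) ^ m
        = (- 1) ^ m * (exp (of_nat n * (- (2 * u + of_nat s * lg p + 4 * lg q))) * exp (of_nat m * (- (u + 4 * lg q))))"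
      unfolding E_def exp_of_nat_mult by (subst power_minus) simp
    also have "exp (of_nat n * (- (2 * u + of_nat s * lg p + 4 * lg q))) * exp (of_nat m * (- (u + 4 * lg q)))
        = exp (of_int (- int (n * s)) * lg p) * exp (of_int (- int (4 * (n + m))) * lg q) * exp (- (of_nat (2 * n + m) * u))"
      unfolding exp_add[symmetric] by (simp add: algebra_simps)
    finally show ?thesis unfolding exp_mult_lg_p exp_mult_lg_q nm c1_def by simp
  qed
  have \<Gamma>_2pi: "\<Gamma> (u + 2 * of_real pi * \<i>) = \<Gamma> u" for u
  proof -
    have "T (u + 2 * of_real pi * \<i> + x) = T (u + x)" for x
      using T_2_pi[of "u + x" 1] by (simp add: add_ac)
    then show ?thesis by (simp add: \<Gamma>_def \<Gamma>0_def H_def add.assoc)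
  qed
  have G_2pi: "G (u + 2 * of_real pi * \<i>) = G u" for u
    by (simp add: G_def exp_add)
  obtain \<sigma> j where \<sigma>: "\<sigma>\<^sup>2 = 1"
    "\<And>z. z \<noteq> 0 \<Longrightarrow> theta p (p powi int N * z) = \<sigma> * p powi j * z powi (- int N) * theta p z"
    using theta_powi_shift[OF p_small p_nonzero, of "int N"] by blast
  have G_shift: "G (u + L) = \<sigma> * p powi j * exp (- (of_nat N * u)) * G u" for u
  proof -
    have "exp (u + L) = p powi int N * exp u"
      by (simp add: L_def exp_add exp_mult_lg_p)
    moreover have "exp u powi (- int N) = exp (- (of_nat N * u))"
      by (simp add: exp_power_int)
    ultimately show ?thesis using \<sigma>(2)[of "exp u"] by (simp add: G_def)
  qed
  have \<Gamma>_zero: "\<Gamma> (- (of_nat a * lg p)) = 0" if a: "a \<in> {1..N}" for a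
  proof -
    let ?u = "- (of_nat a * lg p)"
    have nz: "H b ?u \<noteq> 0" for b
    proof -
      have "T (?u + of_nat b * lg p + 2 * lg q) \<noteq> 0"
        by (rule T_nonzero[of _ "int b - int a" 2]) (auto simp: algebra_simps)
      moreover have "T (?u + (of_nat s - of_nat b) * lg p + 2 * lg q) \<noteq> 0"
        by (rule T_nonzero[of _ "int s - int b - int a" 2]) (auto simp: algebra_simps)
      ultimately show ?thesis by (simp add: H_def)
    qed
    have "\<Gamma>0 ?u = (\<Prod>b\<in>B. H b ?u) * (\<Sum>b\<in>B. w b / H b ?u)"
      unfolding \<Gamma>0_def sum_distrib_left
    proof (rule sum.cong)
      fix b assume "b \<in> B"
      then show "w b * (\<Prod>b'\<in>B-{b}. H b' ?u) = (\<Prod>b\<in>B. H b ?u) * (w b / H b ?u)"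
        using nz[of b] by (subst prod.remove[OF fin \<open>b \<in> B\<close>]) simp
    qed auto
    then show ?thesis using vanish[OF a] by (simp add: \<Gamma>_def)
  qed
  have c1: "c1 \<noteq> 0" using p_nonzero q_nonzero by (simp add: c1_def)
  have per: "\<Gamma> (u + of_int i * L) = 0 \<longleftrightarrow> \<Gamma> u = 0" for u i
    by (rule periodic_int[of "\<lambda>u. \<Gamma> u = 0"]) (simp add: \<Gamma>_shift c1)
  have zeros: "\<Gamma> u = 0 \<and> deriv G u \<noteq> 0" if Gu: "G u = 0" for u
  proof -
    obtain k where k: "exp u = p powi k"
      using theta_nonzero[OF p_small p_nonzero, of "exp u"] Gu by (auto simp: G_def)
    \<comment> \<open>The representative in {1..N} with -a congruent to k modulo N; if N divides k
      it is N, not 0.\<close>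
    define a where "a = N - nat (k mod int N)"
    have kN: "0 \<le> k mod int N" "k mod int N < int N" using N_ge_2 by auto
    have a: "a \<in> {1..N}" using kN by (auto simp: a_def)
    have "int a = int N - k mod int N" using kN by (simp add: a_def of_nat_diff)
    then have "k = - int a + (k div int N + 1) * int N"
      using div_mult_mod_eq[of k "int N"] unfolding distrib_right by linarith
    then have "exp u = exp (of_int (- int a + (k div int N + 1) * int N) * lg p)"
      using k exp_mult_lg_p(2) by metis
    then obtain i :: int where i: "u = of_int (- int a + (k div int N + 1) * int N) * lg p + of_int (2 * i) * pi * \<i>"
      unfolding exp_eq by auto
    have u: "u = - (of_nat a * lg p) + of_int (k div int N + 1) * L + of_int i * (2 * of_real pi * \<i>)"
      unfolding i L_def by (simp add: algebra_simps)
    have "\<Gamma> u = 0"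
      unfolding u periodic_int[of "\<lambda>u. \<Gamma> u = 0", of "2 * of_real pi * \<i>", unfolded \<Gamma>_2pi, OF refl] per
      by (rule \<Gamma>_zero[OF a])
    then show ?thesis using deriv_theta_exp_nonzero[OF p_small p_nonzero k] by (simp add: G_def)
  qed
  obtain h where h: "h holomorphic_on UNIV" "\<And>u. \<Gamma> u = h u * G u"
    using entire_divide[OF hol_\<Gamma> hol_G zeros] by blast
  have hol_h: "(\<lambda>u. h (u + x)) holomorphic_on UNIV" for x
    using holomorphic_on_compose_gen[OF _ h(1), of "\<lambda>u. u + x" UNIV] by (simp add: o_def holomorphic_on_add)
  have G_nz: "G (lg q) \<noteq> 0"
    unfolding G_def by (rule theta_nome_nonzero[of _ 0 1]) (auto simp: exp_lg_q)
  \<comment> \<open>Under the shift by L both \<Gamma> and G acquire the factor exp (- N u), so the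
    multiplier of their quotient is constant.\<close>
  define C where "C = c1 / (\<sigma> * p powi j)"
  have \<sigma>0: "\<sigma> \<noteq> 0" using \<sigma>(1) by auto
  have C0: "C \<noteq> 0" using c1 \<sigma>0 p_nonzero by (simp add: C_def)
  have h0: "h u = 0" for u
  proof (rule quasi_periodic_entire_eq_0[OF h(1), of L C])
    fix u
    show "h (u + 2 * of_real pi * \<i>) = h u"
    proof -
      have "h (u + 2 * of_real pi * \<i>) - h u = 0"
      proof (rule entire_mult_eq_0[where f = "\<lambda>u. h (u + 2 * of_real pi * \<i>) - h u", OF _ hol_G _ G_nz])
        show "(\<lambda>u. h (u + 2 * of_real pi * \<i>) - h u) holomorphic_on UNIV"
          by (intro holomorphic_intros hol_h h(1))
        fix v show "(h (v + 2 * of_real pi * \<i>) - h v) * G v = 0"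
          using h(2)[of v] h(2)[of "v + 2 * of_real pi * \<i>"] \<Gamma>_2pi[of v] G_2pi[of v] by (simp add: algebra_simps)
      qed
      then show ?thesis by simp
    qed
    show "h (u + L) = C * h u"
    proof -
      have "h (u + L) - C * h u = 0"
      proof (rule entire_mult_eq_0[where f = "\<lambda>u. h (u + L) - C * h u", OF _ hol_G _ G_nz])
        show "(\<lambda>u. h (u + L) - C * h u) holomorphic_on UNIV"
          by (intro holomorphic_intros hol_h h(1))
        fix v
        have "h (v + L) * (\<sigma> * p powi j * exp (- (of_nat N * v)) * G v) = c1 * exp (- (of_nat N * v)) * (h v * G v)"
          unfolding G_shift[symmetric] h(2)[symmetric] \<Gamma>_shift[symmetric] ..
        then have "(\<sigma> * p powi j) * (h (v + L) * G v) = c1 * (h v * G v)"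
          by (simp add: mult_ac)
        moreover have "c1 = (\<sigma> * p powi j) * C" using \<sigma>0 p_nonzero by (simp add: C_def)
        ultimately have "(\<sigma> * p powi j) * (h (v + L) * G v) = (\<sigma> * p powi j) * (C * (h v * G v))"
          by (simp only: mult.assoc)
        then have "h (v + L) * G v = C * (h v * G v)" using \<sigma>0 p_nonzero by simp
        then show "(h (v + L) - C * h v) * G v = 0" by (simp add: algebra_simps)
      qed
      then show ?thesis by simp
    qed
  next
    have "norm (exp L) < 1" using nome_N_small by (simp add: L_def exp_mult_lg_p)
    then show "Re L \<noteq> 0" by auto
    show "C \<noteq> 0" by fact
    show "C \<noteq> exp (of_int i * L)" for i
    proof
      assume "C = exp (of_int i * L)"
      also have "of_int i * L = of_int (i * int N) * lg p" by (simp add: L_def)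
      finally have "c1 = p powi (i * int N) * (\<sigma> * p powi j)"
        using \<sigma>0 p_nonzero unfolding exp_mult_lg_p by (simp add: C_def field_simps)
      \<comment> \<open>Squaring removes \<sigma> and (-1)^m, leaving a relation between powers of p
        and q in which q has the nonzero exponent -8 (n + m).\<close>
      then have "c1\<^sup>2 = (p powi (i * int N) * (\<sigma> * p powi j))\<^sup>2" by simp
      moreover have "c1\<^sup>2 = (p powi (- int (n * s)))\<^sup>2 * (q powi (- int (4 * (n + m))))\<^sup>2"
        by (simp add: c1_def power_mult_distrib flip: power_mult)
      moreover have "(p powi (i * int N) * (\<sigma> * p powi j))\<^sup>2 = (p powi (i * int N + j))\<^sup>2"
        using \<sigma>(1) p_nonzero by (simp add: power_mult_distrib power_int_add)
      moreover have sq: "(x powi k)\<^sup>2 = x powi (2 * k)" for x :: complex and k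
        by (metis power_int_mult power_int_of_nat mult.commute of_nat_numeral)
      ultimately have "p powi (2 * (- int (n * s))) * q powi (2 * (- int (4 * (n + m)))) = p powi (2 * (i * int N + j))"
        by simp
      then have "p powi (2 * (- int (n * s)) - 2 * (i * int N + j)) * q powi (2 * (- int (4 * (n + m)))) = 1"
        using p_nonzero by (simp add: power_int_diff)
      then have "2 * (- int (4 * (n + m))) = 0" using independent by blast
      then show False using nm by simp
    qed
  qed
  \<comment> \<open>A zero of the first factor of \<open>H b0\<close>: every product containing
    \<open>H b0\<close> drops out, so only the b0 term of \<Gamma>0 survives.\<close>
  define u where "u = - (of_nat b0 * lg p + 2 * lg q)"
  have "H b0 u = 0" by (simp add: H_def u_def T_0)
  then have "(\<Prod>b'\<in>B-{b}. H b' u) = 0" if "b \<in> B - {b0}" for b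
    using that fin b0 by (intro prod_zero) auto
  then have "\<Gamma>0 u = w b0 * (\<Prod>b'\<in>B-{b0}. H b' u)"
    unfolding \<Gamma>0_def sum.remove[OF fin b0] by (simp add: sum.neutral)
  moreover have "H b' u \<noteq> 0" if "b' \<in> B - {b0}" for b'
  proof -
    have d: "\<not> int N dvd int b' - int b0" "\<not> int N dvd int s - int b' - int b0"
      using distinct[of b0 b'] that b0 by auto
    have "T (u + of_nat b' * lg p + 2 * lg q) \<noteq> 0"
      by (rule T_nonzero[of _ "int b' - int b0" 0]) (use d in \<open>auto simp: algebra_simps u_def\<close>)
    moreover have "T (u + (of_nat s - of_nat b') * lg p + 2 * lg q) \<noteq> 0"
      by (rule T_nonzero[of _ "int s - int b' - int b0" 0]) (use d in \<open>auto simp: algebra_simps u_def\<close>)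
    ultimately show ?thesis by (simp add: H_def)
  qed
  moreover have "T (u + 4 * lg q) \<noteq> 0"
    by (rule T_nonzero[of _ "- int b0" 2]) (auto simp: algebra_simps u_def)
  moreover have "\<Gamma> u = 0" using h(2)[of u] h0[of u] by simp
  ultimately show ?thesis using fin by (simp add: \<Gamma>_def)
qed

end

section \<open>The kernel of the R-matrix at $z = q$\<close>

context independent_nome
begin

text \<open>At z = q the powers z^(2(b-a)/N) and q^(2(c-b)/N) combine to q^(2(c-a)/N), so that b is
  confined to the last factor.\<close>

lemma S_coeff_at_q:
  assumes "a \<in> {1..N}" "b \<in> {1..N}" "c \<in> {1..N}"
  shows "S_coeff lg N q p a c b (lg q) =
    exp (2 * (of_nat c - of_nat a) / of_nat N * lg q)
    * T ((of_nat N + of_nat c - of_nat a) * lg p + 4 * lg q)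
    * (exp ((of_nat b - of_nat a) * (of_nat c - of_nat b) / of_nat N * lg p)
       / (T ((of_nat N + of_nat c - of_nat b) * lg p + 2 * lg q)
          * T ((of_nat N + of_nat b - of_nat a) * lg p + 2 * lg q)))"
proof -
  have pw: "p ^ (N + x - y) = exp ((of_nat N + of_nat x - of_nat y) * lg p)" if "y \<in> {1..N}" for x y
    using that by (simp add: of_nat_diff flip: exp_mult_lg_p)
  have pw2: "p ^ (N + x - y) * q\<^sup>2 = exp ((of_nat N + of_nat x - of_nat y) * lg p + 2 * lg q)"
    and pw4: "p ^ (N + x - y) * q\<^sup>2 * q\<^sup>2 = exp ((of_nat N + of_nat x - of_nat y) * lg p + 4 * lg q)"
    if "y \<in> {1..N}" for x y
  proof -
    have q2: "q\<^sup>2 = exp (2 * lg q)" by (simp add: exp_lg_q exp_double)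
    show "p ^ (N + x - y) * q\<^sup>2 = exp ((of_nat N + of_nat x - of_nat y) * lg p + 2 * lg q)"
      unfolding pw[OF that] q2 exp_add ..
    show "p ^ (N + x - y) * q\<^sup>2 * q\<^sup>2 = exp ((of_nat N + of_nat x - of_nat y) * lg p + 4 * lg q)"
      unfolding pw[OF that] q2 exp_add[symmetric] by (simp add: algebra_simps)
  qed
  have e: "exp (2 * (of_nat b - of_nat a) / of_nat N * lg q) * exp (2 * (of_nat c - of_nat b) / of_nat N * lg q)
      = exp (2 * (of_nat c - of_nat a) / of_nat N * lg q)"
    unfolding exp_add[symmetric] by (simp add: algebra_simps diff_divide_distrib)
  show ?thesis
    unfolding S_coeff_def cpow_def exp_lg_q e T_def pw4[OF assms(1)]
    unfolding pw2[OF assms(1)] pw2[OF assms(2)]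
    by (simp add: divide_inverse mult_ac)
qed

text \<open>With J = b - a and K = c - b, replacing b by a + c + N - b turns (J, K) into (K + N, J -
  N). The exponent changes by (J - K - N) lg p, and the quasi-periodicity of T compensates
  this.\<close>

lemma T_quotient_reflect:
  "exp ((K + of_nat N) * (J - of_nat N) / of_nat N * lg p)
     / (T (J * lg p + 2 * lg q) * T ((2 * of_nat N + K) * lg p + 2 * lg q))
   = exp (J * K / of_nat N * lg p)
     / (T ((of_nat N + K) * lg p + 2 * lg q) * T ((of_nat N + J) * lg p + 2 * lg q))"
proof -
  define X where "X = J * lg p + 2 * lg q"
  define Y where "Y = (of_nat N + K) * lg p + 2 * lg q"
  have 1: "T ((of_nat N + J) * lg p + 2 * lg q) = - exp (- X) * T X"
    using T_shift[of X] by (simp add: X_def algebra_simps)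
  have 2: "T ((2 * of_nat N + K) * lg p + 2 * lg q) = - exp (- Y) * T Y"
    using T_shift[of Y] by (simp add: Y_def algebra_simps)
  have N: "of_nat N \<noteq> (0::complex)" using N_ge_2 by simp
  have ex: "exp ((K + of_nat N) * (J - of_nat N) / of_nat N * lg p) = exp (J * K / of_nat N * lg p) * exp (- Y) / exp (- X)"
    unfolding exp_add[symmetric] exp_diff[symmetric] using N by (simp add: X_def Y_def field_simps)
  show ?thesis unfolding 1 2 ex X_def[symmetric] Y_def[symmetric]
    by (simp add: field_simps)
qed

text \<open>If b + d = a + c, replacing b by d exchanges b - a and c - b, in which the last factor
  of \<open>S_coeff_at_q\<close> is symmetric. The wrap-around by N is
  \<open>T_quotient_reflect\<close>.\<close>

lemma Rq_swap:
  assumes "a \<in> {1..N}" "b \<in> {1..N}" "c \<in> {1..N}" "d \<in> {1..N}"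
  shows "Rq a c b d = Rq a c d b"
proof (cases "(a + c) mod N = (b + d) mod N")
  case True
  have "S_coeff lg N q p a c b (lg q) = S_coeff lg N q p a c d (lg q)"
  proof -
    have "int N dvd int (b + d) - int (a + c)"
      using True by (metis mod_eq_dvd_iff of_nat_mod)
    then obtain e where e: "int (b + d) - int (a + c) = int N * e" by (elim dvdE)
    \<comment> \<open>Indices in {1..N} leave only the multiples -N, 0 and N for b + d - a -
      c.\<close>
    have "int N * e < int N * 2" "int N * (-2) < int N * e" unfolding e[symmetric] using assms by auto
    moreover have "int N > 0" using N_ge_2 by simp
    ultimately have "e < 2" "e > -2" by (simp_all only: mult_less_cancel_left_pos[of "int N"])
    then consider "e = 0" | "e = 1" | "e = -1" by linarith
    then show ?thesis
    proof cases
      case 1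
      then have "b + d = a + c" using e by simp
      then have d: "of_nat d = of_nat a + of_nat c - (of_nat b :: complex)"
        by (metis add_diff_cancel_left' of_nat_add)
      show ?thesis unfolding S_coeff_at_q[OF assms(1,2,3)] S_coeff_at_q[OF assms(1,4,3)] d
        by (simp add: algebra_simps)
    next
      case 2
      then have "b + d = a + c + N" using e by simp
      then have "of_nat b + of_nat d = of_nat a + of_nat c + (of_nat N :: complex)"
        by (metis of_nat_add)
      then have d: "of_nat d = of_nat a + of_nat c + of_nat N - (of_nat b :: complex)"
        by (simp add: algebra_simps)
      show ?thesis unfolding S_coeff_at_q[OF assms(1,2,3)] S_coeff_at_q[OF assms(1,4,3)] d
        using T_quotient_reflect[of "of_nat c - of_nat b" "of_nat b - of_nat a"]
        by (simp add: algebra_simps)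
    next
      case 3
      then have "b + d + N = a + c" using e by simp
      then have "of_nat b + of_nat d + of_nat N = of_nat a + (of_nat c :: complex)"
        by (metis of_nat_add)
      then have d: "of_nat d = of_nat a + of_nat c - of_nat N - (of_nat b :: complex)"
        by (simp add: algebra_simps)
      show ?thesis unfolding S_coeff_at_q[OF assms(1,2,3)] S_coeff_at_q[OF assms(1,4,3)] d
        using T_quotient_reflect[of "of_nat b - of_nat a" "of_nat c - of_nat b"]
        by (simp add: algebra_simps)
    qed
  qed
  then show ?thesis using True by (simp add: Rq_def add.commute[of d b] algebra_simps)
next
  case False
  then show ?thesis by (simp add: Rq_def add.commute)
qed

text \<open>The partner of b in weight s: the only d in {1..N} with b + d congruent to s modulo N.
  For b = s it is N.\<close>

definition reflect :: "nat \<Rightarrow> nat \<Rightarrow> nat" where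
  "reflect s b = (if b < s then s - b else s + N - b)"

lemma reflect_in: "s \<in> {1..N} \<Longrightarrow> b \<in> {1..N} \<Longrightarrow> reflect s b \<in> {1..N}"
  by (auto simp: reflect_def)

lemma reflect_reflect: "s \<in> {1..N} \<Longrightarrow> b \<in> {1..N} \<Longrightarrow> reflect s (reflect s b) = b"
  by (auto simp: reflect_def)

lemma add_mod_eq_reflect:
  assumes "s \<in> {1..N}" "b \<in> {1..N}" "d \<in> {1..N}"
  shows "(b + d) mod N = s mod N \<longleftrightarrow> d = reflect s b"
proof -
  have r: "(b + reflect s b) mod N = s mod N" using assms by (auto simp: reflect_def)
  have "d = reflect s b" if "(b + d) mod N = s mod N"
  proof -
    have "(b + d) mod N = (b + reflect s b) mod N" using r that by simp
    then have "int N dvd int (b + d) - int (b + reflect s b)"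
      by (metis mod_eq_dvd_iff of_nat_mod)
    then have "int N dvd int d - int (reflect s b)" by simp
    moreover have "\<bar>int d - int (reflect s b)\<bar> < int N"
      using assms(3) reflect_in[OF assms(1,2)] by auto
    ultimately show ?thesis using dvd_imp_le_int[of "int d - int (reflect s b)" "int N"] by fastforce
  qed
  with r show ?thesis by auto
qed

text \<open>Reducing the theta arguments by multiples of N lg p yields exponentials that, combined
  with the numerator, contain b only through b (s - b) / N; the rest goes into \<rho>. For a >= s
  the partner of a is s + N - a, and one argument has to be reduced twice.\<close>

lemma S_coeff_factor:
  assumes s: "s \<in> {1..N}" and a: "a \<in> {1..N}"
  obtains \<rho> where "\<rho> \<noteq> 0"
    "\<And>b. b \<in> {1..N} \<Longrightarrow> S_coeff lg N q p a (reflect s a) b (lg q)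
       = \<rho> * (exp (of_nat b * (of_nat s - of_nat b) / of_nat N * lg p)
              / (T ((of_nat b - of_nat a) * lg p + 2 * lg q)
                 * T ((of_nat s - of_nat b - of_nat a) * lg p + 2 * lg q)))"
proof -
  have N: "of_nat N \<noteq> (0::complex)" using N_ge_2 by simp
  define c where "c = reflect s a"
  have cN: "c \<in> {1..N}" unfolding c_def by (rule reflect_in[OF s a])
  define \<rho>0 where "\<rho>0 = exp (2 * (of_nat c - of_nat a) / of_nat N * lg q)
    * T ((of_nat N + of_nat c - of_nat a) * lg p + 4 * lg q)"
  have \<rho>0: "\<rho>0 \<noteq> 0"
    unfolding \<rho>0_def using T_nonzero[of _ "int N + int c - int a" 4] by simp
  define g where "g = exp ((of_nat a * of_nat a - of_nat a * of_nat s) / of_nat N * lg p)"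
  have T1: "T ((of_nat N + x) * lg p + 2 * lg q) = - exp (- (x * lg p + 2 * lg q)) * T (x * lg p + 2 * lg q)" for x
    using T_shift[of "x * lg p + 2 * lg q"] by (simp add: algebra_simps)
  show thesis
  proof (cases "a < s")
    case True
    then have c: "of_nat c = of_nat s - (of_nat a :: complex)" by (simp add: c_def reflect_def of_nat_diff)
    define \<rho> where "\<rho> = \<rho>0 * g * exp ((of_nat s - 2 * of_nat a) * lg p + 4 * lg q)"
    show thesis
    proof (rule that)
      show "\<rho> \<noteq> 0" using \<rho>0 by (simp add: \<rho>_def g_def)
      fix b assume b: "b \<in> {1..N}"
      define X where "X = (of_nat b - of_nat a) * lg p + 2 * lg q"
      define Y where "Y = (of_nat s - of_nat b - of_nat a) * lg p + 2 * lg q"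
      have e1: "T ((of_nat N + of_nat b - of_nat a) * lg p + 2 * lg q) = - exp (- X) * T X"
        using T1[of "of_nat b - of_nat a"] by (simp add: X_def add_diff_eq)
      have e2: "T ((of_nat N + of_nat c - of_nat b) * lg p + 2 * lg q) = - exp (- Y) * T Y"
        using T1[of "of_nat s - of_nat b - of_nat a"] by (simp add: Y_def c algebra_simps)
      have e3: "exp ((of_nat b - of_nat a) * (of_nat c - of_nat b) / of_nat N * lg p)
          = g * exp (of_nat b * (of_nat s - of_nat b) / of_nat N * lg p)"
        unfolding g_def exp_add[symmetric] c by (simp add: field_simps add_divide_distrib diff_divide_distrib)
      have e4: "exp ((of_nat s - 2 * of_nat a) * lg p + 4 * lg q) = exp X * exp Y"
        unfolding exp_add[symmetric] X_def Y_def by (simp add: algebra_simps)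
      show "S_coeff lg N q p a (reflect s a) b (lg q)
       = \<rho> * (exp (of_nat b * (of_nat s - of_nat b) / of_nat N * lg p)
              / (T ((of_nat b - of_nat a) * lg p + 2 * lg q)
                 * T ((of_nat s - of_nat b - of_nat a) * lg p + 2 * lg q)))"
        unfolding c_def[symmetric] S_coeff_at_q[OF a b cN] \<rho>0_def[symmetric] e1 e2 e3 \<rho>_def e4
          X_def[symmetric] Y_def[symmetric]
        by (simp add: exp_minus divide_inverse)
    qed
  next
    case False
    then have c: "of_nat c = of_nat s + of_nat N - (of_nat a :: complex)"
      using a by (simp add: c_def reflect_def of_nat_diff)
    define \<rho> where "\<rho> = - \<rho>0 * g * exp ((2 * of_nat s - 4 * of_nat a + of_nat N) * lg p + 6 * lg q)"
    show thesis
    proof (rule that)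
      show "\<rho> \<noteq> 0" using \<rho>0 by (simp add: \<rho>_def g_def)
      fix b assume b: "b \<in> {1..N}"
      define X where "X = (of_nat b - of_nat a) * lg p + 2 * lg q"
      define Y where "Y = (of_nat s - of_nat b - of_nat a) * lg p + 2 * lg q"
      have e1: "T ((of_nat N + of_nat b - of_nat a) * lg p + 2 * lg q) = - exp (- X) * T X"
        using T1[of "of_nat b - of_nat a"] by (simp add: X_def add_diff_eq)
      have e2: "T ((of_nat N + of_nat c - of_nat b) * lg p + 2 * lg q)
          = exp (- (Y + of_nat N * lg p)) * (exp (- Y) * T Y)"
      proof -
        have "T ((of_nat N + of_nat c - of_nat b) * lg p + 2 * lg q) = T (Y + of_nat N * lg p + of_nat N * lg p)"
          by (simp add: Y_def c algebra_simps)
        then show ?thesis unfolding T_shift by simp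
      qed
      have "(of_nat b - of_nat a) * (of_nat c - of_nat b) / of_nat N
          = (of_nat a * of_nat a - of_nat a * of_nat s) / of_nat N + (of_nat b - of_nat a)
            + of_nat b * (of_nat s - of_nat b) / (of_nat N :: complex)"
        unfolding c using N by (simp add: field_simps)
      then have e3: "exp ((of_nat b - of_nat a) * (of_nat c - of_nat b) / of_nat N * lg p)
          = g * exp ((of_nat b - of_nat a) * lg p) * exp (of_nat b * (of_nat s - of_nat b) / of_nat N * lg p)"
        unfolding g_def exp_add[symmetric] by (simp only: distrib_right)
      have e4: "exp ((2 * of_nat s - 4 * of_nat a + of_nat N) * lg p + 6 * lg q)
          = exp ((of_nat b - of_nat a) * lg p) * exp X * exp Y * exp (Y + of_nat N * lg p)"
        unfolding exp_add[symmetric] X_def Y_def by (simp add: algebra_simps)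
      show "S_coeff lg N q p a (reflect s a) b (lg q)
       = \<rho> * (exp (of_nat b * (of_nat s - of_nat b) / of_nat N * lg p)
              / (T ((of_nat b - of_nat a) * lg p + 2 * lg q)
                 * T ((of_nat s - of_nat b - of_nat a) * lg p + 2 * lg q)))"
        unfolding c_def[symmetric] S_coeff_at_q[OF a b cN] \<rho>0_def[symmetric] e1 e2 e3 \<rho>_def e4
          X_def[symmetric] Y_def[symmetric] exp_minus
        by (simp add: divide_inverse mult_ac)
    qed
  qed
qed

theorem Rq_kernel:
  fixes x :: "nat \<Rightarrow> nat \<Rightarrow> complex"
  assumes ker: "\<And>a c. a \<in> {1..N} \<Longrightarrow> c \<in> {1..N} \<Longrightarrow> (\<Sum>b\<in>{1..N}. \<Sum>d\<in>{1..N}. Rq a c b d * x b d) = 0"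
    and b0: "b0 \<in> {1..N}" and d0: "d0 \<in> {1..N}"
  shows "x b0 d0 + x d0 b0 = 0"
proof -
  define s where "s = (if b0 + d0 \<le> N then b0 + d0 else b0 + d0 - N)"
  have s: "s \<in> {1..N}" using b0 d0 by (auto simp: s_def)
  have "(b0 + d0) mod N = s mod N" by (simp add: s_def le_mod_geq)
  then have d0_eq: "d0 = reflect s b0" using add_mod_eq_reflect[OF s b0 d0] by simp
  define \<delta> where "\<delta> = reflect s"
  have \<delta>_in: "\<delta> b \<in> {1..N}" and \<delta>_\<delta>: "\<delta> (\<delta> b) = b" if "b \<in> {1..N}" for b
    using reflect_in[OF s that] reflect_reflect[OF s that] by (auto simp: \<delta>_def)
  define y where "y b = x b (\<delta> b) + x (\<delta> b) b" for b
  \<comment> \<open>One representative for each orbit {b, \<delta> b}, namely its smaller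
    element.\<close>
  define B where "B = {b \<in> {1..N}. b \<le> \<delta> b}"
  define k where "k b = exp (- \<i> * of_real pi * (of_nat b + of_nat (\<delta> b)) / of_nat N)
    * exp (of_nat b * (of_nat s - of_nat b) / of_nat N * lg p)" for b
  \<comment> \<open>In the sum of \<open>V b * y b\<close> over all indices a two-element orbit
    occurs twice, a fixed point once.\<close>
  define w where "w b = (if b = \<delta> b then 1 else 2) * k b * y b" for b
  have "w b = 0" if "b \<in> B" for b
  proof (rule theta_products_independent[of B s w, OF _ _ _ _ that])
    show "finite B" by (simp add: B_def)
    \<comment> \<open>For b < s the condition b <= \<delta> b reads 2 b <= s, otherwise 2 b <= s +
      N.\<close>
    have "B \<subseteq> {1..s div 2} \<union> {s..(s + N) div 2}" by (auto simp: B_def \<delta>_def reflect_def split: if_splits)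
    then have "card B \<le> card ({1..s div 2} \<union> {s..(s + N) div 2})" by (rule card_mono[rotated]) auto
    also have "\<dots> \<le> s div 2 + (Suc ((s + N) div 2) - s)"
      by (rule order_trans[OF card_Un_le]) simp
    finally show "2 * card B \<le> N + 2" using s by auto
  next
    fix b b' assume bb: "b \<in> B" "b' \<in> B" "b \<noteq> b'"
    have bN: "b \<in> {1..N}" "b' \<in> {1..N}" using bb by (auto simp: B_def)
    have "\<not> int N dvd int b' - int b"
      using bN bb(3) dvd_imp_le_int[of "int b' - int b" "int N"] by auto
    moreover have "\<not> int N dvd int s - int b' - int b"
    proof
      assume "int N dvd int s - int b' - int b"
      then have "int N dvd int s - int (b + b')" by (simp add: algebra_simps)
      then have "s mod N = (b + b') mod N" by (metis mod_eq_dvd_iff of_nat_mod of_nat_eq_iff)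
      then have "b' = \<delta> b" using add_mod_eq_reflect[OF s bN] by (simp add: \<delta>_def)
      then have "b = \<delta> b'" using \<delta>_\<delta>[OF bN(1)] by simp
      moreover have "b \<le> \<delta> b" "b' \<le> \<delta> b'" using bb by (simp_all add: B_def)
      ultimately show False using \<open>b' = \<delta> b\<close> bb(3) by linarith
    qed
    ultimately show "\<not> int N dvd int b' - int b \<and> \<not> int N dvd int s - int b' - int b" ..
  next
    fix a assume a: "a \<in> {1..N}"
    obtain \<rho> where \<rho>: "\<rho> \<noteq> 0" "\<And>b. b \<in> {1..N} \<Longrightarrow> S_coeff lg N q p a (reflect s a) b (lg q)
       = \<rho> * (exp (of_nat b * (of_nat s - of_nat b) / of_nat N * lg p)
              / (T ((of_nat b - of_nat a) * lg p + 2 * lg q)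
                 * T ((of_nat s - of_nat b - of_nat a) * lg p + 2 * lg q)))"
      using S_coeff_factor[OF s a] by blast
    define H where "H b = T (- (of_nat a * lg p) + of_nat b * lg p + 2 * lg q)
        * T (- (of_nat a * lg p) + (of_nat s - of_nat b) * lg p + 2 * lg q)" for b
    define c where "c = \<delta> a"
    have c: "c \<in> {1..N}" unfolding c_def by (rule \<delta>_in[OF a])
    have ac: "(a + c) mod N = s mod N" using add_mod_eq_reflect[OF s a c] by (simp add: c_def \<delta>_def)
    define r where "r = prefactor (lg q) * \<rho> * exp (\<i> * of_real pi * (of_nat a + of_nat c) / of_nat N)"
    have r: "r \<noteq> 0" using prefactor_at_q(1) \<rho>(1) by (simp add: r_def)
    have R: "Rq a c b (\<delta> b) = r * (k b / H b)" if b: "b \<in> {1..N}" for b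
    proof -
      have "(b + \<delta> b) mod N = s mod N"
        using add_mod_eq_reflect[OF s b \<delta>_in[OF b]] by (simp add: \<delta>_def)
      then have "Rq a c b (\<delta> b) = prefactor (lg q) * S_coeff lg N q p a c b (lg q)
           * exp (\<i> * of_real pi * (of_nat a + of_nat c - of_nat b - of_nat (\<delta> b)) / of_nat N)"
        using ac by (simp add: Rq_def)
      also have "exp (\<i> * of_real pi * (of_nat a + of_nat c - of_nat b - of_nat (\<delta> b)) / of_nat N)
        = exp (\<i> * of_real pi * (of_nat a + of_nat c) / of_nat N) * exp (- \<i> * of_real pi * (of_nat b + of_nat (\<delta> b)) / of_nat N)"
        unfolding exp_add[symmetric] by (simp add: algebra_simps add_divide_distrib diff_divide_distrib)
      also have "S_coeff lg N q p a c b (lg q) = \<rho> * (exp (of_nat b * (of_nat s - of_nat b) / of_nat N * lg p) / H b)"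
        using \<rho>(2)[OF b] by (simp add: c_def \<delta>_def H_def algebra_simps)
      finally show ?thesis by (simp add: r_def k_def)
    qed
    have R0: "Rq a c b d = 0" if "b \<in> {1..N}" "d \<in> {1..N}" "d \<noteq> \<delta> b" for b d
      using add_mod_eq_reflect[OF s that(1,2)] that(3) ac by (simp add: Rq_def \<delta>_def)
    have R_sym: "Rq a c (\<delta> b) b = Rq a c b (\<delta> b)" if "b \<in> {1..N}" for b
      using Rq_swap[OF a that c \<delta>_in[OF that]] by simp
    define V where "V b = Rq a c b (\<delta> b)" for b
    have V_sym: "V (\<delta> b) = V b" if "b \<in> {1..N}" for b
      using R_sym[OF that] \<delta>_\<delta>[OF that] by (simp add: V_def)
    have y_sym: "y (\<delta> b) = y b" if "b \<in> {1..N}" for b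
      using \<delta>_\<delta>[OF that] by (simp add: y_def)
    have reidx: "(\<Sum>b\<in>{1..N}. g (\<delta> b)) = (\<Sum>b\<in>{1..N}. g b)" for g :: "nat \<Rightarrow> complex"
      by (rule sum.reindex_bij_witness[of _ \<delta> \<delta>]) (use \<delta>_in \<delta>_\<delta> in auto)
    have sum0: "0 = (\<Sum>b\<in>{1..N}. V b * x b (\<delta> b))"
    proof -
      have "(\<Sum>d\<in>{1..N}. Rq a c b d * x b d) = V b * x b (\<delta> b)" if b: "b \<in> {1..N}" for b
        using \<delta>_in[OF b] R0[OF b] by (subst sum.remove[of _ "\<delta> b"]) (auto simp: V_def intro!: sum.neutral)
      then show ?thesis using ker[OF a c] by simp
    qed
    \<comment> \<open>Column symmetry permits exchanging b and \<delta> b; adding this copy to the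
      original relation leaves only the symmetric part y of x.\<close>
    have "0 = (\<Sum>b\<in>{1..N}. V b * x (\<delta> b) b)"
    proof -
      have "(\<Sum>b\<in>{1..N}. V b * x b (\<delta> b)) = (\<Sum>b\<in>{1..N}. V (\<delta> b) * x (\<delta> b) (\<delta> (\<delta> b)))"
        using reidx[of "\<lambda>b. V b * x b (\<delta> b)"] by simp
      also have "\<dots> = (\<Sum>b\<in>{1..N}. V b * x (\<delta> b) b)"
        by (rule sum.cong) (use V_sym \<delta>_\<delta> in auto)
      finally show ?thesis using sum0 by simp
    qed
    with sum0 have "0 = (\<Sum>b\<in>{1..N}. V b * y b)"
      by (simp add: y_def distrib_left sum.distrib)
    also have "\<dots> = (\<Sum>b\<in>B. V b * y b) + (\<Sum>b\<in>{b\<in>{1..N}. \<delta> b < b}. V b * y b)"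
      by (subst sum.union_disjoint[symmetric]) (auto simp: B_def intro!: sum.cong)
    also have "(\<Sum>b\<in>{b\<in>{1..N}. \<delta> b < b}. V b * y b) = (\<Sum>b\<in>{b\<in>{1..N}. b < \<delta> b}. V b * y b)"
      by (rule sum.reindex_bij_witness[of _ \<delta> \<delta>]) (use \<delta>_in \<delta>_\<delta> V_sym y_sym in auto)
    also have "\<dots> = (\<Sum>b\<in>B. if b = \<delta> b then 0 else V b * y b)"
      by (rule sum.mono_neutral_cong_left) (auto simp: B_def)
    also have "(\<Sum>b\<in>B. V b * y b) + (\<Sum>b\<in>B. if b = \<delta> b then 0 else V b * y b)
        = (\<Sum>b\<in>B. r * (w b / H b))"
      unfolding sum.distrib[symmetric]
      by (rule sum.cong) (auto simp: B_def V_def R w_def)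
    also have "\<dots> = r * (\<Sum>b\<in>B. w b / H b)" by (simp add: sum_distrib_left)
    finally have "(\<Sum>b\<in>B. w b / H b) = 0" using r by simp
    then show "(\<Sum>b\<in>B. w b / (T (- (of_nat a * lg p) + of_nat b * lg p + 2 * lg q)
        * T (- (of_nat a * lg p) + (of_nat s - of_nat b) * lg p + 2 * lg q))) = 0"
      by (simp add: H_def)
  qed
  then have y0: "y b = 0" if "b \<in> B" for b using that by (force simp: w_def k_def split: if_splits)
  have d0: "d0 = \<delta> b0" "\<delta> d0 = b0" using d0_eq \<delta>_\<delta>[OF b0] by (auto simp: \<delta>_def)
  have "b0 \<in> B \<or> d0 \<in> B" using d0 b0 \<open>d0 \<in> {1..N}\<close> by (auto simp: B_def)
  then show ?thesis using y0[of b0] y0[of d0] d0 by (auto simp: y_def add.commute)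
qed

end

section \<open>Noncommutative determinants with antisymmetric rows\<close>

context ring
begin

lemma finsum_swap:
  assumes "finite A" "finite B" "\<And>a b. a \<in> A \<Longrightarrow> b \<in> B \<Longrightarrow> f a b \<in> carrier R"
  shows "(\<Oplus>a\<in>A. \<Oplus>b\<in>B. f a b) = (\<Oplus>b\<in>B. \<Oplus>a\<in>A. f a b)"
  using assms(1,3)
proof (induction A)
  case empty
  then show ?case by simp
next
  case (insert a A)
  have c: "(\<lambda>b. f a b) \<in> B \<rightarrow> carrier R" "\<And>b. b \<in> B \<Longrightarrow> (\<lambda>a. f a b) \<in> A \<rightarrow> carrier R"
    using insert.prems by auto
  have "(\<Oplus>b\<in>B. \<Oplus>a\<in>insert a A. f a b) = (\<Oplus>b\<in>B. f a b \<oplus> (\<Oplus>a\<in>A. f a b))"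
    by (rule finsum_cong') (use insert c in \<open>auto intro!: finsum_closed finsum_insert\<close>)
  also have "\<dots> = (\<Oplus>b\<in>B. f a b) \<oplus> (\<Oplus>b\<in>B. \<Oplus>a\<in>A. f a b)"
    by (rule finsum_addf) (use c in \<open>auto intro!: finsum_closed\<close>)
  also have "(\<Oplus>b\<in>B. \<Oplus>a\<in>A. f a b) = (\<Oplus>a\<in>A. \<Oplus>b\<in>B. f a b)"
    using insert.IH insert.prems by simp
  also have "(\<Oplus>b\<in>B. f a b) \<oplus> (\<Oplus>a\<in>A. \<Oplus>b\<in>B. f a b) = (\<Oplus>a\<in>insert a A. \<Oplus>b\<in>B. f a b)"
    by (rule finsum_insert[symmetric]) (use insert in \<open>auto intro!: finsum_closed\<close>)
  finally show ?case by simp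
qed

lemma finsum_Times:
  assumes "finite A" "finite B" "\<And>a b. a \<in> A \<Longrightarrow> b \<in> B \<Longrightarrow> f (a, b) \<in> carrier R"
  shows "(\<Oplus>x\<in>A \<times> B. f x) = (\<Oplus>a\<in>A. \<Oplus>b\<in>B. f (a, b))"
  using assms(1,3)
proof (induction A)
  case empty
  then show ?case by simp
next
  case (insert a A)
  have "(\<Oplus>x\<in>insert a A \<times> B. f x) = (\<Oplus>x\<in>Pair a ` B \<union> A \<times> B. f x)"
    by (rule arg_cong[where f = "finsum R f"]) auto
  also have "\<dots> = (\<Oplus>x\<in>Pair a ` B. f x) \<oplus> (\<Oplus>x\<in>A \<times> B. f x)"
    using insert assms(2) by (intro finsum_Un_disjoint) auto
  also have "(\<Oplus>x\<in>Pair a ` B. f x) = (\<Oplus>b\<in>B. f (a, b))"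
    using insert.prems by (intro finsum_reindex) (auto simp: inj_on_def)
  also have "(\<Oplus>x\<in>A \<times> B. f x) = (\<Oplus>a\<in>A. \<Oplus>b\<in>B. f (a, b))"
    using insert by auto
  also have "(\<Oplus>b\<in>B. f (a, b)) \<oplus> (\<Oplus>a\<in>A. \<Oplus>b\<in>B. f (a, b)) = (\<Oplus>a\<in>insert a A. \<Oplus>b\<in>B. f (a, b))"
    by (rule finsum_insert[symmetric]) (use insert in \<open>auto intro!: finsum_closed\<close>)
  finally show ?case .
qed

section \<open>Ordered products, index maps and signs\<close>

definition lprod :: "nat list \<Rightarrow> (nat \<Rightarrow> 'a) \<Rightarrow> 'a" where
  "lprod xs f = foldr (\<otimes>) (map f xs) \<one>"

lemma lprod_Nil [simp]: "lprod [] f = \<one>" and lprod_Cons [simp]: "lprod (x # xs) f = f x \<otimes> lprod xs f"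
  by (simp_all add: lprod_def)

lemma lprod_closed [simp, intro]:
  "(\<And>x. x \<in> set xs \<Longrightarrow> f x \<in> carrier R) \<Longrightarrow> lprod xs f \<in> carrier R"
  by (induction xs) auto

lemma lprod_cong: "(\<And>x. x \<in> set xs \<Longrightarrow> f x = g x) \<Longrightarrow> lprod xs f = lprod xs g"
  unfolding lprod_def by (metis map_eq_conv)

lemma lprod_append:
  "(\<And>x. x \<in> set (xs @ ys) \<Longrightarrow> f x \<in> carrier R) \<Longrightarrow> lprod (xs @ ys) f = lprod xs f \<otimes> lprod ys f"
  by (induction xs) (auto simp: m_assoc)

lemma lprod_commute:
  assumes "a \<in> carrier R" "\<And>x. x \<in> set xs \<Longrightarrow> f x \<in> carrier R" "\<And>x. x \<in> set xs \<Longrightarrow> a \<otimes> f x = f x \<otimes> a"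
  shows "a \<otimes> lprod xs f = lprod xs f \<otimes> a"
  using assms(2,3)
proof (induction xs)
  case (Cons x xs)
  have c: "f x \<in> carrier R" "lprod xs f \<in> carrier R" using Cons.prems by auto
  have "a \<otimes> (f x \<otimes> lprod xs f) = (f x \<otimes> a) \<otimes> lprod xs f"
    using Cons.prems(2)[of x] c assms(1) by (simp flip: m_assoc)
  also have "\<dots> = f x \<otimes> (lprod xs f \<otimes> a)"
    using Cons c assms(1) by (simp add: m_assoc)
  finally show ?case using c assms(1) by (simp add: m_assoc)
qed (simp add: assms(1))

lemma lprod_mult:
  assumes "\<And>x. x \<in> set xs \<Longrightarrow> f x \<in> carrier R" "\<And>x. x \<in> set xs \<Longrightarrow> g x \<in> carrier R"
    "\<And>x y. x \<in> set xs \<Longrightarrow> y \<in> set xs \<Longrightarrow> g x \<otimes> f y = f y \<otimes> g x"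
  shows "lprod xs (\<lambda>x. f x \<otimes> g x) = lprod xs f \<otimes> lprod xs g"
  using assms
proof (induction xs)
  case (Cons x xs)
  have c: "f x \<in> carrier R" "g x \<in> carrier R" "lprod xs f \<in> carrier R" "lprod xs g \<in> carrier R"
    using Cons.prems by auto
  have comm: "g x \<otimes> lprod xs f = lprod xs f \<otimes> g x"
    by (rule lprod_commute) (use Cons.prems in auto)
  have "f x \<otimes> g x \<otimes> (lprod xs f \<otimes> lprod xs g) = f x \<otimes> (g x \<otimes> lprod xs f) \<otimes> lprod xs g"
    using c by (simp add: m_assoc)
  also have "\<dots> = f x \<otimes> lprod xs f \<otimes> (g x \<otimes> lprod xs g)"
    unfolding comm using c by (simp add: m_assoc)
  finally show ?case using Cons by auto
qed simp

text \<open>Fixing the points outside \<open>S\<close> makes the permutations of \<open>S\<close> a subset of \<open>index_maps S S\<close>.\<close>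

definition index_maps :: "nat set \<Rightarrow> nat set \<Rightarrow> (nat \<Rightarrow> nat) set" where
  "index_maps S K = {\<kappa>. (\<forall>i\<in>S. \<kappa> i \<in> K) \<and> (\<forall>i. i \<notin> S \<longrightarrow> \<kappa> i = i)}"

lemma index_maps_insert:
  assumes "x \<notin> S"
  shows "index_maps (insert x S) K = (\<lambda>(k, \<kappa>). \<kappa>(x := k)) ` (K \<times> index_maps S K)"
    and "inj_on (\<lambda>(k, \<kappa>). \<kappa>(x := k)) (K \<times> index_maps S K)"
proof -
  show "index_maps (insert x S) K = (\<lambda>(k, \<kappa>). \<kappa>(x := k)) ` (K \<times> index_maps S K)"
  proof (intro equalityI subsetI)
    fix \<kappa> assume "\<kappa> \<in> index_maps (insert x S) K"
    then show "\<kappa> \<in> (\<lambda>(k, \<kappa>). \<kappa>(x := k)) ` (K \<times> index_maps S K)"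
      using assms by (intro image_eqI[of _ _ "(\<kappa> x, \<kappa>(x := x))"]) (auto simp: index_maps_def)
  qed (auto simp: index_maps_def)
  show "inj_on (\<lambda>(k, \<kappa>). \<kappa>(x := k)) (K \<times> index_maps S K)"
  proof (rule inj_onI, clarify)
    fix k k' \<kappa> \<kappa>' assume *: "\<kappa> \<in> index_maps S K" "\<kappa>' \<in> index_maps S K" "\<kappa>(x := k) = \<kappa>'(x := k')"
    have "\<kappa> y = \<kappa>' y" for y
    proof (cases "y = x")
      case True
      then show ?thesis using * assms by (simp add: index_maps_def)
    next
      case False
      then show ?thesis using fun_cong[OF *(3), of y] by simp
    qed
    then show "k = k' \<and> \<kappa> = \<kappa>'" using fun_cong[OF *(3), of x] by (simp add: fun_eq_iff)
  qed
qed

lemma finite_index_maps: "finite S \<Longrightarrow> finite K \<Longrightarrow> finite (index_maps S K)"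
proof (induction S rule: finite_induct)
  case empty
  have "index_maps {} K = {id}" by (auto simp: index_maps_def)
  then show ?case by simp
qed (simp add: index_maps_insert)

lemma lprod_finsum:
  assumes "distinct xs" "finite K" "\<And>x k. x \<in> set xs \<Longrightarrow> k \<in> K \<Longrightarrow> g x k \<in> carrier R"
  shows "lprod xs (\<lambda>x. \<Oplus>k\<in>K. g x k) = (\<Oplus>\<kappa>\<in>index_maps (set xs) K. lprod xs (\<lambda>x. g x (\<kappa> x)))"
  using assms(1,3)
proof (induction xs)
  case Nil
  have "index_maps {} K = {id}" by (auto simp: index_maps_def)
  then show ?case by simp
next
  case (Cons x xs)
  let ?M = "index_maps (set xs) K"
  have fin: "finite ?M" using assms(2) by (simp add: finite_index_maps)
  have mem: "\<kappa> y \<in> K" if "\<kappa> \<in> ?M" "y \<in> set xs" for \<kappa> y using that by (auto simp: index_maps_def)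
  have c: "lprod xs (\<lambda>x. g x (\<kappa> x)) \<in> carrier R" if "\<kappa> \<in> ?M" for \<kappa>
    using mem[OF that] Cons.prems by auto
  have gx: "g x k \<in> carrier R" if "k \<in> K" for k using Cons.prems that by auto
  have x: "x \<notin> set xs" using Cons.prems by simp
  have eq: "lprod xs (\<lambda>y. g y ((\<kappa>(x := k)) y)) = lprod xs (\<lambda>y. g y (\<kappa> y))" for \<kappa> k
    by (rule lprod_cong) (use x in auto)
  have "(\<Oplus>\<kappa>\<in>index_maps (set (x # xs)) K. lprod (x # xs) (\<lambda>x. g x (\<kappa> x)))
      = (\<Oplus>\<kappa>\<in>(\<lambda>(k, \<kappa>). \<kappa>(x := k)) ` (K \<times> ?M). lprod (x # xs) (\<lambda>x. g x (\<kappa> x)))"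
    by (simp only: list.set index_maps_insert(1)[OF x])
  also have "\<dots> = (\<Oplus>z\<in>K \<times> ?M. lprod (x # xs) (\<lambda>y. g y ((case z of (k, \<kappa>) \<Rightarrow> \<kappa>(x := k)) y)))"
    by (rule finsum_reindex[OF _ index_maps_insert(2)[OF x]]) (use c gx eq in auto)
  also have "\<dots> = (\<Oplus>k\<in>K. \<Oplus>\<kappa>\<in>?M. g x k \<otimes> lprod xs (\<lambda>y. g y (\<kappa> y)))"
    by (subst finsum_Times) (use assms(2) fin c gx eq in auto)
  also have "\<dots> = (\<Oplus>k\<in>K. g x k \<otimes> (\<Oplus>\<kappa>\<in>?M. lprod xs (\<lambda>y. g y (\<kappa> y))))"
    by (rule finsum_cong') (use fin c gx in \<open>auto simp: finsum_rdistr intro!: finsum_closed\<close>)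
  also have "\<dots> = (\<Oplus>k\<in>K. g x k) \<otimes> (\<Oplus>\<kappa>\<in>?M. lprod xs (\<lambda>y. g y (\<kappa> y)))"
    by (rule finsum_ldistr[symmetric]) (use assms(2) c gx in \<open>auto intro!: finsum_closed\<close>)
  also have "(\<Oplus>\<kappa>\<in>?M. lprod xs (\<lambda>y. g y (\<kappa> y))) = lprod xs (\<lambda>x. \<Oplus>k\<in>K. g x k)"
    using Cons by auto
  finally show ?case by simp
qed

abbreviation signed :: "(nat \<Rightarrow> nat) \<Rightarrow> 'a \<Rightarrow> 'a" where
  "signed \<sigma> x \<equiv> add_pow R (sign \<sigma> :: int) x"

lemma signed_eq: "x \<in> carrier R \<Longrightarrow> signed \<sigma> x = (if evenperm \<sigma> then x else \<ominus> x)"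
  by (simp add: sign_def add_pow_int_ge add_pow_int_lt)

lemma signed_closed [simp]: "x \<in> carrier R \<Longrightarrow> signed \<sigma> x \<in> carrier R"
  by (simp add: signed_eq)

lemma signed_add:
  "x \<in> carrier R \<Longrightarrow> y \<in> carrier R \<Longrightarrow> signed \<sigma> (x \<oplus> y) = signed \<sigma> x \<oplus> signed \<sigma> y"
  by (simp add: signed_eq minus_add)

lemma signed_mult_right:
  "x \<in> carrier R \<Longrightarrow> y \<in> carrier R \<Longrightarrow> x \<otimes> signed \<sigma> y = signed \<sigma> (x \<otimes> y)"
  by (simp add: signed_eq r_minus)

lemma signed_mult_left:
  "x \<in> carrier R \<Longrightarrow> y \<in> carrier R \<Longrightarrow> signed \<sigma> x \<otimes> y = signed \<sigma> (x \<otimes> y)"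
  by (simp add: signed_eq l_minus)

lemma signed_finsum:
  assumes "finite A" "f \<in> A \<rightarrow> carrier R"
  shows "signed \<sigma> (\<Oplus>a\<in>A. f a) = (\<Oplus>a\<in>A. signed \<sigma> (f a))"
  using assms
proof (induction A)
  case empty
  then show ?case by (simp add: signed_eq)
next
  case (insert a A)
  then have c: "f a \<in> carrier R" "f \<in> A \<rightarrow> carrier R" by auto
  have "(\<Oplus>a\<in>insert a A. signed \<sigma> (f a)) = signed \<sigma> (f a) \<oplus> (\<Oplus>a\<in>A. signed \<sigma> (f a))"
    using insert c by (intro finsum_insert) auto
  also have "\<dots> = signed \<sigma> (f a) \<oplus> signed \<sigma> (\<Oplus>a\<in>A. f a)"
    using insert.IH[OF c(2)] by simp
  also have "\<dots> = signed \<sigma> (\<Oplus>a\<in>insert a A. f a)"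
    using insert c by (simp add: signed_add)
  finally show ?case by simp
qed

end

section \<open>Minors alternating in their rows\<close>

locale row_antisymmetric = ring +
  fixes N :: nat and A :: "nat \<Rightarrow> nat \<Rightarrow> nat \<Rightarrow> 'a"
  assumes A_closed: "\<And>i j n. i \<in> {1..N} \<Longrightarrow> j \<in> {1..N} \<Longrightarrow> n \<in> {1..N} \<Longrightarrow> A i j n \<in> carrier R"
    and two_torsion_free: "\<And>x. x \<in> carrier R \<Longrightarrow> x \<oplus> x = \<zero> \<Longrightarrow> x = \<zero>"
    and antisym: "\<And>n i i' j j'. n \<in> {1..<N} \<Longrightarrow> i \<in> {1..N} \<Longrightarrow> i' \<in> {1..N} \<Longrightarrow> j \<in> {1..N} \<Longrightarrow> j' \<in> {1..N} \<Longrightarrow>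
      A i j n \<otimes> A i' j' (Suc n) \<oplus> A i' j n \<otimes> A i j' (Suc n)
      = A i j' n \<otimes> A i' j (Suc n) \<oplus> A i' j' n \<otimes> A i j (Suc n)"
begin

declare One_nat_def [simp del]

abbreviation perms :: "(nat \<Rightarrow> nat) set" where "perms \<equiv> {\<sigma>. \<sigma> permutes {1..N}}"

definition row_prod :: "(nat \<Rightarrow> nat) \<Rightarrow> (nat \<Rightarrow> nat) \<Rightarrow> 'a" where
  "row_prod \<kappa> \<sigma> = lprod [1..<Suc N] (\<lambda>n. A (\<kappa> n) (\<sigma> n) n)"

definition minor :: "(nat \<Rightarrow> nat) \<Rightarrow> 'a" where
  "minor \<kappa> = (\<Oplus>\<sigma>\<in>perms. signed \<sigma> (row_prod \<kappa> \<sigma>))"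

definition is_index :: "(nat \<Rightarrow> nat) \<Rightarrow> bool" where
  "is_index \<kappa> \<longleftrightarrow> \<kappa> ` {1..N} \<subseteq> {1..N}"

lemma is_indexD: "is_index \<kappa> \<Longrightarrow> n \<in> {1..N} \<Longrightarrow> \<kappa> n \<in> {1..N}"
  unfolding is_index_def by blast

lemma is_index_id: "is_index id"
  by (simp add: is_index_def)

lemma A_index_closed: "is_index \<kappa> \<Longrightarrow> is_index \<sigma> \<Longrightarrow> n \<in> {1..N} \<Longrightarrow> A (\<kappa> n) (\<sigma> n) n \<in> carrier R"
  by (rule A_closed; (erule is_indexD)?)

lemma finite_perms: "finite perms" by (rule finite_permutations) simp

lemma is_index_perm: "\<sigma> permutes {1..N} \<Longrightarrow> is_index \<sigma>"
  by (simp add: is_index_def permutes_image)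

lemma is_index_swap: "is_index \<kappa> \<Longrightarrow> i \<in> {1..N} \<Longrightarrow> j \<in> {1..N} \<Longrightarrow> is_index (\<kappa> \<circ> Transposition.transpose i j)"
  unfolding is_index_def Transposition.transpose_def by auto

lemma row_prod_closed [simp]: "is_index \<kappa> \<Longrightarrow> is_index \<sigma> \<Longrightarrow> row_prod \<kappa> \<sigma> \<in> carrier R"
  unfolding row_prod_def by (rule lprod_closed) (rule A_index_closed; auto)

lemma minor_closed [simp]: "is_index \<kappa> \<Longrightarrow> minor \<kappa> \<in> carrier R"
  unfolding minor_def by (intro finsum_closed) (auto intro!: signed_closed row_prod_closed dest: is_index_perm)

text \<open>The common prefix and suffix factor out, and \<open>antisym\<close> applies to the two
  neighbouring factors between them.\<close>

lemma row_prod_swap: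
  assumes \<kappa>: "is_index \<kappa>" and \<sigma>: "is_index \<sigma>" and n: "n \<in> {1..<N}"
  defines "\<tau> \<equiv> Transposition.transpose n (Suc n)"
  shows "row_prod \<kappa> \<sigma> \<oplus> row_prod (\<kappa> \<circ> \<tau>) \<sigma> = row_prod \<kappa> (\<sigma> \<circ> \<tau>) \<oplus> row_prod (\<kappa> \<circ> \<tau>) (\<sigma> \<circ> \<tau>)"
proof -
  have split: "[1..<Suc N] = [1..<n] @ n # Suc n # [Suc (Suc n)..<Suc N]"
  proof -
    have "[1..<Suc N] = [1..<n] @ [n..<Suc N]"
      using n upt_add_eq_append[of 1 n "Suc N - n"] by simp
    also have "[n..<Suc N] = n # Suc n # [Suc (Suc n)..<Suc N]"
      using n upt_conv_Cons[of n "Suc N"] upt_conv_Cons[of "Suc n" "Suc N"] by simp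
    finally show ?thesis .
  qed
  define pre where "pre = lprod [1..<n] (\<lambda>n. A (\<kappa> n) (\<sigma> n) n)"
  define suf where "suf = lprod [Suc (Suc n)..<Suc N] (\<lambda>n. A (\<kappa> n) (\<sigma> n) n)"
  have nN: "n \<in> {1..N}" "Suc n \<in> {1..N}" using n by auto
  have pre: "pre \<in> carrier R" and suf: "suf \<in> carrier R"
    unfolding pre_def suf_def by (rule lprod_closed, rule A_index_closed[OF \<kappa> \<sigma>], use n in auto)+
  have row: "row_prod \<kappa>' \<sigma>' = pre \<otimes> ((A (\<kappa>' n) (\<sigma>' n) n \<otimes> A (\<kappa>' (Suc n)) (\<sigma>' (Suc n)) (Suc n)) \<otimes> suf)"
    if i: "is_index \<kappa>'" "is_index \<sigma>'" and same: "\<And>m. m \<noteq> n \<Longrightarrow> m \<noteq> Suc n \<Longrightarrow> \<kappa>' m = \<kappa> m \<and> \<sigma>' m = \<sigma> m" for \<kappa>' \<sigma>'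
  proof -
    have cl: "A (\<kappa>' m) (\<sigma>' m) m \<in> carrier R" if "m \<in> {1..N}" for m
      using A_index_closed[OF i that] .
    have "row_prod \<kappa>' \<sigma>' = lprod [1..<n] (\<lambda>n. A (\<kappa>' n) (\<sigma>' n) n)
        \<otimes> lprod (n # Suc n # [Suc (Suc n)..<Suc N]) (\<lambda>n. A (\<kappa>' n) (\<sigma>' n) n)"
      unfolding row_prod_def split by (rule lprod_append) (use cl n in auto)
    also have "lprod [1..<n] (\<lambda>n. A (\<kappa>' n) (\<sigma>' n) n) = pre"
      unfolding pre_def by (rule lprod_cong) (use same in auto)
    also have "lprod (n # Suc n # [Suc (Suc n)..<Suc N]) (\<lambda>n. A (\<kappa>' n) (\<sigma>' n) n)
      = A (\<kappa>' n) (\<sigma>' n) n \<otimes> (A (\<kappa>' (Suc n)) (\<sigma>' (Suc n)) (Suc n) \<otimes> suf)"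
    proof -
      have "lprod [Suc (Suc n)..<Suc N] (\<lambda>n. A (\<kappa>' n) (\<sigma>' n) n) = suf"
        unfolding suf_def by (rule lprod_cong) (use same in auto)
      then show ?thesis by simp
    qed
    also have "\<dots> = (A (\<kappa>' n) (\<sigma>' n) n \<otimes> A (\<kappa>' (Suc n)) (\<sigma>' (Suc n)) (Suc n)) \<otimes> suf"
      using cl nN suf by (intro m_assoc[symmetric])
    finally show ?thesis .
  qed
  have idx: "is_index (\<kappa> \<circ> \<tau>)" "is_index (\<sigma> \<circ> \<tau>)"
    unfolding \<tau>_def using is_index_swap[OF \<kappa> nN] is_index_swap[OF \<sigma> nN] by blast+
  have \<tau>: "\<tau> n = Suc n" "\<tau> (Suc n) = n" "\<And>m. m \<noteq> n \<Longrightarrow> m \<noteq> Suc n \<Longrightarrow> \<tau> m = m"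
    by (auto simp: \<tau>_def Transposition.transpose_def)
  have in_range: "\<kappa> n \<in> {1..N}" "\<kappa> (Suc n) \<in> {1..N}" "\<sigma> n \<in> {1..N}" "\<sigma> (Suc n) \<in> {1..N}"
    using is_indexD[OF \<kappa>] is_indexD[OF \<sigma>] nN by blast+
  have factor: "pre \<otimes> (x \<otimes> suf) \<oplus> pre \<otimes> (y \<otimes> suf) = pre \<otimes> ((x \<oplus> y) \<otimes> suf)"
    if "x \<in> carrier R" "y \<in> carrier R" for x y
    using that pre suf by (simp add: l_distr r_distr)
  have "row_prod \<kappa> \<sigma> \<oplus> row_prod (\<kappa> \<circ> \<tau>) \<sigma>
      = pre \<otimes> ((A (\<kappa> n) (\<sigma> n) n \<otimes> A (\<kappa> (Suc n)) (\<sigma> (Suc n)) (Suc n)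
           \<oplus> A (\<kappa> (Suc n)) (\<sigma> n) n \<otimes> A (\<kappa> n) (\<sigma> (Suc n)) (Suc n)) \<otimes> suf)"
    using in_range nN by (simp add: row \<kappa> \<sigma> idx \<tau> factor A_closed)
  also have "\<dots> = pre \<otimes> ((A (\<kappa> n) (\<sigma> (Suc n)) n \<otimes> A (\<kappa> (Suc n)) (\<sigma> n) (Suc n)
           \<oplus> A (\<kappa> (Suc n)) (\<sigma> (Suc n)) n \<otimes> A (\<kappa> n) (\<sigma> n) (Suc n)) \<otimes> suf)"
    using antisym[OF n in_range] by simp
  also have "\<dots> = row_prod \<kappa> (\<sigma> \<circ> \<tau>) \<oplus> row_prod (\<kappa> \<circ> \<tau>) (\<sigma> \<circ> \<tau>)"
    using in_range nN by (simp add: row \<kappa> \<sigma> idx \<tau> factor A_closed)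
  finally show ?thesis .
qed

text \<open>Under \<sigma> -> \<sigma> \<circ> \<tau> the sum of the two row products is unchanged
  by \<open>row_prod_swap\<close>, while the sign flips. Hence twice the sum of \<open>Q\<close>
  over all permutations vanishes, and so does the sum itself.\<close>

lemma minor_adjacent_swap:
  assumes \<kappa>: "is_index \<kappa>" and n: "n \<in> {1..<N}"
  shows "minor (\<kappa> \<circ> Transposition.transpose n (Suc n)) = \<ominus> minor \<kappa>"
proof -
  define \<tau> where "\<tau> = Transposition.transpose n (Suc n)"
  have nN: "n \<in> {1..N}" "Suc n \<in> {1..N}" using n by auto
  have \<tau>_perm: "\<tau> permutes {1..N}" unfolding \<tau>_def by (rule permutes_swap_id) (use nN in auto)
  have idx: "is_index (\<kappa> \<circ> \<tau>)" unfolding \<tau>_def by (rule is_index_swap[OF \<kappa> nN])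
  define Q where "Q \<sigma> = signed \<sigma> (row_prod \<kappa> \<sigma> \<oplus> row_prod (\<kappa> \<circ> \<tau>) \<sigma>)" for \<sigma>
  have rc: "row_prod \<kappa> \<sigma> \<in> carrier R" "row_prod (\<kappa> \<circ> \<tau>) \<sigma> \<in> carrier R" if "\<sigma> \<in> perms" for \<sigma>
    using row_prod_closed[OF \<kappa>] row_prod_closed[OF idx] is_index_perm that by blast+
  have Qc: "Q \<sigma> \<in> carrier R" if "\<sigma> \<in> perms" for \<sigma> using rc[OF that] by (simp add: Q_def)
  have comp: "\<sigma> \<circ> \<tau> \<in> perms" if "\<sigma> \<in> perms" for \<sigma>
    using permutes_compose[OF \<tau>_perm] that by auto
  have cancel: "Q \<sigma> \<oplus> Q (\<sigma> \<circ> \<tau>) = \<zero>" if \<sigma>: "\<sigma> \<in> perms" for \<sigma>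
  proof -
    have "permutation \<sigma>" "permutation \<tau>"
      using \<sigma> \<tau>_perm permutes_imp_permutation[of "{1..N}"] by auto
    moreover have "\<not> evenperm \<tau>" by (simp add: \<tau>_def evenperm_swap)
    ultimately have "evenperm (\<sigma> \<circ> \<tau>) \<longleftrightarrow> \<not> evenperm \<sigma>" by (simp add: evenperm_comp)
    moreover have "row_prod \<kappa> (\<sigma> \<circ> \<tau>) \<oplus> row_prod (\<kappa> \<circ> \<tau>) (\<sigma> \<circ> \<tau>) = row_prod \<kappa> \<sigma> \<oplus> row_prod (\<kappa> \<circ> \<tau>) \<sigma>"
      using row_prod_swap[OF \<kappa> is_index_perm n, of \<sigma>] \<sigma> by (simp add: \<tau>_def)
    ultimately show ?thesis using rc[OF \<sigma>] by (simp add: Q_def signed_eq r_neg l_neg)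
  qed
  have "(\<Oplus>\<sigma>\<in>perms. Q \<sigma>) = (\<Oplus>\<sigma>\<in>(\<lambda>\<sigma>. \<sigma> \<circ> \<tau>) ` perms. Q \<sigma>)"
  proof -
    have "\<tau> \<circ> \<tau> = id" by (simp add: \<tau>_def)
    then have "\<sigma> = (\<sigma> \<circ> \<tau>) \<circ> \<tau>" for \<sigma> :: "nat \<Rightarrow> nat" by (simp add: comp_assoc)
    then have "(\<lambda>\<sigma>. \<sigma> \<circ> \<tau>) ` perms = perms" using comp by (metis (no_types, lifting) image_iff subsetI subset_antisym)
    then show ?thesis by simp
  qed
  also have "\<dots> = (\<Oplus>\<sigma>\<in>perms. Q (\<sigma> \<circ> \<tau>))"
  proof (rule finsum_reindex)
    have "\<tau> \<circ> \<tau> = id" by (simp add: \<tau>_def)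
    then show "inj_on (\<lambda>\<sigma>. \<sigma> \<circ> \<tau>) perms" 
      by (metis (no_types, lifting) comp_assoc comp_id inj_onI)
  qed (use Qc comp in auto)
  finally have "(\<Oplus>\<sigma>\<in>perms. Q \<sigma>) \<oplus> (\<Oplus>\<sigma>\<in>perms. Q \<sigma>) = (\<Oplus>\<sigma>\<in>perms. Q \<sigma> \<oplus> Q (\<sigma> \<circ> \<tau>))"
    using Qc comp by (subst finsum_addf) auto
  also have "\<dots> = \<zero>" by (rule add.finprod_one_eqI) (use cancel in auto)
  finally have 0: "(\<Oplus>\<sigma>\<in>perms. Q \<sigma>) = \<zero>"
    using two_torsion_free[of "\<Oplus>\<sigma>\<in>perms. Q \<sigma>"] Qc by (auto intro!: finsum_closed)
  have "(\<Oplus>\<sigma>\<in>perms. Q \<sigma>) = (\<Oplus>\<sigma>\<in>perms. signed \<sigma> (row_prod \<kappa> \<sigma>) \<oplus> signed \<sigma> (row_prod (\<kappa> \<circ> \<tau>) \<sigma>))"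
    by (rule finsum_cong') (use rc in \<open>auto simp: Q_def signed_eq minus_add\<close>)
  also have "\<dots> = minor \<kappa> \<oplus> minor (\<kappa> \<circ> \<tau>)"
    unfolding minor_def by (rule finsum_addf) (use rc in auto)
  finally have "minor (\<kappa> \<circ> \<tau>) \<oplus> minor \<kappa> = \<zero>"
    using 0 minor_closed[OF \<kappa>] minor_closed[OF idx] by (simp add: a_comm)
  then show ?thesis
    unfolding \<tau>_def[symmetric] using minor_closed[OF \<kappa>] minor_closed[OF idx] by (metis minus_equality)
qed

lemma minor_swap_less:
  assumes "i < j" "is_index \<kappa>" "i \<in> {1..N}" "j \<in> {1..N}"
  shows "minor (\<kappa> \<circ> Transposition.transpose i j) = \<ominus> minor \<kappa>"
proof -
  have "Suc i \<le> j" using assms(1) by simp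
  then show ?thesis using assms(2-)
  proof (induction j arbitrary: \<kappa> rule: dec_induct)
    case base
    then show ?case by (intro minor_adjacent_swap) auto
  next
    case (step n)
    define \<tau> where "\<tau> = Transposition.transpose n (Suc n)"
    have n: "n \<in> {1..<N}" "n \<in> {1..N}" "Suc n \<in> {1..N}" using step by auto
    \<comment> \<open>Conjugating by an adjacent transposition shortens the distance; the three sign
      changes amount to one.\<close>
    have "Transposition.transpose i (Suc n) = \<tau> \<circ> Transposition.transpose i n \<circ> \<tau>"
      using step.hyps by (auto simp: \<tau>_def Transposition.transpose_def fun_eq_iff)
    then have eq: "\<kappa> \<circ> Transposition.transpose i (Suc n) = ((\<kappa> \<circ> \<tau>) \<circ> Transposition.transpose i n) \<circ> \<tau>"
      by (simp add: comp_assoc)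
    have 1: "is_index (\<kappa> \<circ> \<tau>)" unfolding \<tau>_def by (rule is_index_swap[OF step.prems(1) n(2,3)])
    have 2: "is_index ((\<kappa> \<circ> \<tau>) \<circ> Transposition.transpose i n)" by (rule is_index_swap[OF 1 step.prems(2) n(2)])
    have "minor (\<kappa> \<circ> Transposition.transpose i (Suc n)) = \<ominus> minor ((\<kappa> \<circ> \<tau>) \<circ> Transposition.transpose i n)"
      unfolding eq \<tau>_def by (rule minor_adjacent_swap[OF 2[unfolded \<tau>_def] n(1)])
    also have "\<dots> = \<ominus> (\<ominus> minor (\<kappa> \<circ> \<tau>))"
      unfolding step.IH[OF 1 step.prems(2) n(2)] ..
    also have "\<dots> = \<ominus> (\<ominus> (\<ominus> minor \<kappa>))"
      unfolding \<tau>_def minor_adjacent_swap[OF step.prems(1) n(1)] ..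
    also have "\<dots> = \<ominus> minor \<kappa>" using minor_closed[OF step.prems(1)] by simp
    finally show ?case .
  qed
qed

lemma minor_swap:
  assumes "i \<noteq> j" "is_index \<kappa>" "i \<in> {1..N}" "j \<in> {1..N}"
  shows "minor (\<kappa> \<circ> Transposition.transpose i j) = \<ominus> minor \<kappa>"
  using assms minor_swap_less[of i j \<kappa>] minor_swap_less[of j i \<kappa>]
  by (cases "i < j") (auto simp: Transposition.transpose_commute)

lemma minor_repeated_row:
  assumes "is_index \<kappa>" "\<not> inj_on \<kappa> {1..N}"
  shows "minor \<kappa> = \<zero>"
proof -
  obtain i j where ij: "i \<in> {1..N}" "j \<in> {1..N}" "i \<noteq> j" "\<kappa> i = \<kappa> j"
    using assms(2) unfolding inj_on_def by blast
  have "\<kappa> \<circ> Transposition.transpose i j = \<kappa>" using ij(4) by (auto simp: Transposition.transpose_def fun_eq_iff)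
  then have "minor \<kappa> = \<ominus> minor \<kappa>" using minor_swap[OF ij(3) assms(1) ij(1,2)] by (simp only:)
  then have "minor \<kappa> \<oplus> minor \<kappa> = \<zero>" using minor_closed[OF assms(1)] by (metis r_neg)
  then show ?thesis using two_torsion_free minor_closed[OF assms(1)] by blast
qed

lemma minor_perm:
  assumes "\<kappa> permutes {1..N}"
  shows "minor \<kappa> = signed \<kappa> (minor id)"
proof -
  have D: "minor id \<in> carrier R" by (rule minor_closed[OF is_index_id])
  have "finite {1..N}" by simp
  then show ?thesis using assms
  proof (induction rule: permutes_rev_induct)
    case id
    show ?case by (simp only: signed_eq[OF D] evenperm_id if_True)
  next
    case (swap a b \<sigma>)
    have "permutation \<sigma>" using swap permutes_imp_permutation[of "{1..N}"] by auto
    then have "evenperm (\<sigma> \<circ> Transposition.transpose a b) \<longleftrightarrow> \<not> evenperm \<sigma>"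
      using swap(3) by (simp add: evenperm_comp permutation_swap_id evenperm_swap)
    then show ?case
      unfolding minor_swap[OF swap(3) is_index_perm[OF swap(4)] swap(1,2)] swap(5) signed_eq[OF D]
      using D by simp
  qed
qed

lemma index_map_permutes:
  assumes "\<kappa> \<in> index_maps {1..N} {1..N}" "inj_on \<kappa> {1..N}"
  shows "\<kappa> permutes {1..N}"
proof (rule bij_imp_permutes)
  have "\<kappa> ` {1..N} \<subseteq> {1..N}" using assms(1) by (auto simp: index_maps_def)
  then show "bij_betw \<kappa> {1..N} {1..N}"
    using assms(2) endo_inj_surj[of "{1..N}" \<kappa>] by (auto simp: bij_betw_def)
qed (use assms(1) in \<open>auto simp: index_maps_def\<close>)

text \<open>Commutation collects the B-factors to the left of the A-factors. The summed index
  \<kappa> is then the row index of a minor of A, which contributes zero or the sign of \<kappa>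
  times the determinant of A, while B supplies its own determinant.\<close>

theorem determinant_product:
  assumes B: "\<And>i j n. i \<in> {1..N} \<Longrightarrow> j \<in> {1..N} \<Longrightarrow> n \<in> {1..N} \<Longrightarrow> B i j n \<in> carrier R"
    and comm: "\<And>i j n i' j' n'. i \<in> {1..N} \<Longrightarrow> j \<in> {1..N} \<Longrightarrow> n \<in> {1..N} \<Longrightarrow> i' \<in> {1..N} \<Longrightarrow>
       j' \<in> {1..N} \<Longrightarrow> n' \<in> {1..N} \<Longrightarrow> A i j n \<otimes> B i' j' n' = B i' j' n' \<otimes> A i j n"
  shows "(\<Oplus>\<sigma>\<in>perms. signed \<sigma> (lprod [1..<Suc N] (\<lambda>n. \<Oplus>k\<in>{1..N}. B n k n \<otimes> A k (\<sigma> n) n)))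
    = (\<Oplus>\<sigma>\<in>perms. signed \<sigma> (lprod [1..<Suc N] (\<lambda>n. B n (\<sigma> n) n)))
      \<otimes> (\<Oplus>\<sigma>\<in>perms. signed \<sigma> (lprod [1..<Suc N] (\<lambda>n. A n (\<sigma> n) n)))"
proof -
  let ?K = "index_maps {1..N} {1..N}"
  define PB where "PB \<kappa> = lprod [1..<Suc N] (\<lambda>n. B n (\<kappa> n) n)" for \<kappa>
  have fin: "finite ?K" by (simp add: finite_index_maps)
  have idx: "is_index \<kappa>" if "\<kappa> \<in> ?K" for \<kappa> using that by (auto simp: index_maps_def is_index_def)
  have set: "set [1..<Suc N] = {1..N}" by auto
  have PB: "PB \<kappa> \<in> carrier R" if "is_index \<kappa>" for \<kappa>
    unfolding PB_def using B[OF _ is_indexD[OF that]] by (intro lprod_closed, unfold set) blast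
  have expand: "lprod [1..<Suc N] (\<lambda>n. \<Oplus>k\<in>{1..N}. B n k n \<otimes> A k (\<sigma> n) n)
      = (\<Oplus>\<kappa>\<in>?K. PB \<kappa> \<otimes> row_prod \<kappa> \<sigma>)" if \<sigma>: "is_index \<sigma>" for \<sigma>
  proof -
    have "lprod [1..<Suc N] (\<lambda>n. \<Oplus>k\<in>{1..N}. B n k n \<otimes> A k (\<sigma> n) n)
      = (\<Oplus>\<kappa>\<in>?K. lprod [1..<Suc N] (\<lambda>n. B n (\<kappa> n) n \<otimes> A (\<kappa> n) (\<sigma> n) n))"
    proof (rule lprod_finsum[of "[1..<Suc N]", unfolded set])
      fix n k assume n: "n \<in> {1..N}" and k: "k \<in> {1..N}"
      show "B n k n \<otimes> A k (\<sigma> n) n \<in> carrier R"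
        by (rule m_closed[OF B[OF n k n] A_closed[OF k is_indexD[OF \<sigma> n] n]])
    qed auto
    also have "\<dots> = (\<Oplus>\<kappa>\<in>?K. PB \<kappa> \<otimes> row_prod \<kappa> \<sigma>)"
    proof (rule finsum_cong'[OF refl])
      fix \<kappa> assume "\<kappa> \<in> ?K"
      then have \<kappa>: "is_index \<kappa>" by (rule idx)
      show "lprod [1..<Suc N] (\<lambda>n. B n (\<kappa> n) n \<otimes> A (\<kappa> n) (\<sigma> n) n) = PB \<kappa> \<otimes> row_prod \<kappa> \<sigma>"
        unfolding PB_def row_prod_def
      proof (rule lprod_mult, unfold set)
        fix n m assume n: "n \<in> {1..N}" and m: "m \<in> {1..N}"
        show "B n (\<kappa> n) n \<in> carrier R" by (rule B[OF n is_indexD[OF \<kappa> n] n])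
        show "A (\<kappa> n) (\<sigma> n) n \<in> carrier R" by (rule A_index_closed[OF \<kappa> \<sigma> n])
        show "A (\<kappa> n) (\<sigma> n) n \<otimes> B m (\<kappa> m) m = B m (\<kappa> m) m \<otimes> A (\<kappa> n) (\<sigma> n) n"
          by (rule comm[OF is_indexD[OF \<kappa> n] is_indexD[OF \<sigma> n] n m is_indexD[OF \<kappa> m] m])
      qed
    qed (use PB idx \<sigma> in auto)
    finally show ?thesis .
  qed
  have "(\<Oplus>\<sigma>\<in>perms. signed \<sigma> (lprod [1..<Suc N] (\<lambda>n. \<Oplus>k\<in>{1..N}. B n k n \<otimes> A k (\<sigma> n) n)))
      = (\<Oplus>\<sigma>\<in>perms. \<Oplus>\<kappa>\<in>?K. PB \<kappa> \<otimes> signed \<sigma> (row_prod \<kappa> \<sigma>))"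
  proof (rule finsum_cong'[OF refl])
    fix \<sigma> assume "\<sigma> \<in> perms"
    then have \<sigma>: "is_index \<sigma>" using is_index_perm by blast
    have "signed \<sigma> (\<Oplus>\<kappa>\<in>?K. PB \<kappa> \<otimes> row_prod \<kappa> \<sigma>) = (\<Oplus>\<kappa>\<in>?K. signed \<sigma> (PB \<kappa> \<otimes> row_prod \<kappa> \<sigma>))"
      by (rule signed_finsum[OF fin]) (use PB idx \<sigma> in auto)
    also have "\<dots> = (\<Oplus>\<kappa>\<in>?K. PB \<kappa> \<otimes> signed \<sigma> (row_prod \<kappa> \<sigma>))"
      by (rule finsum_cong') (use PB idx \<sigma> in \<open>auto simp: signed_mult_right\<close>)
    finally show "signed \<sigma> (lprod [1..<Suc N] (\<lambda>n. \<Oplus>k\<in>{1..N}. B n k n \<otimes> A k (\<sigma> n) n))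
       = (\<Oplus>\<kappa>\<in>?K. PB \<kappa> \<otimes> signed \<sigma> (row_prod \<kappa> \<sigma>))"
      unfolding expand[OF \<sigma>] .
  next
    show "(\<lambda>\<sigma>. \<Oplus>\<kappa>\<in>?K. PB \<kappa> \<otimes> signed \<sigma> (row_prod \<kappa> \<sigma>)) \<in> perms \<rightarrow> carrier R"
      using PB idx is_index_perm by (auto intro!: finsum_closed m_closed signed_closed row_prod_closed)
  qed
  also have "\<dots> = (\<Oplus>\<kappa>\<in>?K. \<Oplus>\<sigma>\<in>perms. PB \<kappa> \<otimes> signed \<sigma> (row_prod \<kappa> \<sigma>))"
    by (rule finsum_swap[OF finite_perms fin])
       (use PB idx is_index_perm in \<open>auto intro!: m_closed signed_closed row_prod_closed\<close>)
  also have "\<dots> = (\<Oplus>\<kappa>\<in>?K. PB \<kappa> \<otimes> minor \<kappa>)"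
    unfolding minor_def
    by (rule finsum_cong'[OF refl _ finsum_rdistr[symmetric]])
       (use PB idx is_index_perm finite_perms in \<open>auto intro!: m_closed finsum_closed signed_closed row_prod_closed\<close>)
  \<comment> \<open>A self-map of {1..N} that is no permutation repeats a value, so its minor has a
    repeated row.\<close>
  also have "\<dots> = (\<Oplus>\<kappa>\<in>perms. PB \<kappa> \<otimes> minor \<kappa>)"
  proof (rule add.finprod_mono_neutral_cong_right[OF fin])
    show "perms \<subseteq> ?K" using is_indexD[OF is_index_perm] by (auto simp: index_maps_def permutes_not_in)
    show "PB \<kappa> \<otimes> minor \<kappa> = \<zero>" if "\<kappa> \<in> ?K - perms" for \<kappa>
      using that PB idx minor_repeated_row index_map_permutes by (metis DiffE mem_Collect_eq r_null)
  qed (use PB idx in auto)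
  also have "\<dots> = (\<Oplus>\<kappa>\<in>perms. signed \<kappa> (PB \<kappa>) \<otimes> minor id)"
  proof (rule finsum_cong'[OF refl])
    fix \<kappa> assume \<kappa>: "\<kappa> \<in> perms"
    then have "PB \<kappa> \<in> carrier R" "minor id \<in> carrier R"
      using PB is_index_perm minor_closed[OF is_index_id] by auto
    then show "PB \<kappa> \<otimes> minor \<kappa> = signed \<kappa> (PB \<kappa>) \<otimes> minor id"
      unfolding minor_perm[of \<kappa>, OF \<kappa>[unfolded mem_Collect_eq]]
      by (simp only: signed_mult_right signed_mult_left)
  qed (use PB is_index_perm minor_closed[OF is_index_id] in auto)
  also have "\<dots> = (\<Oplus>\<kappa>\<in>perms. signed \<kappa> (PB \<kappa>)) \<otimes> minor id"
    by (rule finsum_ldistr[symmetric])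
       (use PB is_index_perm minor_closed[OF is_index_id] finite_perms in auto)
  finally show ?thesis by (simp add: PB_def minor_def row_prod_def)
qed

end

section \<open>Functionals vanishing on a kernel\<close>

text \<open>Finite-dimensional duality, by induction on the rows. It turns a statement about complex
  kernel vectors into scalar coefficients, which can then be applied to elements of an
  ideal.\<close>

lemma functional_in_row_span:
  fixes r :: "'a \<Rightarrow> 'b \<Rightarrow> complex" and \<phi> :: "'b \<Rightarrow> complex"
  assumes "finite A" "finite B"
    and "\<And>x. (\<forall>a\<in>A. (\<Sum>b\<in>B. r a b * x b) = 0) \<Longrightarrow> (\<Sum>b\<in>B. \<phi> b * x b) = 0"
  shows "\<exists>c. \<forall>b\<in>B. \<phi> b = (\<Sum>a\<in>A. c a * r a b)"
  using assms(1,3)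
proof (induction A arbitrary: \<phi>)
  case empty
  have "\<phi> b = 0" if b: "b \<in> B" for b
  proof -
    have "(\<Sum>b'\<in>B. \<phi> b' * (if b' = b then 1 else 0)) = 0" by (rule empty) simp
    then show ?thesis using b assms(2) by (simp add: if_distrib cong: if_cong)
  qed
  then show ?case by simp
next
  case (insert a0 A)
  show ?case
  proof (cases "\<exists>x. (\<forall>a\<in>A. (\<Sum>b\<in>B. r a b * x b) = 0) \<and> (\<Sum>b\<in>B. r a0 b * x b) \<noteq> 0")
    case True
    then obtain x0 where x0: "\<And>a. a \<in> A \<Longrightarrow> (\<Sum>b\<in>B. r a b * x0 b) = 0" "(\<Sum>b\<in>B. r a0 b * x0 b) \<noteq> 0"
      by blast
    define m where "m = (\<Sum>b\<in>B. r a0 b * x0 b)"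
    \<comment> \<open>With this k the functional \<phi> - k * r a0 vanishes at x0, and subtracting a
      multiple of x0 brings any vector of the kernel of A into the kernel of row a0 as well.\<close>
    define k where "k = (\<Sum>b\<in>B. \<phi> b * x0 b) / m"
    have m: "m \<noteq> 0" using x0(2) by (simp add: m_def)
    have "\<exists>c. \<forall>b\<in>B. \<phi> b - k * r a0 b = (\<Sum>a\<in>A. c a * r a b)"
    proof (rule insert.IH)
      fix x assume x: "\<forall>a\<in>A. (\<Sum>b\<in>B. r a b * x b) = 0"
      define t where "t = (\<Sum>b\<in>B. r a0 b * x b) / m"
      have lin: "(\<Sum>b\<in>B. f b * (x b - t * x0 b)) = (\<Sum>b\<in>B. f b * x b) - t * (\<Sum>b\<in>B. f b * x0 b)" for f
        by (simp add: sum_subtractf sum_distrib_left algebra_simps)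
      have "(\<Sum>b\<in>B. \<phi> b * (x b - t * x0 b)) = 0"
      proof (rule insert.prems, safe)
        fix a assume "a \<in> A"
        then show "(\<Sum>b\<in>B. r a b * (x b - t * x0 b)) = 0" using x x0(1) by (simp add: lin)
      next
        show "(\<Sum>b\<in>B. r a0 b * (x b - t * x0 b)) = 0"
          using lin[of "r a0"] m by (simp add: t_def flip: m_def)
      qed
      then have "(\<Sum>b\<in>B. \<phi> b * x b) = k * (\<Sum>b\<in>B. r a0 b * x b)"
        using m unfolding lin by (simp add: k_def t_def)
      then show "(\<Sum>b\<in>B. (\<phi> b - k * r a0 b) * x b) = 0"
        by (simp add: left_diff_distrib sum_subtractf sum_distrib_left mult.assoc)
    qed
    then obtain c where c: "\<And>b. b \<in> B \<Longrightarrow> \<phi> b - k * r a0 b = (\<Sum>a\<in>A. c a * r a b)" by blast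
    have "\<phi> b = (\<Sum>a\<in>insert a0 A. (c(a0 := k)) a * r a b)" if "b \<in> B" for b
    proof -
      have "(\<Sum>a\<in>A. (c(a0 := k)) a * r a b) = (\<Sum>a\<in>A. c a * r a b)"
        by (rule sum.cong) (use insert.hyps in auto)
      then show ?thesis using insert.hyps c[OF that] by (simp add: algebra_simps)
    qed
    then show ?thesis by blast
  next
    case False
    then have "\<exists>c. \<forall>b\<in>B. \<phi> b = (\<Sum>a\<in>A. c a * r a b)"
      by (intro insert.IH insert.prems) auto
    then obtain c where c: "\<And>b. b \<in> B \<Longrightarrow> \<phi> b = (\<Sum>a\<in>A. c a * r a b)" by blast
    have "\<phi> b = (\<Sum>a\<in>insert a0 A. (c(a0 := 0)) a * r a b)" if "b \<in> B" for b
    proof -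
      have "(\<Sum>a\<in>A. (c(a0 := 0)) a * r a b) = (\<Sum>a\<in>A. c a * r a b)"
        by (rule sum.cong) (use insert.hyps in auto)
      then show ?thesis using insert.hyps c[OF that] by simp
    qed
    then show ?thesis by blast
  qed
qed

section \<open>Ideals of series rings and tensor products\<close>

lemma carrier_series_ring: "f \<in> carrier (series_ring M) \<longleftrightarrow> (\<forall>m. m \<notin> carrier M \<longrightarrow> f m = 0)"
  by (simp add: series_ring_def)

lemma series_ring_add: "f \<oplus>\<^bsub>series_ring M\<^esub> g = (\<lambda>m. f m + g m)"
  by (simp add: series_ring_def)

lemma series_ring_mult:
  "(f \<otimes>\<^bsub>series_ring M\<^esub> g) m
    = (\<Sum>(x, y)\<in>{(x, y). x \<in> carrier M \<and> y \<in> carrier M \<and> x \<otimes>\<^bsub>M\<^esub> y = m}. f x * g y)"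
  by (simp add: series_ring_def)

lemma series_ring_zero: "\<zero>\<^bsub>series_ring M\<^esub> = (\<lambda>m. 0)"
  by (simp add: series_ring_def)

lemma series_ring_one: "\<one>\<^bsub>series_ring M\<^esub> = (\<lambda>m. if m = \<one>\<^bsub>M\<^esub> then 1 else 0)"
  by (simp add: series_ring_def)

context
  fixes M :: "'m monoid"
  assumes M: "Group.monoid M" and ring: "ring (series_ring M)"
begin

lemma series_const_closed: "series_const M k \<in> carrier (series_ring M)"
  using Group.monoid.one_closed[OF M] by (auto simp: series_const_def carrier_series_ring)

lemma series_const_mult:
  assumes "f \<in> carrier (series_ring M)"
  shows "series_const M k \<otimes>\<^bsub>series_ring M\<^esub> f = (\<lambda>m. k * f m)"
proof
  fix m
  interpret ring "series_ring M" by (rule ring)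
  have "(series_const M k \<otimes>\<^bsub>series_ring M\<^esub> f) m = k * (\<one>\<^bsub>series_ring M\<^esub> \<otimes>\<^bsub>series_ring M\<^esub> f) m"
    unfolding series_ring_mult sum_distrib_left
    by (rule sum.cong) (auto simp: series_const_def series_ring_one)
  then show "(series_const M k \<otimes>\<^bsub>series_ring M\<^esub> f) m = k * f m"
    using assms by simp
qed

text \<open>Constant series belong to the ring and multiply as scalars, so a ring ideal is
  automatically a complex subspace.\<close>

lemma ideal_scale:
  assumes "ideal I (series_ring M)" "f \<in> I"
  shows "(\<lambda>m. k * f m) \<in> I"
proof -
  have "f \<in> carrier (series_ring M)" using ideal.Icarr[OF assms] .
  with ideal.I_l_closed[OF assms series_const_closed] show ?thesis by (simp add: series_const_mult)
qed

lemma ideal_zero: "ideal I (series_ring M) \<Longrightarrow> (\<lambda>m. 0) \<in> I"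
  using additive_subgroup.zero_closed[OF ideal.axioms(1)] by (fastforce simp: series_ring_zero)

lemma ideal_add:
  assumes "ideal I (series_ring M)" "f \<in> I" "g \<in> I"
  shows "(\<lambda>m. f m + g m) \<in> I"
  using additive_subgroup.a_closed[OF ideal.axioms(1)[OF assms(1)] assms(2,3)] by (simp add: series_ring_add)

lemma ideal_sum:
  assumes "ideal I (series_ring M)" "finite A" "\<And>a. a \<in> A \<Longrightarrow> f a \<in> I"
  shows "(\<lambda>m. \<Sum>a\<in>A. f a m) \<in> I"
  using assms(2,3)
proof (induction A)
  case empty
  then show ?case using ideal_zero[OF assms(1)] by simp
next
  case (insert a A)
  then show ?case using ideal_add[OF assms(1), of "f a" "\<lambda>m. \<Sum>a\<in>A. f a m"] by simp
qed

text \<open>If f + f lies in the ideal, scaling by 1/2 puts f there.\<close>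

lemma quotient_two_torsion_free:
  assumes I: "ideal I (series_ring M)" and x: "x \<in> carrier (series_ring M Quot I)"
    and "x \<oplus>\<^bsub>series_ring M Quot I\<^esub> x = \<zero>\<^bsub>series_ring M Quot I\<^esub>"
  shows "x = \<zero>\<^bsub>series_ring M Quot I\<^esub>"
proof -
  interpret ideal I "series_ring M" by fact
  obtain f where f: "f \<in> carrier (series_ring M)" "x = I +>\<^bsub>series_ring M\<^esub> f"
    using x by (auto simp: FactRing_def A_RCOSETS_def' )
  have "I +>\<^bsub>series_ring M\<^esub> (f \<oplus>\<^bsub>series_ring M\<^esub> f) = I"
    using assms(3) f a_rcos_sum[of f f] by (simp add: FactRing_def)
  then have "f \<oplus>\<^bsub>series_ring M\<^esub> f \<in> I"
    using a_rcos_self[of "f \<oplus>\<^bsub>series_ring M\<^esub> f"] f by auto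
  from ideal_scale[OF I this, of "1/2"] have "f \<in> I" by (simp add: series_ring_add)
  then show ?thesis using f by (simp add: FactRing_def a_rcos_const)
qed

end

lemma monoid_words: "Group.monoid (words N)"
  by (rule monoidI) (simp_all add: words_def)

lemma monoid_words2: "Group.monoid (words N \<times>\<times> words N)"
  using DirProd_monoid[OF monoid_words monoid_words] .

lemmas free_ideal_scale = ideal_scale[OF monoid_words ring_free_ring]
lemmas free_ideal_add = ideal_add[OF monoid_words ring_free_ring]
lemmas free_ideal_sum = ideal_sum[OF monoid_words ring_free_ring]

lemma L_series_closed: "i \<in> {1..N} \<Longrightarrow> j \<in> {1..N} \<Longrightarrow> L_series i j z \<in> carrier (free_ring N)"
  by (auto simp: carrier_series_ring L_series_def words_def split: list.splits)

lemma tensor_closed: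
  "f \<in> carrier (free_ring N) \<Longrightarrow> g \<in> carrier (free_ring N) \<Longrightarrow> tensor_series f g \<in> carrier (free_ring2 N)"
  by (auto simp: carrier_series_ring tensor_series_def)

lemma tensor_one: "tensor_series \<one>\<^bsub>free_ring N\<^esub> \<one>\<^bsub>free_ring N\<^esub> = \<one>\<^bsub>free_ring2 N\<^esub>"
  by (auto simp: series_ring_one tensor_series_def fun_eq_iff)

text \<open>Factorizations of a pair of words are pairs of factorizations, so the convolution sum
  splits into a product of two.\<close>

lemma tensor_mult:
  "tensor_series f g \<otimes>\<^bsub>free_ring2 N\<^esub> tensor_series f' g'
    = tensor_series (f \<otimes>\<^bsub>free_ring N\<^esub> f') (g \<otimes>\<^bsub>free_ring N\<^esub> g')"
proof
  fix m :: "letter list \<times> letter list"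
  obtain u v where m: "m = (u, v)" by (cases m)
  let ?D = "\<lambda>u. {(x, y). x \<in> carrier (words N) \<and> y \<in> carrier (words N) \<and> x \<otimes>\<^bsub>words N\<^esub> y = u}"
  have "(tensor_series f g \<otimes>\<^bsub>free_ring2 N\<^esub> tensor_series f' g') m
      = (\<Sum>((x, y), (x', y'))\<in>?D u \<times> ?D v. (f x * g x') * (f' y * g' y'))"
    unfolding series_ring_mult
    by (rule sum.reindex_bij_witness[where j = "\<lambda>((x, x'), (y, y')). ((x, y), (x', y'))"
          and i = "\<lambda>((x, y), (x', y')). ((x, x'), (y, y'))"])
       (auto simp: m tensor_series_def)
  also have "\<dots> = (\<Sum>(x, y)\<in>?D u. f x * f' y) * (\<Sum>(x, y)\<in>?D v. g x * g' y)"
    unfolding sum_product sum.cartesian_product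
    by (rule sum.cong) (auto simp: mult_ac)
  finally show "(tensor_series f g \<otimes>\<^bsub>free_ring2 N\<^esub> tensor_series f' g') m
      = tensor_series (f \<otimes>\<^bsub>free_ring N\<^esub> f') (g \<otimes>\<^bsub>free_ring N\<^esub> g') m"
    by (simp add: m tensor_series_def series_ring_mult)
qed

lemma tensor_left_hom: "(\<lambda>f. tensor_series f \<one>\<^bsub>free_ring N\<^esub>) \<in> ring_hom (free_ring N) (free_ring2 N)"
proof (rule ring_hom_memI)
  interpret ring "free_ring N" by (rule ring_free_ring)
  fix f g assume "f \<in> carrier (free_ring N)" "g \<in> carrier (free_ring N)"
  show "tensor_series f \<one>\<^bsub>free_ring N\<^esub> \<in> carrier (free_ring2 N)" by (rule tensor_closed) (fact, simp)
  show "tensor_series (f \<otimes>\<^bsub>free_ring N\<^esub> g) \<one>\<^bsub>free_ring N\<^esub>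
      = tensor_series f \<one>\<^bsub>free_ring N\<^esub> \<otimes>\<^bsub>free_ring2 N\<^esub> tensor_series g \<one>\<^bsub>free_ring N\<^esub>"
    by (simp add: tensor_mult)
  show "tensor_series (f \<oplus>\<^bsub>free_ring N\<^esub> g) \<one>\<^bsub>free_ring N\<^esub>
      = tensor_series f \<one>\<^bsub>free_ring N\<^esub> \<oplus>\<^bsub>free_ring2 N\<^esub> tensor_series g \<one>\<^bsub>free_ring N\<^esub>"
    by (auto simp: series_ring_add tensor_series_def fun_eq_iff distrib_right)
qed (rule tensor_one)

lemma tensor_right_hom: "(\<lambda>f. tensor_series \<one>\<^bsub>free_ring N\<^esub> f) \<in> ring_hom (free_ring N) (free_ring2 N)"
proof (rule ring_hom_memI)
  interpret ring "free_ring N" by (rule ring_free_ring)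
  fix f g assume "f \<in> carrier (free_ring N)" "g \<in> carrier (free_ring N)"
  show "tensor_series \<one>\<^bsub>free_ring N\<^esub> f \<in> carrier (free_ring2 N)" by (rule tensor_closed) (simp, fact)
  show "tensor_series \<one>\<^bsub>free_ring N\<^esub> (f \<otimes>\<^bsub>free_ring N\<^esub> g)
      = tensor_series \<one>\<^bsub>free_ring N\<^esub> f \<otimes>\<^bsub>free_ring2 N\<^esub> tensor_series \<one>\<^bsub>free_ring N\<^esub> g"
    by (simp add: tensor_mult)
  show "tensor_series \<one>\<^bsub>free_ring N\<^esub> (f \<oplus>\<^bsub>free_ring N\<^esub> g)
      = tensor_series \<one>\<^bsub>free_ring N\<^esub> f \<oplus>\<^bsub>free_ring2 N\<^esub> tensor_series \<one>\<^bsub>free_ring N\<^esub> g"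
    by (auto simp: series_ring_add tensor_series_def fun_eq_iff distrib_left)
qed (rule tensor_one)

lemma ring_hom_qdet:
  assumes R: "ring R" and S: "ring S" and h: "h \<in> ring_hom R S"
    and L: "\<And>i j n. i \<in> {1..N} \<Longrightarrow> j \<in> {1..N} \<Longrightarrow> L i j (z * q powi (1 - int i)) \<in> carrier R"
  shows "h (qdet R N q L z) = qdet S N q (\<lambda>i j z. h (L i j z)) z"
proof -
  interpret R: ring R by fact
  interpret S: ring S by fact
  interpret h: ring_hom_ring R S h by (rule ring_hom_ringI2[OF R S h])
  let ?P = "{\<sigma>. \<sigma> permutes {1..N}}"
  let ?f = "\<lambda>\<sigma> i. L i (\<sigma> i) (z * q powi (1 - int i))"
  have fold: "foldr (\<otimes>\<^bsub>R\<^esub>) (map f xs) \<one>\<^bsub>R\<^esub> \<in> carrier R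
      \<and> h (foldr (\<otimes>\<^bsub>R\<^esub>) (map f xs) \<one>\<^bsub>R\<^esub>) = foldr (\<otimes>\<^bsub>S\<^esub>) (map (\<lambda>i. h (f i)) xs) \<one>\<^bsub>S\<^esub>"
    if "\<And>i. i \<in> set xs \<Longrightarrow> f i \<in> carrier R" for f :: "nat \<Rightarrow> _" and xs
    using that by (induction xs) auto
  have f: "?f \<sigma> i \<in> carrier R" if "\<sigma> \<in> ?P" "i \<in> set [1..<Suc N]" for \<sigma> i
  proof -
    have i: "i \<in> {1..N}" using that(2) by auto
    moreover have "\<sigma> i \<in> {1..N}" using permutes_in_image[of \<sigma> "{1..N}" i] that(1) i by blast
    ultimately show ?thesis by (rule L)
  qed
  have c: "foldr (\<otimes>\<^bsub>R\<^esub>) (map (?f \<sigma>) [1..<Suc N]) \<one>\<^bsub>R\<^esub> \<in> carrier R"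
    and e: "h (foldr (\<otimes>\<^bsub>R\<^esub>) (map (?f \<sigma>) [1..<Suc N]) \<one>\<^bsub>R\<^esub>)
      = foldr (\<otimes>\<^bsub>S\<^esub>) (map (\<lambda>i. h (?f \<sigma> i)) [1..<Suc N]) \<one>\<^bsub>S\<^esub>" if "\<sigma> \<in> ?P" for \<sigma>
    using fold[of "[1..<Suc N]" "?f \<sigma>"] f[OF that] by blast+
  have hs: "h (add_pow R (sign \<sigma> :: int) x) = add_pow S (sign \<sigma> :: int) (h x)"
    if "x \<in> carrier R" for \<sigma> :: "nat \<Rightarrow> nat" and x
    using that by (simp add: R.signed_eq S.signed_eq)
  have sum: "h (\<Oplus>\<^bsub>R\<^esub>a\<in>A. f a) = (\<Oplus>\<^bsub>S\<^esub>a\<in>A. h (f a))"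
    if "finite A" "f \<in> A \<rightarrow> carrier R" for A :: "(nat \<Rightarrow> nat) set" and f
    using that
  proof (induction A)
    case (insert a A)
    then have "f a \<in> carrier R" "f \<in> A \<rightarrow> carrier R" by auto
    moreover from this have "h (f a) \<in> carrier S" "(\<lambda>a. h (f a)) \<in> A \<rightarrow> carrier S"
      by (auto simp: Pi_def)
    ultimately show ?case using insert by simp
  qed simp
  have "h (qdet R N q L z) = (\<Oplus>\<^bsub>S\<^esub>\<sigma>\<in>?P. h (add_pow R (sign \<sigma> :: int)
      (foldr (\<otimes>\<^bsub>R\<^esub>) (map (?f \<sigma>) [1..<Suc N]) \<one>\<^bsub>R\<^esub>)))"
    unfolding qdet_def using c by (intro sum finite_permutations) auto
  also have "\<dots> = qdet S N q (\<lambda>i j z. h (L i j z)) z"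
    unfolding qdet_def
  proof (rule S.finsum_cong'[OF refl])
    show "(\<lambda>\<sigma>. add_pow S (sign \<sigma> :: int) (foldr (\<otimes>\<^bsub>S\<^esub>) (map (\<lambda>i. h (?f \<sigma> i)) [1..<Suc N]) \<one>\<^bsub>S\<^esub>))
        \<in> ?P \<rightarrow> carrier S"
    proof
      fix \<sigma> assume \<sigma>: "\<sigma> \<in> ?P"
      show "add_pow S (sign \<sigma> :: int) (foldr (\<otimes>\<^bsub>S\<^esub>) (map (\<lambda>i. h (?f \<sigma> i)) [1..<Suc N]) \<one>\<^bsub>S\<^esub>) \<in> carrier S"
        unfolding e[OF \<sigma>, symmetric] by (intro S.signed_closed h.hom_closed c[OF \<sigma>])
    qed
  next
    fix \<sigma> assume \<sigma>: "\<sigma> \<in> ?P"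
    show "h (add_pow R (sign \<sigma> :: int) (foldr (\<otimes>\<^bsub>R\<^esub>) (map (?f \<sigma>) [1..<Suc N]) \<one>\<^bsub>R\<^esub>))
        = add_pow S (sign \<sigma> :: int) (foldr (\<otimes>\<^bsub>S\<^esub>) (map (\<lambda>i. h (?f \<sigma> i)) [1..<Suc N]) \<one>\<^bsub>S\<^esub>)"
      unfolding hs[OF c[OF \<sigma>]] e[OF \<sigma>] ..
  qed
  finally show ?thesis .
qed

lemma mem_cosetE:
  assumes "x \<in> I +>\<^bsub>R\<^esub> f"
  obtains i where "i \<in> I" "x = i \<oplus>\<^bsub>R\<^esub> f"
  using assms unfolding a_r_coset_def' by auto

section \<open>Tensor product of two quotients of the free ring\<close>

locale quotient_tensor =
  fixes N :: nat and I J :: "(letter list \<Rightarrow> complex) set"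
  assumes I: "ideal I (free_ring N)" and J: "ideal J (free_ring N)"
begin

text \<open>Defined on representatives in the free ring, where the homomorphism property follows by
  composition; compatibility with the quotient by I is \<open>left_eq_0\<close>.\<close>

definition left :: "(letter list \<Rightarrow> complex) \<Rightarrow> (letter list \<times> letter list \<Rightarrow> complex) set" where
  "left f = tensor_ideal N I J +>\<^bsub>free_ring2 N\<^esub> tensor_series f \<one>\<^bsub>free_ring N\<^esub>"

definition right :: "(letter list \<Rightarrow> complex) \<Rightarrow> (letter list \<times> letter list \<Rightarrow> complex) set" where
  "right f = tensor_ideal N I J +>\<^bsub>free_ring2 N\<^esub> tensor_series \<one>\<^bsub>free_ring N\<^esub> f"

lemma tensor_ideal_generators:
  "{tensor_series f \<one>\<^bsub>free_ring N\<^esub> | f. f \<in> I} \<union> {tensor_series \<one>\<^bsub>free_ring N\<^esub> g | g. g \<in> J}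
    \<subseteq> carrier (free_ring2 N)"
  using ideal.Icarr[OF I] ideal.Icarr[OF J] ring.ring_simprules(6)[OF ring_free_ring, of N]
  by (auto intro!: tensor_closed)

lemma ideal_tensor_ideal: "ideal (tensor_ideal N I J) (free_ring2 N)"
  unfolding tensor_ideal_def by (rule ring.genideal_ideal[OF ring_free_ring2 tensor_ideal_generators])

lemma ring_tensor_alg: "ring (tensor_alg N I J)"
  unfolding tensor_alg_def by (rule ideal.quotient_is_ring[OF ideal_tensor_ideal])

lemma left_hom: "left \<in> ring_hom (free_ring N) (tensor_alg N I J)"
  using ring_hom_trans[OF tensor_left_hom ideal.rcos_ring_hom[OF ideal_tensor_ideal]]
  by (simp add: left_def[abs_def] tensor_alg_def o_def)

lemma right_hom: "right \<in> ring_hom (free_ring N) (tensor_alg N I J)"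
  using ring_hom_trans[OF tensor_right_hom ideal.rcos_ring_hom[OF ideal_tensor_ideal]]
  by (simp add: right_def[abs_def] tensor_alg_def o_def)

lemma left_eq_0: "f \<in> I \<Longrightarrow> left f = \<zero>\<^bsub>tensor_alg N I J\<^esub>"
proof -
  assume f: "f \<in> I"
  interpret ideal "tensor_ideal N I J" "free_ring2 N" by (rule ideal_tensor_ideal)
  have "tensor_series f \<one>\<^bsub>free_ring N\<^esub> \<in> tensor_ideal N I J"
    using f ring.genideal_self[OF ring_free_ring2 tensor_ideal_generators] unfolding tensor_ideal_def by blast
  then show ?thesis by (simp add: left_def tensor_alg_def FactRing_def a_rcos_const)
qed

lemma right_eq_0: "f \<in> J \<Longrightarrow> right f = \<zero>\<^bsub>tensor_alg N I J\<^esub>"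
proof -
  assume f: "f \<in> J"
  interpret ideal "tensor_ideal N I J" "free_ring2 N" by (rule ideal_tensor_ideal)
  have "tensor_series \<one>\<^bsub>free_ring N\<^esub> f \<in> tensor_ideal N I J"
    using f ring.genideal_self[OF ring_free_ring2 tensor_ideal_generators] unfolding tensor_ideal_def by blast
  then show ?thesis by (simp add: right_def tensor_alg_def FactRing_def a_rcos_const)
qed

text \<open>Both orders give the same class, which is the commutation of the two tensor
  factors.\<close>

lemma left_right_mult:
  assumes "f \<in> carrier (free_ring N)" "g \<in> carrier (free_ring N)"
  shows "left f \<otimes>\<^bsub>tensor_alg N I J\<^esub> right g = tensor_ideal N I J +>\<^bsub>free_ring2 N\<^esub> tensor_series f g"
    and "right g \<otimes>\<^bsub>tensor_alg N I J\<^esub> left f = tensor_ideal N I J +>\<^bsub>free_ring2 N\<^esub> tensor_series f g"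
proof -
  interpret F: ring "free_ring N" by (rule ring_free_ring)
  have hom: "(+>\<^bsub>free_ring2 N\<^esub>) (tensor_ideal N I J) \<in> ring_hom (free_ring2 N) (tensor_alg N I J)"
    unfolding tensor_alg_def by (rule ideal.rcos_ring_hom[OF ideal_tensor_ideal])
  show "left f \<otimes>\<^bsub>tensor_alg N I J\<^esub> right g = tensor_ideal N I J +>\<^bsub>free_ring2 N\<^esub> tensor_series f g"
    unfolding left_def right_def
    using ring_hom_mult[OF hom tensor_closed tensor_closed, of f "\<one>\<^bsub>free_ring N\<^esub>" "\<one>\<^bsub>free_ring N\<^esub>" g] assms
    by (simp add: tensor_mult)
  show "right g \<otimes>\<^bsub>tensor_alg N I J\<^esub> left f = tensor_ideal N I J +>\<^bsub>free_ring2 N\<^esub> tensor_series f g"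
    unfolding left_def right_def
    using ring_hom_mult[OF hom tensor_closed tensor_closed, of "\<one>\<^bsub>free_ring N\<^esub>" g f "\<one>\<^bsub>free_ring N\<^esub>"] assms
    by (simp add: tensor_mult)
qed

text \<open>Other representatives differ by elements of I or J, which \<open>left\<close> and
  \<open>right\<close> send to zero. All cosets in the union defining \<open>tensor_class\<close>
  therefore coincide.\<close>

lemma tensor_class_cosets:
  assumes f: "f \<in> carrier (free_ring N)" and g: "g \<in> carrier (free_ring N)"
  shows "tensor_class N I J (I +>\<^bsub>free_ring N\<^esub> f) (J +>\<^bsub>free_ring N\<^esub> g)
    = left f \<otimes>\<^bsub>tensor_alg N I J\<^esub> right g"
proof -
  interpret F: ring "free_ring N" by (rule ring_free_ring)
  interpret T: ring "tensor_alg N I J" by (rule ring_tensor_alg)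
  interpret I: ideal I "free_ring N" by (rule I)
  interpret J: ideal J "free_ring N" by (rule J)
  have l: "left f' = left f \<and> f' \<in> carrier (free_ring N)" if f': "f' \<in> I +>\<^bsub>free_ring N\<^esub> f" for f'
  proof -
    obtain i where i: "i \<in> I" "f' = i \<oplus>\<^bsub>free_ring N\<^esub> f" by (rule mem_cosetE[OF f'])
    have "left f \<in> carrier (tensor_alg N I J)" using ring_hom_closed[OF left_hom f] .
    then show ?thesis
      using ring_hom_add[OF left_hom I.Icarr[OF i(1)] f] left_eq_0[OF i(1)] i I.Icarr[OF i(1)] f by simp
  qed
  have r: "right g' = right g \<and> g' \<in> carrier (free_ring N)" if g': "g' \<in> J +>\<^bsub>free_ring N\<^esub> g" for g'
  proof -
    obtain i where i: "i \<in> J" "g' = i \<oplus>\<^bsub>free_ring N\<^esub> g" by (rule mem_cosetE[OF g'])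
    have "right g \<in> carrier (tensor_alg N I J)" using ring_hom_closed[OF right_hom g] .
    then show ?thesis
      using ring_hom_add[OF right_hom J.Icarr[OF i(1)] g] right_eq_0[OF i(1)] i J.Icarr[OF i(1)] g by simp
  qed
  have "tensor_ideal N I J +>\<^bsub>free_ring2 N\<^esub> tensor_series f' g' = left f \<otimes>\<^bsub>tensor_alg N I J\<^esub> right g"
    if "f' \<in> I +>\<^bsub>free_ring N\<^esub> f" "g' \<in> J +>\<^bsub>free_ring N\<^esub> g" for f' g'
    using left_right_mult(1)[of f' g'] l[OF that(1)] r[OF that(2)] by simp
  moreover have "f \<in> I +>\<^bsub>free_ring N\<^esub> f" "g \<in> J +>\<^bsub>free_ring N\<^esub> g"
    using I.a_rcos_self[OF f] J.a_rcos_self[OF g] by auto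
  ultimately show ?thesis unfolding tensor_class_def by blast
qed

end

section \<open>Antisymmetry from the RLL relations\<close>

lemma generic_independent_nome:
  assumes "generic lg q p c" "N \<ge> 2" "log_choice lg" "q \<noteq> 0" "norm q < 1" "p \<noteq> 0" "norm p < 1"
  shows "independent_nome N lg q p"
proof
  fix k l :: int assume "p powi k * q powi l = 1"
  then have "p powi k * q powi l * cpow lg q c powi 0 = 1" by simp
  then show "k = 0 \<and> l = 0" using assms(1) unfolding generic_def by blast
qed (use assms in auto)

text \<open>The k-th power of the shifted nome is p^k (q^c)^(-2k), so a relation between it and q is
  one among p, q and q^c with the same exponents of p and q.\<close>

lemma generic_independent_shift_nome:
  assumes "generic lg q p c" "N \<ge> 2" "log_choice lg" "q \<noteq> 0" "norm q < 1" "p \<noteq> 0"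
    and "norm (shift_nome lg q p c) < 1"
  shows "independent_nome N lg q (shift_nome lg q p c)"
proof
  fix k l :: int assume *: "shift_nome lg q p c powi k * q powi l = 1"
  have "cpow lg q (- 2 * c) = cpow lg q c powi (- 2)"
    by (simp add: cpow_def exp_power_int mult_ac)
  then have "shift_nome lg q p c powi k = p powi k * cpow lg q c powi (- 2 * k)"
    by (simp add: shift_nome_def power_int_mult_distrib flip: power_int_mult)
  with * have "p powi k * q powi l * cpow lg q c powi (- 2 * k) = 1"
    by (simp add: mult_ac)
  then show "k = 0 \<and> l = 0" using assms(1) unfolding generic_def by blast
qed (use assms in \<open>auto simp: shift_nome_def cpow_def\<close>)

lemma shift_nome_shift_nome: "shift_nome lg q (shift_nome lg q p c2) c1 = shift_nome lg q p (c1 + c2)"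
  by (simp add: shift_nome_def cpow_def exp_add[symmetric] algebra_simps)

text \<open>Places q among the ratios for which the RLL relations are imposed.\<close>

lemma q_regular:
  assumes "q \<noteq> 0" "\<And>p. p \<in> P \<Longrightarrow> independent_nome N lg q p"
  shows "q \<in> regular_points lg N q P"
  unfolding regular_points_def using assms independent_nome.Rhat_at_q(2) by blast

lemma RLL_entry_closed:
  assumes "a \<in> {1..N}" "c \<in> {1..N}" "e \<in> {1..N}" "f \<in> {1..N}"
  shows "RLL_entry lg N q p ch a c e f z w \<in> carrier (free_ring N)"
proof -
  interpret ring "free_ring N" by (rule ring_free_ring)
  have "(L_series i j x \<otimes>\<^bsub>free_ring N\<^esub> L_series k l y) v = 0"
    if "v \<notin> carrier (words N)" "i \<in> {1..N}" "j \<in> {1..N}" "k \<in> {1..N}" "l \<in> {1..N}" for i j k l x y v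
    using m_closed[OF L_series_closed[OF that(2,3)] L_series_closed[OF that(4,5)]] that(1)
    unfolding carrier_series_ring by blast
  then show ?thesis
    unfolding carrier_series_ring RLL_entry_def using assms by (simp add: sum.neutral)
qed

lemma RLL_generators:
  "{RLL_entry lg N q p ch a c e f z w | a c e f z w.
      a \<in> {1..N} \<and> c \<in> {1..N} \<and> e \<in> {1..N} \<and> f \<in> {1..N} \<and> z \<noteq> 0 \<and> w \<noteq> 0 \<and> z / w \<in> X}
    \<subseteq> carrier (free_ring N)"
  using RLL_entry_closed by blast

lemma ideal_RLL_ideal: "ideal (RLL_ideal lg N q X p ch) (free_ring N)"
  unfolding RLL_ideal_def by (rule ring.genideal_ideal[OF ring_free_ring RLL_generators])

lemma RLL_entry_mem:
  assumes "a \<in> {1..N}" "c \<in> {1..N}" "e \<in> {1..N}" "f \<in> {1..N}" "z \<noteq> 0" "w \<noteq> 0" "z / w \<in> X"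
  shows "RLL_entry lg N q p ch a c e f z w \<in> RLL_ideal lg N q X p ch"
  unfolding RLL_ideal_def
  by (rule subsetD[OF ring.genideal_self[OF ring_free_ring RLL_generators]]) (use assms in blast)

text \<open>The element is written explicitly through generators: differences of two RLL entries
  with exchanged columns, combined with the coefficients that express \<phi> through the rows of
  \<open>P.Rq\<close>.\<close>

lemma RLL_antisymmetric_mem:
  assumes p: "independent_nome N lg q p" and p': "independent_nome N lg q (shift_nome lg q p ch)"
    and q: "q \<in> X" and zw: "z \<noteq> 0" "w \<noteq> 0" "z / w = q"
    and i: "i \<in> {1..N}" "i' \<in> {1..N}" and j: "j \<in> {1..N}" "j' \<in> {1..N}"
  defines "V \<equiv> \<lambda>b d v. (L_series b j z \<otimes>\<^bsub>free_ring N\<^esub> L_series d j' w) v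
      - (L_series b j' z \<otimes>\<^bsub>free_ring N\<^esub> L_series d j w) v"
  shows "(\<lambda>v. V i i' v + V i' i v) \<in> RLL_ideal lg N q X p ch"
proof -
  let ?I = "RLL_ideal lg N q X p ch"
  interpret P: independent_nome N lg q p by (rule p)
  interpret P': independent_nome N lg q "shift_nome lg q p ch" by (rule p')
  define A where "A = {1..N} \<times> {1..N}"
  \<comment> \<open>A sum of two indicators, so that for i = i' the diagonal entry counts twice, as
    in the conclusion.\<close>
  define \<phi> :: "nat \<times> nat \<Rightarrow> complex" where
    "\<phi> b = (if b = (i, i') then 1 else 0) + (if b = (i', i) then 1 else 0)" for b
  have A: "finite A" "(i, i') \<in> A" "(i', i) \<in> A" using i by (auto simp: A_def)
  have \<phi>_sum: "(\<Sum>b\<in>A. \<phi> b * x b) = x (i, i') + x (i', i)" for x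
    using A by (simp add: \<phi>_def distrib_right sum.distrib if_distrib[of "\<lambda>y. y * _"] cong: if_cong)
  have "\<exists>c. \<forall>b\<in>A. \<phi> b = (\<Sum>a\<in>A. c a * P.Rq (fst a) (snd a) (fst b) (snd b))"
  proof (rule functional_in_row_span[OF A(1) A(1)])
    fix x :: "nat \<times> nat \<Rightarrow> complex"
    assume x: "\<forall>a\<in>A. (\<Sum>b\<in>A. P.Rq (fst a) (snd a) (fst b) (snd b) * x b) = 0"
    have "x (i, i') + x (i', i) = 0"
    proof (rule P.Rq_kernel[of "\<lambda>b d. x (b, d)"])
      fix a c assume "a \<in> {1..N}" "c \<in> {1..N}"
      then show "(\<Sum>b\<in>{1..N}. \<Sum>d\<in>{1..N}. P.Rq a c b d * x (b, d)) = 0"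
        using x[rule_format, of "(a, c)"] by (simp add: A_def sum.cartesian_product case_prod_beta)
    qed fact+
    then show "(\<Sum>b\<in>A. \<phi> b * x b) = 0" by (simp add: \<phi>_sum)
  qed
  then obtain c where c: "\<And>b. b \<in> A \<Longrightarrow> \<phi> b = (\<Sum>a\<in>A. c a * P.Rq (fst a) (snd a) (fst b) (snd b))"
    by blast
  define E where "E a v = (\<Sum>b\<in>A. P.Rq (fst a) (snd a) (fst b) (snd b) * V (fst b) (snd b) v)" for a v
  have E_mem: "E a \<in> ?I" if a: "a \<in> A" for a
  proof -
    obtain a1 a2 where a12: "a = (a1, a2)" "a1 \<in> {1..N}" "a2 \<in> {1..N}" using a by (auto simp: A_def)
    have "(\<lambda>v. RLL_entry lg N q p ch a1 a2 j j' z w v + (- 1) * RLL_entry lg N q p ch a1 a2 j' j z w v) \<in> ?I"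
      by (rule free_ideal_add[OF ideal_RLL_ideal _ free_ideal_scale[OF ideal_RLL_ideal]])
         (rule RLL_entry_mem; use a12 j zw q in simp)+
    moreover have "RLL_entry lg N q p ch a1 a2 j j' z w v + (- 1) * RLL_entry lg N q p ch a1 a2 j' j z w v = E a v" for v
    proof -
      \<comment> \<open>At ratio q the starred matrix is symmetric in j and j', so its contributions
        cancel in the difference of the two entries.\<close>
      have swap: "(\<Sum>b\<in>{1..N}. \<Sum>d\<in>{1..N}. (L_series a2 d w \<otimes>\<^bsub>free_ring N\<^esub> L_series a1 b z) v
             * Rhat lg N q (shift_nome lg q p ch) b d j j' q)
        = (\<Sum>b\<in>{1..N}. \<Sum>d\<in>{1..N}. (L_series a2 d w \<otimes>\<^bsub>free_ring N\<^esub> L_series a1 b z) v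
             * Rhat lg N q (shift_nome lg q p ch) b d j' j q)"
        by (intro sum.cong refl) (use j in \<open>simp add: P'.Rhat_at_q(1) P'.Rq_swap[of _ j _ j']\<close>)
      have "E a v = (\<Sum>b\<in>{1..N}. \<Sum>d\<in>{1..N}. Rhat lg N q p a1 a2 b d q
             * (L_series b j z \<otimes>\<^bsub>free_ring N\<^esub> L_series d j' w) v)
          - (\<Sum>b\<in>{1..N}. \<Sum>d\<in>{1..N}. Rhat lg N q p a1 a2 b d q
             * (L_series b j' z \<otimes>\<^bsub>free_ring N\<^esub> L_series d j w) v)"
        unfolding sum_subtractf[symmetric] E_def A_def sum.cartesian_product
        by (rule sum.cong) (use a12 in \<open>auto simp: V_def P.Rhat_at_q(1) right_diff_distrib\<close>)
      then show ?thesis unfolding RLL_entry_def zw(3) using swap by simp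
    qed
    ultimately show ?thesis by simp
  qed
  have "(\<lambda>v. \<Sum>a\<in>A. c a * E a v) \<in> ?I"
    by (intro free_ideal_sum[OF ideal_RLL_ideal A(1)] free_ideal_scale[OF ideal_RLL_ideal] E_mem)
  moreover have "(\<Sum>a\<in>A. c a * E a v) = V i i' v + V i' i v" for v
  proof -
    have "(\<Sum>a\<in>A. c a * E a v) = (\<Sum>b\<in>A. \<phi> b * V (fst b) (snd b) v)"
      unfolding E_def sum_distrib_left
      by (subst sum.swap) (simp add: c sum_distrib_right mult.assoc)
    then show ?thesis using \<phi>_sum[of "\<lambda>b. V (fst b) (snd b) v"] by simp
  qed
  ultimately show ?thesis by simp
qed

section \<open>The coproduct of the quantum determinant\<close>

lemma qdet_closed:
  assumes "ring R" "\<And>i j. i \<in> {1..N} \<Longrightarrow> j \<in> {1..N} \<Longrightarrow> L i j (z * q powi (1 - int i)) \<in> carrier R"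
  shows "qdet R N q L z \<in> carrier R"
proof -
  interpret ring R by fact
  have "lprod [1..<Suc N] (\<lambda>i. L i (\<sigma> i) (z * q powi (1 - int i))) \<in> carrier R"
    if "\<sigma> permutes {1..N}" for \<sigma>
  proof (rule lprod_closed)
    fix i assume "i \<in> set [1..<Suc N]"
    then have "i \<in> {1..N}" by auto
    moreover have "\<sigma> i \<in> {1..N}" using permutes_in_image[OF that] \<open>i \<in> {1..N}\<close> by blast
    ultimately show "L i (\<sigma> i) (z * q powi (1 - int i)) \<in> carrier R" by (rule assms(2))
  qed
  then show ?thesis
    unfolding qdet_def lprod_def[symmetric] by (intro finsum_closed) (auto intro: signed_closed)
qed

text \<open>Presents the determinant as the class of one in the free ring, the form that
  \<open>tensor_class_cosets\<close> accepts.\<close>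

lemma qdet_L_op:
  "qdet (ell_alg lg N q X p ch) N q (L_op lg N q X p ch) z
    = RLL_ideal lg N q X p ch +>\<^bsub>free_ring N\<^esub> qdet (free_ring N) N q L_series z"
  unfolding ell_alg_def L_op_def
  by (rule ring_hom_qdet[OF ring_free_ring ideal.quotient_is_ring ideal.rcos_ring_hom, symmetric])
     (rule ideal_RLL_ideal L_series_closed | assumption)+

theorem corollary4p2:
  fixes N :: nat and lg :: "complex \<Rightarrow> complex" and p q c1 c2 z :: complex
    and X :: "complex set"
    and \<Delta> :: "(letter list \<Rightarrow> complex) set \<Rightarrow> (letter list \<times> letter list \<Rightarrow> complex) set"
  assumes "N \<ge> 2"
    and "log_choice lg"
    and "p \<noteq> 0" and "q \<noteq> 0" and "norm p < 1" and "norm q < 1"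
    and "norm (shift_nome lg q p c2) < 1" and "norm (shift_nome lg q p (c1 + c2)) < 1"
    and "generic lg q p (c1 + c2)"
    and "generic lg q (shift_nome lg q p c2) c1"
    and "generic lg q p c2"
    and "X = regular_points lg N q {p, shift_nome lg q p c2, shift_nome lg q p (c1 + c2)}"
    and "quasi_hopf_coproduct lg N q X p c1 c2 \<Delta>"
    and "z \<noteq> 0"
  shows "\<Delta> (qdet (ell_alg lg N q X p (c1 + c2)) N q (L_op lg N q X p (c1 + c2)) z)
       = tensor_class N (RLL_ideal lg N q X (shift_nome lg q p c2) c1) (RLL_ideal lg N q X p c2)
           (qdet (ell_alg lg N q X (shift_nome lg q p c2) c1) N q
              (L_op lg N q X (shift_nome lg q p c2) c1) (z * cpow lg q (- c2 / 2)))
           (qdet (ell_alg lg N q X p c2) N q (L_op lg N q X p c2) (z * cpow lg q (c1 / 2)))"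
proof -
  define p' where "p' = shift_nome lg q p c2"
  define I1 where "I1 = RLL_ideal lg N q X p' c1"
  define I2 where "I2 = RLL_ideal lg N q X p c2"
  define A0 where "A0 = ell_alg lg N q X p (c1 + c2)"
  define z1 where "z1 = z * cpow lg q (- c2 / 2)"
  define z2 where "z2 = z * cpow lg q (c1 / 2)"
  note q0 = \<open>q \<noteq> 0\<close>
  have p'0: "p' \<noteq> 0" using \<open>p \<noteq> 0\<close> by (simp add: p'_def shift_nome_def cpow_def)
  have z1: "z1 \<noteq> 0" using \<open>z \<noteq> 0\<close> by (simp add: z1_def cpow_def)
  have shift: "shift_nome lg q p' c1 = shift_nome lg q p (c1 + c2)"
    unfolding p'_def by (rule shift_nome_shift_nome)
  have nome_p: "independent_nome N lg q p"
    by (rule generic_independent_nome) fact+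
  have nome_p': "independent_nome N lg q p'"
    unfolding p'_def by (rule generic_independent_shift_nome) fact+
  have nome_p'': "independent_nome N lg q (shift_nome lg q p' c1)"
    unfolding shift by (rule generic_independent_shift_nome) fact+
  have qX: "q \<in> X"
    unfolding \<open>X = _\<close> by (rule q_regular[OF q0]) (use nome_p nome_p' nome_p'' shift in \<open>auto simp: p'_def\<close>)
  have ideals: "ideal I1 (free_ring N)" "ideal I2 (free_ring N)"
    unfolding I1_def I2_def by (rule ideal_RLL_ideal)+
  interpret Q: quotient_tensor N I1 I2 by (rule quotient_tensor.intro) fact+
  define T where "T = tensor_alg N I1 I2"
  interpret F: ring "free_ring N" by (rule ring_free_ring)
  interpret T: ring T unfolding T_def by (rule Q.ring_tensor_alg)
  have left_hom: "Q.left \<in> ring_hom (free_ring N) T" and right_hom: "Q.right \<in> ring_hom (free_ring N) T"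
    unfolding T_def by (rule Q.left_hom Q.right_hom)+
  \<comment> \<open>The third index is the position in the ordered product, where the argument is
    multiplied by q^(1-n). A lives in the left factor of nome p', B in the right factor of nome
    p.\<close>
  define A where "A i j n = Q.left (L_series i j (z1 * q powi (1 - int n)))" for i j n
  define B where "B i j n = Q.right (L_series i j (z2 * q powi (1 - int n)))" for i j n
  have A_closed: "A i j n \<in> carrier T" and B_closed: "B i j n \<in> carrier T"
    if "i \<in> {1..N}" "j \<in> {1..N}" for i j n
    unfolding A_def B_def
    by (rule ring_hom_closed[OF left_hom L_series_closed[OF that]] ring_hom_closed[OF right_hom L_series_closed[OF that]])+
  have antisym: "A i j n \<otimes>\<^bsub>T\<^esub> A i' j' (Suc n) \<oplus>\<^bsub>T\<^esub> A i' j n \<otimes>\<^bsub>T\<^esub> A i j' (Suc n)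
      = A i j' n \<otimes>\<^bsub>T\<^esub> A i' j (Suc n) \<oplus>\<^bsub>T\<^esub> A i' j' n \<otimes>\<^bsub>T\<^esub> A i j (Suc n)"
    if i: "i \<in> {1..N}" "i' \<in> {1..N}" and j: "j \<in> {1..N}" "j' \<in> {1..N}" for n i i' j j'
  proof -
    define u where "u = z1 * q powi (1 - int n)"
    define w where "w = z1 * q powi (1 - int (Suc n))"
    have uw: "u \<noteq> 0" "w \<noteq> 0" "u / w = q"
      using z1 q0 by (simp_all add: u_def w_def power_int_diff power_int_minus)
    define m where "m i j i' j' = L_series i j u \<otimes>\<^bsub>free_ring N\<^esub> L_series i' j' w" for i j i' j'
    have mc: "m i j i' j' \<in> carrier (free_ring N)"
      if "i \<in> {1..N}" "j \<in> {1..N}" "i' \<in> {1..N}" "j' \<in> {1..N}" for i j i' j'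
      unfolding m_def using that by (intro F.m_closed L_series_closed)
    have Qm: "Q.left (m i j i' j') = A i j n \<otimes>\<^bsub>T\<^esub> A i' j' (Suc n)"
      if "i \<in> {1..N}" "j \<in> {1..N}" "i' \<in> {1..N}" "j' \<in> {1..N}" for i j i' j'
      unfolding m_def A_def u_def w_def
      by (rule ring_hom_mult[OF left_hom L_series_closed[OF that(1,2)] L_series_closed[OF that(3,4)]])
    \<comment> \<open>The difference of the two sides of the required identity; since it lies in I1,
      \<open>Q.left\<close> identifies them.\<close>
    define d where "d = (\<lambda>v. (m i j i' j' v - m i j' i' j v) + (m i' j i j' v - m i' j' i j v))"
    have d: "d \<in> I1"
      unfolding d_def m_def I1_def by (rule RLL_antisymmetric_mem[OF nome_p' nome_p'' qX uw i j])
    have dc: "d \<in> carrier (free_ring N)" using ideal.Icarr[OF ideals(1) d] .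
    have eq: "m i j i' j' \<oplus>\<^bsub>free_ring N\<^esub> m i' j i j' = d \<oplus>\<^bsub>free_ring N\<^esub> (m i j' i' j \<oplus>\<^bsub>free_ring N\<^esub> m i' j' i j)"
      by (simp add: series_ring_add d_def fun_eq_iff)
    have "Q.left (m i j i' j' \<oplus>\<^bsub>free_ring N\<^esub> m i' j i j') = Q.left (m i j' i' j \<oplus>\<^bsub>free_ring N\<^esub> m i' j' i j)"
      unfolding eq
      using ring_hom_add[OF left_hom dc F.a_closed[OF mc mc], of i j' i' j i' j' i j]
        ring_hom_closed[OF left_hom F.a_closed[OF mc mc], of i j' i' j i' j' i j] Q.left_eq_0[OF d] i j
      by (simp flip: T_def)
    then show ?thesis
      using ring_hom_add[OF left_hom mc mc, of i j i' j' i' j i j'] ring_hom_add[OF left_hom mc mc, of i j' i' j i' j' i j] i j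
      by (simp add: Qm)
  qed
  interpret row_antisymmetric T N A
  proof (rule row_antisymmetric.intro[OF T.ring_axioms row_antisymmetric_axioms.intro])
    show "x = \<zero>\<^bsub>T\<^esub>" if "x \<in> carrier T" "x \<oplus>\<^bsub>T\<^esub> x = \<zero>\<^bsub>T\<^esub>" for x
      using that unfolding T_def tensor_alg_def
      by (rule quotient_two_torsion_free[OF monoid_words2 ring_free_ring2 Q.ideal_tensor_ideal])
  qed (rule A_closed antisym; assumption)+
  have commute: "Q.left f \<otimes>\<^bsub>T\<^esub> Q.right g = Q.right g \<otimes>\<^bsub>T\<^esub> Q.left f"
    if "f \<in> carrier (free_ring N)" "g \<in> carrier (free_ring N)" for f g
    using Q.left_right_mult[OF that] by (simp add: T_def)
  note \<Delta> = \<open>quasi_hopf_coproduct lg N q X p c1 c2 \<Delta>\<close>[unfolded quasi_hopf_coproduct_def Let_def,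
      folded p'_def, folded I1_def I2_def A0_def, folded T_def]
  have \<Delta>_hom: "\<Delta> \<in> ring_hom A0 T" using \<Delta> by blast
  have \<Delta>_L: "\<Delta> (L_op lg N q X p (c1 + c2) i j x)
        = (\<Oplus>\<^bsub>T\<^esub>k\<in>{1..N}. Q.right (L_series i k (x * cpow lg q (c1 / 2))) \<otimes>\<^bsub>T\<^esub> Q.left (L_series k j (x * cpow lg q (- c2 / 2))))"
    if ij: "i \<in> {1..N}" "j \<in> {1..N}" and x: "x \<noteq> 0" for i j x
  proof -
    have one: "\<one>\<^bsub>ell_alg lg N q X p' c1\<^esub> = I1 +>\<^bsub>free_ring N\<^esub> \<one>\<^bsub>free_ring N\<^esub>"
      "\<one>\<^bsub>ell_alg lg N q X p c2\<^esub> = I2 +>\<^bsub>free_ring N\<^esub> \<one>\<^bsub>free_ring N\<^esub>"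
      by (simp_all add: ell_alg_def FactRing_def I1_def I2_def)
    have class1: "tensor_class N I1 I2 \<one>\<^bsub>ell_alg lg N q X p' c1\<^esub> (L_op lg N q X p c2 i k y) = Q.right (L_series i k y)"
      and class2: "tensor_class N I1 I2 (L_op lg N q X p' c1 k j y) \<one>\<^bsub>ell_alg lg N q X p c2\<^esub> = Q.left (L_series k j y)"
      if k: "k \<in> {1..N}" for k y
    proof -
      have L: "L_series i k y \<in> carrier (free_ring N)" "L_series k j y \<in> carrier (free_ring N)"
        using L_series_closed k ij by blast+
      show "tensor_class N I1 I2 \<one>\<^bsub>ell_alg lg N q X p' c1\<^esub> (L_op lg N q X p c2 i k y) = Q.right (L_series i k y)"
        unfolding one L_op_def I2_def[symmetric] Q.tensor_class_cosets[OF F.one_closed L(1)] T_def[symmetric]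
          ring_hom_one[OF left_hom]
        by (rule T.l_one[OF ring_hom_closed[OF right_hom L(1)]])
      show "tensor_class N I1 I2 (L_op lg N q X p' c1 k j y) \<one>\<^bsub>ell_alg lg N q X p c2\<^esub> = Q.left (L_series k j y)"
        unfolding one L_op_def I1_def[symmetric] Q.tensor_class_cosets[OF L(2) F.one_closed] T_def[symmetric]
          ring_hom_one[OF right_hom]
        by (rule T.r_one[OF ring_hom_closed[OF left_hom L(2)]])
    qed
    have "\<Delta> (L_op lg N q X p (c1 + c2) i j x) = (\<Oplus>\<^bsub>T\<^esub>k\<in>{1..N}.
        tensor_class N I1 I2 \<one>\<^bsub>ell_alg lg N q X p' c1\<^esub> (L_op lg N q X p c2 i k (x * cpow lg q (c1 / 2)))
        \<otimes>\<^bsub>T\<^esub> tensor_class N I1 I2 (L_op lg N q X p' c1 k j (x * cpow lg q (- c2 / 2))) \<one>\<^bsub>ell_alg lg N q X p c2\<^esub>)"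
      using \<Delta> ij x by blast
    also have "\<dots> = (\<Oplus>\<^bsub>T\<^esub>k\<in>{1..N}. Q.right (L_series i k (x * cpow lg q (c1 / 2))) \<otimes>\<^bsub>T\<^esub> Q.left (L_series k j (x * cpow lg q (- c2 / 2))))"
      by (rule T.finsum_cong')
         (use ij in \<open>auto simp: class1 class2 intro!: T.m_closed ring_hom_closed[OF left_hom] ring_hom_closed[OF right_hom] L_series_closed\<close>)
    finally show "\<Delta> (L_op lg N q X p (c1 + c2) i j x)
        = (\<Oplus>\<^bsub>T\<^esub>k\<in>{1..N}. Q.right (L_series i k (x * cpow lg q (c1 / 2))) \<otimes>\<^bsub>T\<^esub> Q.left (L_series k j (x * cpow lg q (- c2 / 2))))" .
  qed
  have ring_A0: "ring A0"
    unfolding A0_def ell_alg_def by (rule ideal.quotient_is_ring[OF ideal_RLL_ideal])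
  have L_op_closed: "L_op lg N q X p (c1 + c2) i j x \<in> carrier A0"
    if "i \<in> {1..N}" "j \<in> {1..N}" for i j x
    unfolding A0_def ell_alg_def L_op_def
    by (rule ring_hom_closed[OF ideal.rcos_ring_hom[OF ideal_RLL_ideal] L_series_closed[OF that]])
  have qdet_free: "qdet (free_ring N) N q L_series x \<in> carrier (free_ring N)" for x
    by (rule qdet_closed[OF ring_free_ring L_series_closed])
  have "\<Delta> (qdet A0 N q (L_op lg N q X p (c1 + c2)) z)
      = qdet T N q (\<lambda>i j z. \<Delta> (L_op lg N q X p (c1 + c2) i j z)) z"
    by (rule ring_hom_qdet[OF ring_A0 T.ring_axioms \<Delta>_hom L_op_closed])
  also have "\<dots> = (\<Oplus>\<^bsub>T\<^esub>\<sigma>\<in>perms. T.signed \<sigma> (T.lprod [1..<Suc N] (\<lambda>n. \<Oplus>\<^bsub>T\<^esub>k\<in>{1..N}. B n k n \<otimes>\<^bsub>T\<^esub> A k (\<sigma> n) n)))"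
    unfolding qdet_def T.lprod_def[symmetric]
  proof (rule T.finsum_cong'[OF refl])
    show "(\<lambda>\<sigma>. T.signed \<sigma> (T.lprod [1..<Suc N] (\<lambda>n. \<Oplus>\<^bsub>T\<^esub>k\<in>{1..N}. B n k n \<otimes>\<^bsub>T\<^esub> A k (\<sigma> n) n))) \<in> perms \<rightarrow> carrier T"
      by (intro Pi_I T.signed_closed T.lprod_closed T.finsum_closed T.m_closed A_closed B_closed)
         (auto dest: permutes_in_image simp: less_Suc_eq_le)
  next
    fix \<sigma> assume \<sigma>: "\<sigma> \<in> perms"
    have "T.lprod [1..<Suc N] (\<lambda>i. \<Delta> (L_op lg N q X p (c1 + c2) i (\<sigma> i) (z * q powi (1 - int i))))
        = T.lprod [1..<Suc N] (\<lambda>n. \<Oplus>\<^bsub>T\<^esub>k\<in>{1..N}. B n k n \<otimes>\<^bsub>T\<^esub> A k (\<sigma> n) n)"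
    proof (rule T.lprod_cong)
      fix n assume "n \<in> set [1..<Suc N]"
      then have n: "n \<in> {1..N}" by auto
      have \<sigma>n: "\<sigma> n \<in> {1..N}" using is_indexD[OF is_index_perm n] \<sigma> by blast
      have z: "z * q powi (1 - int n) \<noteq> 0" using \<open>z \<noteq> 0\<close> q0 by simp
      show "\<Delta> (L_op lg N q X p (c1 + c2) n (\<sigma> n) (z * q powi (1 - int n)))
          = (\<Oplus>\<^bsub>T\<^esub>k\<in>{1..N}. B n k n \<otimes>\<^bsub>T\<^esub> A k (\<sigma> n) n)"
        unfolding \<Delta>_L[OF n \<sigma>n z] A_def B_def z1_def z2_def by (simp only: mult_ac)
    qed
    then show "T.signed \<sigma> (T.lprod [1..<Suc N] (\<lambda>i. \<Delta> (L_op lg N q X p (c1 + c2) i (\<sigma> i) (z * q powi (1 - int i)))))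
        = T.signed \<sigma> (T.lprod [1..<Suc N] (\<lambda>n. \<Oplus>\<^bsub>T\<^esub>k\<in>{1..N}. B n k n \<otimes>\<^bsub>T\<^esub> A k (\<sigma> n) n))" by simp
  qed
  also have "\<dots> = qdet T N q (\<lambda>i j z. Q.right (L_series i j z)) z2 \<otimes>\<^bsub>T\<^esub> qdet T N q (\<lambda>i j z. Q.left (L_series i j z)) z1"
    unfolding qdet_def T.lprod_def[symmetric] A_def[symmetric] B_def[symmetric]
    by (rule determinant_product) (rule B_closed, assumption+, unfold A_def B_def, rule commute, (rule L_series_closed, assumption+)+)
  also have "\<dots> = Q.right (qdet (free_ring N) N q L_series z2) \<otimes>\<^bsub>T\<^esub> Q.left (qdet (free_ring N) N q L_series z1)"
    using ring_hom_qdet[OF ring_free_ring T.ring_axioms left_hom L_series_closed]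
      ring_hom_qdet[OF ring_free_ring T.ring_axioms right_hom L_series_closed] by simp
  \<comment> \<open>The coproduct puts the right factor first, the tensor class the left one; the
    two commute.\<close>
  also have "\<dots> = tensor_class N I1 I2 (I1 +>\<^bsub>free_ring N\<^esub> qdet (free_ring N) N q L_series z1)
      (I2 +>\<^bsub>free_ring N\<^esub> qdet (free_ring N) N q L_series z2)"
    unfolding Q.tensor_class_cosets[OF qdet_free qdet_free] T_def[symmetric]
    by (rule commute[OF qdet_free qdet_free, symmetric])
  finally show ?thesis
    unfolding A0_def[symmetric] p'_def[symmetric] I1_def[symmetric] I2_def[symmetric]
      z1_def[symmetric] z2_def[symmetric] qdet_L_op .
qed

end
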